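(* Let $m\geq 2$ be an even integer and $K$ a totally real number field. The set of all $m$th powerfree indecomposables (viewed as classes in $\mathcal{O}_K^+/\mathcal{O}_K^{\times m}$) is contained in the set $\overline{\mathcal{C}}_K^{(m)}$ of all critical elements.
   Context: $\mathcal{O}_K$ is the ring of integers of $K$, $\mathcal{O}_K^+$ the set of its totally positive elements, and $\mathcal{O}_K^+/\mathcal{O}_K^{\times m}$ the set of classes of totally positive integers up to multiplication by $m$th powers of units. An element $\alpha\in\mathcal{O}_K^+$ is indecomposable if it cannot be written as $\beta+\gamma$ with $\beta,\gamma\in\mathcal{O}_K^+$. An element $\alpha\in\mathcal{O}_K$ is $m$th powerfree if $\beta^m\mid\alpha$ with $\beta\in\mathcal{O}_K$ implies $\beta\in\mathcal{O}_K^\times$. A diagonal $m$-ic form over $K$ of rank $n$ is $Q(x)=\sum_{i=1}^n a_ix_i^m$ with $a_i\in\mathcal{O}_K$; it is totally positive definite if all $a_i$ are totally positive; the empty form of rank $0$ (representing only $0$) is included by convention. $Q$ represents $\alpha$ if $Q(x)=\alpha$ for some $x\in\mathcal{O}_K^n$ (this depends only on the class of $\alpha$ modulo $\mathcal{O}_K^{\times m}$). A class $\alpha\in\mathcal{O}_K^+/\mathcal{O}_K^{\times m}$ is critical if there is a totally positive definite diagonal $m$-ic form over $K$ that does not represent $\alpha$ but represents all elements of $(\mathcal{O}_K^+/\mathcal{O}_K^{\times m})\setminus\{\alpha\}$. $\overline{\mathcal{C}}_K^{(m)}$ denotes the set of all critical elements. *)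

theory Defs
  imports Complex_Main "HOL-Computational_Algebra.Polynomial"
begin

(* A number field K is modelled as a type of class field_char_0 that is
   finite-dimensional over the rationals. *)

lemma vector_space_of_rat:
  "vector_space (\<lambda>(q::rat) (x::'k::field_char_0). of_rat q * x)"
  by unfold_locales (simp_all add: algebra_simps of_rat_add of_rat_mult)

definition number_field :: "'k::field_char_0 itself \<Rightarrow> bool" where
  "number_field _ \<longleftrightarrow>
     (\<exists>B::'k set. finite B \<and> module.span (\<lambda>(q::rat) (x::'k). of_rat q * x) B = UNIV)"

definition field_embedding :: "('k::field \<Rightarrow> 'l::field) \<Rightarrow> bool" where
  "field_embedding \<sigma> \<longleftrightarrow>
     \<sigma> 1 = 1 \<and> (\<forall>x y. \<sigma> (x + y) = \<sigma> x + \<sigma> y) \<and> (\<forall>x y. \<sigma> (x * y) = \<sigma> x * \<sigma> y)"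

definition totally_real :: "'k::field_char_0 itself \<Rightarrow> bool" where
  "totally_real _ \<longleftrightarrow> (\<forall>\<sigma>::'k \<Rightarrow> complex. field_embedding \<sigma> \<longrightarrow> range \<sigma> \<subseteq> \<real>)"

definition ring_of_integers :: "'k::field_char_0 set" where
  "ring_of_integers = {x. algebraic_int x}"

definition integer_units :: "'k::field_char_0 set" where
  "integer_units = {u \<in> ring_of_integers. \<exists>v\<in>ring_of_integers. u * v = 1}"

definition totally_positive :: "'k::field_char_0 \<Rightarrow> bool" where
  "totally_positive x \<longleftrightarrow> (\<forall>\<sigma>::'k \<Rightarrow> real. field_embedding \<sigma> \<longrightarrow> \<sigma> x > 0)"

definition positive_integers :: "'k::field_char_0 set" where
  "positive_integers = {x \<in> ring_of_integers. totally_positive x}"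

definition indecomposable :: "'k::field_char_0 \<Rightarrow> bool" where
  "indecomposable \<alpha> \<longleftrightarrow> \<alpha> \<in> positive_integers \<and>
     \<not> (\<exists>\<beta>\<in>positive_integers. \<exists>\<gamma>\<in>positive_integers. \<alpha> = \<beta> + \<gamma>)"

(* Divisibility is in the ring of integers; the class operation dvd on 'k would be
   divisibility in the field. *)
definition integer_dvd :: "'k::field_char_0 \<Rightarrow> 'k \<Rightarrow> bool" where
  "integer_dvd \<beta> \<alpha> \<longleftrightarrow> (\<exists>\<gamma>\<in>ring_of_integers. \<alpha> = \<beta> * \<gamma>)"

definition powerfree :: "nat \<Rightarrow> 'k::field_char_0 \<Rightarrow> bool" where
  "powerfree m \<alpha> \<longleftrightarrow> \<alpha> \<in> ring_of_integers \<and>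
     (\<forall>\<beta>\<in>ring_of_integers. integer_dvd (\<beta> ^ m) \<alpha> \<longrightarrow> \<beta> \<in> integer_units)"

definition unit_power_rel :: "nat \<Rightarrow> ('k::field_char_0 \<times> 'k) set" where
  "unit_power_rel m = {(\<alpha>, \<beta>). \<alpha> \<in> positive_integers \<and> \<beta> \<in> positive_integers \<and>
     (\<exists>u\<in>integer_units. \<beta> = \<alpha> * u ^ m)}"

definition positive_classes :: "nat \<Rightarrow> 'k::field_char_0 set set" where
  "positive_classes m = positive_integers // unit_power_rel m"

(* A diagonal form of rank n is given by the list of its n coefficients;
   the empty list is the form of rank 0. *)
definition totally_positive_definite :: "'k::field_char_0 list \<Rightarrow> bool" where
  "totally_positive_definite as \<longleftrightarrow> set as \<subseteq> positive_integers"

definition diagonal_form :: "nat \<Rightarrow> 'k::field_char_0 list \<Rightarrow> 'k list \<Rightarrow> 'k" where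
  "diagonal_form m as xs = (\<Sum>i<length as. as ! i * (xs ! i) ^ m)"

definition represents :: "nat \<Rightarrow> 'k::field_char_0 list \<Rightarrow> 'k \<Rightarrow> bool" where
  "represents m as \<alpha> \<longleftrightarrow>
     (\<exists>xs. length xs = length as \<and> set xs \<subseteq> ring_of_integers \<and> diagonal_form m as xs = \<alpha>)"

(* Representability depends only on the class: replace each x_i by x_i * u. Hence
   "some element of the class" and "every element of the class" mean the same here. *)
definition represents_class :: "nat \<Rightarrow> 'k::field_char_0 list \<Rightarrow> 'k set \<Rightarrow> bool" where
  "represents_class m as C \<longleftrightarrow> (\<exists>\<alpha>\<in>C. represents m as \<alpha>)"

definition critical_classes :: "nat \<Rightarrow> 'k::field_char_0 set set" where
  "critical_classes m = {C \<in> positive_classes m. \<exists>as. totally_positive_definite as \<and>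
     \<not> represents_class m as C \<and> (\<forall>D\<in>positive_classes m - {C}. represents_class m as D)}"

end

(*
  Let alpha be an m-th powerfree indecomposable.  Since m is even, every nonzero term a x^m of a totally
  positive definite form is totally positive, so the form can represent alpha only through a single term,
  and then x is a unit and a lies in the class of alpha, and a is indecomposable.  Hence a form whose
  coefficients are decomposable or lie in a finite set of integers outside the class of alpha never
  represents alpha.

  Such a form can represent everything else.  A pigeonhole argument (which replaces Minkowski's theorem and
  the unit theorem) makes all conjugates of beta comparable after multiplication by an m-th power of a unit.
  For a totally positive integral generator theta, a balanced beta is then either in a finite set or of the
  form N tau + sum_j n_j theta^j + rho, with tau and rho in finite sets, rho decomposable and N, n_j >= 2.
  It remains to represent all natural numbers by one diagonal m-ic form over the natural numbers, which is
  Waring's problem for an even exponent.  By Hilbert's identity A |v|^m + h(v) is, for any form h of degree m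
  and large A, a positive rational combination of m-th powers of rational linear forms.  With
  h(v) = sum_j s^j x_j, prescribing the digits x_j < s and completing |v|^2 to a given T by four squares
  yields all integers in an interval of length s^m above A T^(m/2).  Hilbert's identity itself follows from
  a rational law with positive weights that shares its first moments with the Gaussian law.
*)

theory Submission
  imports "HOL-Algebra.Algebraic_Closure_Type" "Jordan_Normal_Form.Char_Poly"
    "HOL-Computational_Algebra.Polynomial" "HOL-Computational_Algebra.Primes" Defs
begin

subsection \<open>Lagrange's four square theorem\<close>

text \<open>Two positivity demands drive the constructions. A coefficient of the form is harmless
  for \<alpha> once it is decomposable, but natural building blocks such as \<theta>^0 = 1 are
  indecomposable and may themselves lie in the class of \<alpha>. They are therefore used only with
  multiplicities N >= 2, which can be spread over the decomposable elements 2 \<tau> and 3 \<tau>.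
  These multiplicities are unbounded while the rank is fixed, which is what brings in Waring's
  problem; arbitrary positive coefficients are allowed there, so weighted mth powers of linear forms
  are good enough. In Hilbert's identity it is the weights that have to be positive. The functionals
  that extract single monomials are signed, and they can be absorbed into a multiple of the Gaussian
  part only if that part gives positive mass to every node they use. Hence a law is wanted that has
  finite rational support, positive mass everywhere and exact Gaussian moments up to order
  2k.\<close>

definition four_sq :: "int \<Rightarrow> bool" where
  "four_sq n \<longleftrightarrow> (\<exists>a b c d. n = a^2 + b^2 + c^2 + d^2)"

lemma euler_four_square:
  fixes a b c d x y z w :: int
  shows "(a^2+b^2+c^2+d^2) * (x^2+y^2+z^2+w^2) =
     (a*x+b*y+c*z+d*w)^2 + (a*y-b*x+c*w-d*z)^2 + (a*z-b*w-c*x+d*y)^2 + (a*w+b*z-c*y-d*x)^2"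
  by (simp add: power2_eq_square algebra_simps)

lemma four_sq_mult: "four_sq m \<Longrightarrow> four_sq n \<Longrightarrow> four_sq (m * n)"
  unfolding four_sq_def by (elim exE) (hypsubst, subst euler_four_square, blast)

lemma centered_residue:
  fixes m a :: int
  assumes "m > 0"
  obtains r where "m dvd a - r" "2 * \<bar>r\<bar> \<le> m"
proof -
  define s where "s = a mod m"
  have s: "0 \<le> s" "s < m" "m dvd a - s"
    using assms by (auto simp: s_def mod_eq_dvd_iff[symmetric])
  show thesis
  proof (cases "2 * s \<le> m")
    case True then show ?thesis using s(1) by (intro that[OF s(3)]) simp
  next
    case False
    have "m dvd (a - s) + m" using s(3) by simp
    then have "m dvd a - (s - m)" by (simp add: algebra_simps)
    then show ?thesis by (rule that) (use False s(1,2) in arith)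
  qed
qed

lemma centered_residue_bound:
  fixes r m :: int
  assumes "2 * \<bar>r\<bar> \<le> m"
  shows "4 * r^2 \<le> m^2"
proof -
  have "(2 * \<bar>r\<bar>)^2 \<le> m^2" using assms by (intro power_mono) simp_all
  moreover have "(2 * \<bar>r\<bar>)^2 = 4 * r^2" unfolding power_mult_distrib power2_abs by simp
  ultimately show ?thesis by linarith
qed

text \<open>The terms of an even sum of four squares fall into two pairs of equal parity, and a^2 +
  b^2 = 2 (((a+b)/2)^2 + ((a-b)/2)^2) for such a pair. In the proof (a+b)/2 and (a-b)/2 appear as
  \<open>b+u\<close> and \<open>u\<close>.\<close>

lemma four_sq_half:
  assumes "m = 2 * k" "four_sq (m * p)"
  shows "four_sq (k * p)"
proof -
  obtain a b c d where e: "m * p = a^2+b^2+c^2+d^2" using assms(2) unfolding four_sq_def by blast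
  have pairs: "\<exists>a b c d. m * p = a^2+b^2+c^2+d^2 \<and> even (a - b) \<and> even (c - d)"
  proof -
    have "even (a^2+b^2+c^2+d^2)" using e assms(1) by (metis dvd_mult2 dvd_triv_left)
    then have ev: "even (a+b+c+d)" by auto
    consider "even (a-b)" | "even (a-c)" | "even (a-d)" using ev by (cases "even a"; cases "even b"; cases "even c"; cases "even d"; simp)
    then show ?thesis
    proof cases
      case 1 then have "even (c-d)" using ev by auto
      then show ?thesis using e 1 by blast
    next
      case 2 then have "even (b-d)" using ev by auto
      moreover have "m * p = a^2+c^2+b^2+d^2" using e by simp
      ultimately show ?thesis using 2 by blast
    next
      case 3 then have "even (b-c)" using ev by auto
      moreover have "m * p = a^2+d^2+b^2+c^2" using e by simp
      ultimately show ?thesis using 3 by blast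
    qed
  qed
  then obtain a b c d where e: "m * p = a^2+b^2+c^2+d^2" "even (a-b)" "even (c-d)" by blast
  obtain u where u: "a - b = 2 * u" using e(2) by (rule evenE)
  obtain v where v: "c - d = 2 * v" using e(3) by (rule evenE)
  have ab: "a = b + 2 * u" "c = d + 2 * v" using u v by auto
  have "2 * (k * p) = 2 * ((b+u)^2 + u^2 + (d+v)^2 + v^2)"
    using e(1) unfolding assms(1) ab by (simp add: power2_eq_square algebra_simps)
  then have "k * p = (b+u)^2 + u^2 + (d+v)^2 + v^2" by simp
  then show ?thesis unfolding four_sq_def by blast
qed

text \<open>Lagrange's descent. For odd m the centred residues of a, b, c, d have squares summing to
  m k with k < m. By Euler's identity (m p)(m k) is a sum of four squares whose bases are all
  divisible by m, and m^2 cancels.\<close>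

lemma four_sq_descent:
  fixes m p :: int
  assumes m: "1 < m" "m < p" and p: "prime p" and f: "four_sq (m * p)"
  shows "\<exists>k. 0 < k \<and> k < m \<and> four_sq (k * p)"
proof (cases "even m")
  case True
  then obtain k where "m = 2 * k" by auto
  then show ?thesis using four_sq_half[OF _ f] m by (intro exI[of _ k]) auto
next
  case False
  obtain a b c d where e: "m * p = a^2+b^2+c^2+d^2" using f unfolding four_sq_def by blast
  have m0: "m > 0" using m by auto
  obtain x where x: "m dvd a - x" "2 * \<bar>x\<bar> \<le> m" using centered_residue[OF m0] by blast
  obtain y where y: "m dvd b - y" "2 * \<bar>y\<bar> \<le> m" using centered_residue[OF m0] by blast
  obtain z where z: "m dvd c - z" "2 * \<bar>z\<bar> \<le> m" using centered_residue[OF m0] by blast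
  obtain w where w: "m dvd d - w" "2 * \<bar>w\<bar> \<le> m" using centered_residue[OF m0] by blast
  \<comment> \<open>For odd m no centred residue has absolute value m/2. Without strictness k = m
    could occur and the descent would stall; this is why even m is halved separately.\<close>
  have strict: "2 * \<bar>r\<bar> < m" if "2 * \<bar>r\<bar> \<le> m" for r using that False by (cases "2 * \<bar>r\<bar> = m") auto
  obtain a' where da: "a = x + m * a'" using x(1) by (auto simp: dvd_def algebra_simps)
  obtain b' where db: "b = y + m * b'" using y(1) by (auto simp: dvd_def algebra_simps)
  obtain c' where dc: "c = z + m * c'" using z(1) by (auto simp: dvd_def algebra_simps)
  obtain d' where dd: "d = w + m * d'" using w(1) by (auto simp: dvd_def algebra_simps)
  note dec = da db dc dd
  have "x^2+y^2+z^2+w^2 = m * (p - (2*x*a'+m*a'^2+2*y*b'+m*b'^2+2*z*c'+m*c'^2+2*w*d'+m*d'^2))"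
    using e unfolding dec by (simp add: power2_eq_square algebra_simps)
  then obtain k where k: "x^2+y^2+z^2+w^2 = m * k" by blast
  have sq: "4 * r^2 < m^2" if "2 * \<bar>r\<bar> \<le> m" for r
  proof -
    have "(2 * \<bar>r\<bar>)^2 < m^2" using strict[OF that] by (intro power_strict_mono) simp_all
    moreover have "(2 * \<bar>r\<bar>)^2 = 4 * r^2" unfolding power_mult_distrib power2_abs by simp
  ultimately show ?thesis by linarith
  qed
  have "4 * (x^2+y^2+z^2+w^2) < 4 * (m^2)"
    using sq[OF x(2)] sq[OF y(2)] sq[OF z(2)] sq[OF w(2)] unfolding distrib_left by linarith
  then have "m * k < m * m" using k by (simp add: power2_eq_square)
  then have km: "k < m" using m0 by simp
  have "0 \<le> m * k" unfolding k[symmetric] by simp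
  then have k0: "k \<ge> 0" using m0 by (simp add: zero_le_mult_iff)
  have "k \<noteq> 0"
  proof
    assume "k = 0"
    then have "x^2+y^2+z^2+w^2 = 0" using k by simp
    then have "x = 0" "y = 0" "z = 0" "w = 0" by (simp_all add: add_nonneg_eq_0_iff)
    then have "m * p = m * (m * (a'^2+b'^2+c'^2+d'^2))"
      using e dec by (simp add: power2_eq_square algebra_simps)
    then have "m dvd p" using m0 by simp
    then show False using p m by (metis prime_int_not_dvd)
  qed
  have E: "(m*p) * (m*k) =
    (a*x+b*y+c*z+d*w)^2 + (a*y-b*x+c*w-d*z)^2 + (a*z-b*w-c*x+d*y)^2 + (a*w+b*z-c*y-d*x)^2"
    unfolding k[symmetric] e by (rule euler_four_square)
  define A where "A = k + (a'*x+b'*y+c'*z+d'*w)"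
  define B where "B = a'*y-b'*x+c'*w-d'*z"
  define C where "C = a'*z-b'*w-c'*x+d'*y"
  define D where "D = a'*w+b'*z-c'*y-d'*x"
  have "a*x+b*y+c*z+d*w = m * A" using k unfolding A_def dec by (simp add: power2_eq_square algebra_simps)
  moreover have "a*y-b*x+c*w-d*z = m * B" unfolding B_def dec by (simp add: algebra_simps)
  moreover have "a*z-b*w-c*x+d*y = m * C" unfolding C_def dec by (simp add: algebra_simps)
  moreover have "a*w+b*z-c*y-d*x = m * D" unfolding D_def dec by (simp add: algebra_simps)
  ultimately have "m^2 * (k * p) = m^2 * (A^2+B^2+C^2+D^2)"
    using E by (simp add: power2_eq_square algebra_simps)
  then have "k * p = A^2+B^2+C^2+D^2" using m0 by simp
  then show ?thesis using k0 \<open>k \<noteq> 0\<close> km unfolding four_sq_def by (intro exI[of _ k]) auto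
qed

text \<open>Pigeonhole: the (p+1)/2 numbers below p/2 have distinct squares mod p, so the residues
  of a^2 and those of -1 - b^2 are together p + 1 in number and must meet. The bounds on a and b
  later keep the multiple of p below p^2.\<close>

lemma sum_two_squares_plus_one:
  fixes p :: int
  assumes "prime p" "odd p"
  obtains a b :: int where "p dvd a^2 + b^2 + 1" "0 \<le> a" "2 * a < p" "0 \<le> b" "2 * b < p"
proof -
  define I where "I = {a::int. 0 \<le> a \<and> 2 * a < p}"
  have p2: "p > 0" using assms by (simp add: prime_gt_0_int)
  have I: "I = {0..(p - 1) div 2}" using assms(2) unfolding I_def by auto
  have fI: "finite I" and cI: "2 * int (card I) = p + 1" using assms(2) p2 unfolding I by auto
  define f where "f = (\<lambda>a::int. a^2 mod p)"
  define g where "g = (\<lambda>a::int. (- 1 - a^2) mod p)"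
  have key: "x = y" if "x \<in> I" "y \<in> I" "p dvd x^2 - y^2" for x y
  proof -
    have "p dvd (x - y) * (x + y)" using that(3) by (simp add: power2_eq_square algebra_simps)
    then have "p dvd x - y \<or> p dvd x + y" using assms(1) by (simp add: prime_dvd_mult_iff)
    moreover have "\<bar>x - y\<bar> < p" "\<bar>x + y\<bar> < p" using that unfolding I_def by auto
    ultimately have "x - y = 0 \<or> x + y = 0"
      using dvd_imp_le_int[of "x - y" p] dvd_imp_le_int[of "x + y" p] p2 by linarith
    then show ?thesis using that unfolding I_def by auto
  qed
  have "inj_on f I"
  proof (rule inj_onI)
    fix x y assume "x \<in> I" "y \<in> I" "f x = f y"
    then have "p dvd x^2 - y^2" by (simp add: f_def mod_eq_dvd_iff)
    then show "x = y" using key \<open>x \<in> I\<close> \<open>y \<in> I\<close> by blast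
  qed
  moreover have "inj_on g I"
  proof (rule inj_onI)
    fix x y assume "x \<in> I" "y \<in> I" "g x = g y"
    then have "p dvd y^2 - x^2" by (simp add: g_def mod_eq_dvd_iff)
    then show "x = y" using key \<open>x \<in> I\<close> \<open>y \<in> I\<close> by blast
  qed
  ultimately have "card (f ` I) = card I" "card (g ` I) = card I" by (simp_all add: card_image)
  moreover have "f ` I \<union> g ` I \<subseteq> {0..<p}"
    unfolding f_def g_def using pos_mod_sign[OF p2] pos_mod_bound[OF p2] by (intro Un_least image_subsetI) simp_all
  then have "card (f ` I \<union> g ` I) \<le> nat p" using card_mono[of "{0..<p}"] by simp
  ultimately have cards: "card (f ` I) = card I" "card (g ` I) = card I" "card (f ` I \<union> g ` I) \<le> nat p"
    by blast+
  have "f ` I \<inter> g ` I \<noteq> {}"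
  proof
    assume "f ` I \<inter> g ` I = {}"
    then have "card (f ` I \<union> g ` I) = card I + card I"
      using fI card_Un_disjoint[of "f ` I" "g ` I"] cards by simp
    then show False using cards(3) cI p2 by linarith
  qed
  then obtain a b where "a \<in> I" "b \<in> I" "f a = g b" by blast
  then have "p dvd a^2 - (- 1 - b^2)" by (simp add: f_def g_def mod_eq_dvd_iff)
  then have "p dvd a^2 + b^2 + 1" by (simp add: algebra_simps)
  then show ?thesis using that \<open>a \<in> I\<close> \<open>b \<in> I\<close> unfolding I_def by auto
qed

lemma four_sq_prime:
  fixes p :: int
  assumes "prime p"
  shows "four_sq p"
proof (cases "p = 2")
  case True
  have "(2::int) = 1^2 + 1^2 + 0^2 + 0^2" by simp
  then show ?thesis unfolding True four_sq_def by blast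
next
  case False
  then have "odd p" using assms using prime_odd_int[of p] prime_ge_2_int[of p] by auto
  then obtain a b where ab: "p dvd a^2 + b^2 + 1" "0 \<le> a" "2 * a < p" "0 \<le> b" "2 * b < p"
    using sum_two_squares_plus_one assms by blast
  have p1: "p > 2" using False assms by (metis order_less_le prime_ge_2_int)
  have "4*a^2 \<le> (p-1)^2" "4*b^2 \<le> (p-1)^2"
    by (rule centered_residue_bound, use ab in simp)+
  then have "4 * (a^2 + b^2 + 1) \<le> 2 * (p-1)^2 + 4" by simp
  also have "\<dots> < 4 * p^2"
  proof -
    have "(p-1)^2 < p^2" using p1 by (intro power_strict_mono) simp_all
    moreover have "4 < p^2" using p1 power_strict_mono[of 2 p 2] by simp
    ultimately show ?thesis by linarith
  qed
  finally have lt: "a^2 + b^2 + 1 < p * p" by (simp add: power2_eq_square)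
  obtain m where m: "a^2 + b^2 + 1 = p * m" using ab(1) by blast
  have "m < p" using lt p1 unfolding m by simp
  moreover have "m > 0"
  proof -
    have "0 < a^2 + b^2 + 1" by (simp add: add_nonneg_pos)
    then show ?thesis using p1 unfolding m by (simp add: zero_less_mult_iff)
  qed
  moreover have "four_sq (m * p)"
    using m unfolding four_sq_def
    by (intro exI[of _ a] exI[of _ b] exI[of _ 1] exI[of _ 0]) (simp add: mult.commute)
  ultimately have ex: "\<exists>n::nat. n > 0 \<and> int n < p \<and> four_sq (int n * p)"
    by (intro exI[of _ "nat m"]) auto
  \<comment> \<open>A least multiplier above 1 would be lowered by
    \<open>four_sq_descent\<close>.\<close>
  define n where "n = (LEAST n::nat. n > 0 \<and> int n < p \<and> four_sq (int n * p))"
  have n: "n > 0" "int n < p" "four_sq (int n * p)" using LeastI_ex[OF ex] unfolding n_def by auto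
  have "n = 1"
  proof (rule ccontr)
    assume "n \<noteq> 1"
    then obtain k where k: "0 < k" "k < int n" "four_sq (k * p)"
      using four_sq_descent[of "int n" p] n assms by auto
    moreover have "k < p" using k n by linarith
    ultimately have "n \<le> nat k" unfolding n_def by (intro Least_le) auto
    then show False using k by auto
  qed
  then show ?thesis using n by simp
qed

theorem lagrange_four_squares:
  assumes "n \<ge> 0"
  shows "four_sq n"
proof -
  have four_sq_0: "four_sq 0" unfolding four_sq_def by (rule exI[of _ 0])+ simp
  have four_sq_1: "four_sq 1" unfolding four_sq_def
    by (rule exI[of _ 1], (rule exI[of _ 0])+) simp
  have "four_sq (int k)" for k
  proof (induction k rule: prime_divisors_induct)
    case zero
    show ?case using four_sq_0 by simp
  next
    case (unit x)
    then have "x = 1" by simp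
    show ?case unfolding \<open>x = 1\<close> using four_sq_1 by simp
  next
    case (factor p x)
    then have "prime (int p)" by simp
    from four_sq_mult[OF four_sq_prime[OF this] factor(2)] show ?case by simp
  qed
  from this[of "nat n"] show ?thesis using assms by simp
qed

subsection \<open>Gaussian moments\<close>

text \<open>The jth moment of the standard normal law; the recursion is integration by
  parts.\<close>

fun gmom :: "nat \<Rightarrow> rat" where
  "gmom 0 = 1"
| "gmom (Suc 0) = 0"
| "gmom (Suc (Suc j)) = of_nat (Suc j) * gmom j"

lemma gmom_even: "gmom (2 * a) = fact (2 * a) / (2 ^ a * fact a)"
proof (induction a)
  case (Suc a)
  have "gmom (2 * Suc a) = of_nat (2 * a + 1) * gmom (2 * a)" by simp
  also have "\<dots> = ((2 * (1 + of_nat a)) * (of_nat (2 * a + 1) * fact (2 * a))) / ((2 * (1 + of_nat a)) * (2 ^ a * fact a))"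
    unfolding Suc by (subst mult_divide_mult_cancel_left) (simp_all add: add_nonneg_eq_0_iff)
  also have "\<dots> = fact (2 * Suc a) / (2 ^ Suc a * fact (Suc a))"
    by (simp add: algebra_simps)
  finally show ?case .
qed simp

lemma gmom_odd: "odd j \<Longrightarrow> gmom j = 0"
  by (induction j rule: gmom.induct) auto

lemma sum_even_terms:
  fixes f :: "nat \<Rightarrow> 'a::comm_monoid_add"
  assumes "\<And>i. odd i \<Longrightarrow> f i = 0"
  shows "(\<Sum>i\<le>2*l. f i) = (\<Sum>a\<le>l. f (2 * a))"
  by (induction l) (use assms in auto)

text \<open>For independent standard normal X and Y and S >= 0 the left side is the jth moment of x
  X + sqrt(S) Y, which is distributed like sqrt(x^2 + S) X. The rounding in \<open>div 2\<close> is
  harmless because the moment in front of the power vanishes for odd exponents.\<close>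

lemma gmom_convolution:
  "(\<Sum>i\<le>j. of_nat (j choose i) * gmom i * x ^ i * (gmom (j - i) * S ^ ((j - i) div 2)))
     = gmom j * (x^2 + S) ^ (j div 2)"
proof (cases "even j")
  case False
  have "gmom i * gmom (j - i) = 0" if "i \<le> j" for i
    using that False by (cases "even i") (auto simp: gmom_odd)
  then have "(\<Sum>i\<le>j. of_nat (j choose i) * gmom i * x ^ i * (gmom (j - i) * S ^ ((j - i) div 2))) = 0"
    by (intro sum.neutral) auto
  then show ?thesis using False gmom_odd by simp
next
  case True
  then obtain l where j: "j = 2 * l" by blast
  have coeff: "of_nat (2 * l choose (2 * a)) * gmom (2 * a) * gmom (2 * (l - a)) = gmom (2 * l) * of_nat (l choose a)"
    if "a \<le> l" for a
  proof -
    have e: "2 * l - 2 * a = 2 * (l - a)" by simp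
    have c1: "of_nat (2 * l choose (2 * a)) = (fact (2 * l) / (fact (2 * a) * fact (2 * (l - a))) :: rat)"
      using binomial_fact[of "2 * a" "2 * l"] that unfolding e by simp
    have c2: "of_nat (l choose a) = (fact l / (fact a * fact (l - a)) :: rat)"
      by (rule binomial_fact[OF that])
    have c3: "(2::rat) ^ l = 2 ^ a * 2 ^ (l - a)" using that by (simp flip: power_add)
    have "F2 / (A2 * B2) * (A2 / (pa * A)) * (B2 / (pb * B)) = F2 / ((pa * pb) * F) * (F / (A * B))"
      if "A2 \<noteq> 0" "B2 \<noteq> 0" "pa \<noteq> 0" "pb \<noteq> 0" "A \<noteq> 0" "B \<noteq> 0" "F \<noteq> 0" for F2 A2 B2 pa A pb B F :: rat
      using that by simp
    then show ?thesis unfolding c1 c2 gmom_even c3 by simp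
  qed
  have "(\<Sum>i\<le>2*l. of_nat (2*l choose i) * gmom i * x ^ i * (gmom (2*l - i) * S ^ ((2*l - i) div 2)))
     = (\<Sum>a\<le>l. of_nat (2*l choose (2*a)) * gmom (2*a) * x ^ (2*a) * (gmom (2*l - 2*a) * S ^ ((2*l - 2*a) div 2)))"
    by (rule sum_even_terms) (simp add: gmom_odd)
  also have "\<dots> = (\<Sum>a\<le>l. gmom (2*l) * (of_nat (l choose a) * (x^2) ^ a * S ^ (l - a)))"
  proof (rule sum.cong[OF refl])
    fix a assume "a \<in> {..l}"
    then have a: "a \<le> l" by simp
    have "2 * l - 2 * a = 2 * (l - a)" by simp
    then have "of_nat (2*l choose (2*a)) * gmom (2*a) * x ^ (2*a) * (gmom (2*l - 2*a) * S ^ ((2*l - 2*a) div 2))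
      = (of_nat (2*l choose (2*a)) * gmom (2*a) * gmom (2 * (l - a))) * ((x^2) ^ a * S ^ (l - a))"
      by (simp add: power_mult)
    then show "of_nat (2*l choose (2*a)) * gmom (2*a) * x ^ (2*a) * (gmom (2*l - 2*a) * S ^ ((2*l - 2*a) div 2))
      = gmom (2*l) * (of_nat (l choose a) * (x^2) ^ a * S ^ (l - a))"
      unfolding coeff[OF a] by simp
  qed
  also have "\<dots> = gmom (2*l) * (x^2 + S) ^ l"
    unfolding binomial_ring sum_distrib_left ..
  finally show ?thesis unfolding j by simp
qed

subsection \<open>Central moments of the symmetric binomial law\<close>

text \<open>The jth moment of a sum of n independent fair signs: if i of them are +1, the sum is 2i
  - n.\<close>

definition bmom :: "nat \<Rightarrow> nat \<Rightarrow> rat" where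
  "bmom j n = (\<Sum>i\<le>n. of_nat (n choose i) * (2 * of_nat i - of_nat n) ^ j) / 2 ^ n"

lemma bmom_0 [simp]: "bmom 0 n = 1"
proof -
  have "(\<Sum>i\<le>n. rat_of_nat (n choose i)) = of_nat (\<Sum>i\<le>n. n choose i)" by simp
  also have "\<dots> = 2 ^ n" unfolding choose_row_sum by simp
  finally show ?thesis by (simp add: bmom_def)
qed

lemma bmom_at_0: "j > 0 \<Longrightarrow> bmom j 0 = 0"
  by (simp add: bmom_def)

text \<open>By symmetry of the summands, E S^(j+1) = (n+1) E(e (S' + e)^j), where e is one sign and
  S' the sum of the other n. Averaging over e leaves the odd powers of e in the binomial expansion.
  The symmetry is expressed by absorbing the factors i and n+1-i into the binomial
  coefficient.\<close>

lemma bmom_Suc: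
  "bmom (Suc j) (Suc n) = of_nat (Suc n) * (\<Sum>i\<le>j. of_nat (j choose i) * (if odd i then 1 else 0) * bmom (j - i) n)"
proof -
  define g :: "nat \<Rightarrow> rat" where "g i = (2 * of_nat i - of_nat (Suc n)) ^ j" for i
  define y :: "nat \<Rightarrow> rat" where "y i = 2 * of_nat i - of_nat n" for i
  have 1: "of_nat (Suc n choose i) * (2 * rat_of_nat i - of_nat (Suc n)) =
      of_nat i * of_nat (Suc n choose i) - of_nat (Suc n - i) * of_nat (Suc n choose i)" if "i \<le> Suc n" for i
    using that by (simp add: of_nat_diff algebra_simps)
  have "(\<Sum>i\<le>Suc n. of_nat (Suc n choose i) * (2 * of_nat i - of_nat (Suc n)) ^ Suc j)
     = (\<Sum>i\<le>Suc n. of_nat (i * (Suc n choose i)) * g i) - (\<Sum>i\<le>Suc n. of_nat ((Suc n - i) * (Suc n choose i)) * g i)"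
    unfolding sum_subtractf[symmetric]
  proof (rule sum.cong[OF refl])
    fix i assume "i \<in> {..Suc n}"
    then have i: "i \<le> Suc n" by simp
    show "of_nat (Suc n choose i) * (2 * of_nat i - of_nat (Suc n)) ^ Suc j =
      of_nat (i * (Suc n choose i)) * g i - of_nat ((Suc n - i) * (Suc n choose i)) * g i"
      using arg_cong[where f = "\<lambda>x. x * g i", OF 1[OF i]]
      by (simp add: g_def left_diff_distrib mult.assoc del: of_nat_Suc)
  qed
  also have "(\<Sum>i\<le>Suc n. of_nat (i * (Suc n choose i)) * g i) = (\<Sum>i\<le>n. of_nat (Suc n * (n choose i)) * g (Suc i))"
    unfolding sum.atMost_Suc_shift by (simp only: Suc_times_binomial)
  also have "(\<Sum>i\<le>Suc n. of_nat ((Suc n - i) * (Suc n choose i)) * g i) = (\<Sum>i\<le>n. of_nat (Suc n * (n choose i)) * g i)"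
    unfolding sum.atMost_Suc binomial_absorb_comp by (simp add: binomial_eq_0)
  also have "(\<Sum>i\<le>n. of_nat (Suc n * (n choose i)) * g (Suc i)) - (\<Sum>i\<le>n. of_nat (Suc n * (n choose i)) * g i)
     = of_nat (Suc n) * (\<Sum>i\<le>n. of_nat (n choose i) * ((y i + 1) ^ j - (y i - 1) ^ j))"
    unfolding sum_subtractf[symmetric] sum_distrib_left
    by (rule sum.cong[OF refl]) (simp add: g_def y_def algebra_simps)
  also have "(\<Sum>i\<le>n. of_nat (n choose i) * ((y i + 1) ^ j - (y i - 1) ^ j))
     = (\<Sum>i\<le>n. of_nat (n choose i) * (\<Sum>s\<le>j. of_nat (j choose s) * (2 * (if odd s then 1 else 0)) * y i ^ (j - s)))"
  proof (rule sum.cong[OF refl], rule arg_cong[where f = "\<lambda>x. _ * x"])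
    fix i
    have a: "(y i + 1) ^ j = (\<Sum>s\<le>j. of_nat (j choose s) * 1 ^ s * y i ^ (j - s))"
      using binomial_ring[of 1 "y i" j] by (simp add: add.commute)
    have b: "(y i - 1) ^ j = (\<Sum>s\<le>j. of_nat (j choose s) * (-1) ^ s * y i ^ (j - s))"
      using binomial_ring[of "-1" "y i" j] by simp
    show "(y i + 1) ^ j - (y i - 1) ^ j = (\<Sum>s\<le>j. of_nat (j choose s) * (2 * (if odd s then 1 else 0)) * y i ^ (j - s))"
      unfolding a b sum_subtractf[symmetric] by (rule sum.cong[OF refl]) auto
  qed
  also have "\<dots> = (\<Sum>s\<le>j. of_nat (j choose s) * (2 * (if odd s then 1 else 0)) * (2 ^ n * bmom (j - s) n))"
  proof -
    have e: "2 ^ n * bmom (j - s) n = (\<Sum>i\<le>n. of_nat (n choose i) * y i ^ (j - s))" for s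
      by (simp add: bmom_def y_def)
    show ?thesis unfolding e sum_distrib_left by (subst sum.swap) (intro sum.cong refl, simp)
  qed
  also have "\<dots> = 2 ^ Suc n * (\<Sum>i\<le>j. of_nat (j choose i) * (if odd i then 1 else 0) * bmom (j - i) n)"
    unfolding sum_distrib_left by (rule sum.cong[OF refl]) simp
  finally show ?thesis by (simp add: bmom_def[of "Suc j"] del: of_nat_Suc)
qed

lemma bmom_odd: "odd j \<Longrightarrow> bmom j n = 0"
proof (induction j arbitrary: n rule: less_induct)
  case (less j)
  then obtain j' where j: "j = Suc j'" "even j'" by (metis oddE even_Suc not0_implies_Suc even_zero)
  show ?case
  proof (cases n)
    case 0
    then show ?thesis using j by (simp add: bmom_at_0)
  next
    case (Suc n')
    have "(\<Sum>i\<le>j'. of_nat (j' choose i) * (if odd i then 1 else 0) * bmom (j' - i) n') = 0"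
      by (rule sum.neutral) (use less.IH j in auto)
    then show ?thesis unfolding Suc j bmom_Suc by simp
  qed
qed

lemma bmom_2: "bmom 2 n = of_nat n"
proof (cases n)
  case 0 then show ?thesis by (simp add: bmom_at_0)
next
  case (Suc n')
  show ?thesis unfolding Suc numeral_2_eq_2 bmom_Suc by simp
qed

lemma bmom_4: "bmom 4 n = 3 * of_nat n ^ 2 - 2 * of_nat n"
proof (cases n)
  case 0 then show ?thesis by (simp add: bmom_at_0)
next
  case (Suc n')
  have "bmom (Suc 3) (Suc n') = of_nat (Suc n') * (3 * bmom 2 n' + bmom 0 n')"
  proof -
    have "(\<Sum>i\<le>3::nat. f i) = f 0 + f 1 + f 2 + f 3" for f :: "nat \<Rightarrow> rat"
      by (simp add: eval_nat_numeral)
    then show ?thesis unfolding bmom_Suc by simp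
  qed
  then show ?thesis unfolding Suc bmom_2 by (simp add: power2_eq_square algebra_simps)
qed

lemma coeff_pcompose_shift:
  fixes p :: "'a::idom poly"
  assumes "degree p \<le> d"
  shows "coeff (pcompose p [:c, 1:]) d = coeff p d"
proof (cases "degree p = d")
  case True
  have "lead_coeff (pcompose p [:c, 1:]) = lead_coeff p" by (subst lead_coeff_comp) auto
  moreover have "degree (pcompose p [:c, 1:]) = degree p" by (simp add: degree_pcompose)
  ultimately show ?thesis using True by simp
next
  case False
  then show ?thesis using assms by (simp add: coeff_eq_0 degree_pcompose)
qed

text \<open>The central limit theorem for moments: the 2jth moment of n signs grows like
  \<open>gmom (2 * j)\<close> times n^j. In \<open>bmom_Suc\<close> only the summand with a single
  power of e has top degree, and it reproduces the recursion of \<open>gmom\<close>.\<close>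

lemma bmom_poly:
  "\<exists>p. degree p \<le> j \<and> coeff p j = gmom (2 * j) \<and> (\<forall>n. bmom (2 * j) n = poly p (of_nat n))"
proof (induction j rule: less_induct)
  case (less j)
  show ?case
  proof (cases j)
    case 0
    then show ?thesis by (intro exI[of _ 1]) simp
  next
    case (Suc i)
    have "\<forall>a\<le>i. \<exists>p. degree p \<le> a \<and> coeff p a = gmom (2 * a) \<and> (\<forall>n. bmom (2 * a) n = poly p (of_nat n))"
      using less Suc by auto
    then obtain P where P: "\<And>a. a \<le> i \<Longrightarrow> degree (P a) \<le> a" "\<And>a. a \<le> i \<Longrightarrow> coeff (P a) a = gmom (2 * a)"
      "\<And>a n. a \<le> i \<Longrightarrow> bmom (2 * a) n = poly (P a) (of_nat n)" by metis
    \<comment> \<open>The recursion leads from n to n - 1, hence the composition with X - 1; the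
      factor n becomes the \<open>pCons 0\<close> in \<open>R\<close>.\<close>
    define Q where "Q a = smult (of_nat (Suc (2 * i) choose Suc (2 * a))) (pcompose (P (i - a)) [:-1, 1:])" for a
    define R where "R = pCons 0 (\<Sum>a\<le>i. Q a)"
    have dQ: "degree (Q a) \<le> i - a" for a
      unfolding Q_def using P(1)[of "i - a"] by (intro order.trans[OF degree_smult_le]) (simp add: degree_pcompose)
    have "degree (\<Sum>a\<le>i. Q a) \<le> i"
      by (rule degree_sum_le) (auto intro: order.trans[OF dQ])
    then have dR: "degree R \<le> Suc i" unfolding R_def using degree_pCons_le order.trans by (metis Suc_le_mono)
    have "coeff R (Suc i) = (\<Sum>a\<le>i. coeff (Q a) i)" by (simp add: R_def coeff_sum)
    also have "\<dots> = (\<Sum>a\<le>i. if a = 0 then coeff (Q 0) i else 0)"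
    proof (rule sum.cong[OF refl])
      fix a assume "a \<in> {..i}"
      then have "degree (Q a) < i" if "a \<noteq> 0" using dQ[of a] that by auto
      then show "coeff (Q a) i = (if a = 0 then coeff (Q 0) i else 0)" by (auto intro: coeff_eq_0)
    qed
    also have "\<dots> = of_nat (Suc (2 * i)) * gmom (2 * i)"
      by (simp add: Q_def coeff_pcompose_shift P del: of_nat_Suc)
    also have "\<dots> = gmom (2 * Suc i)" by simp
    finally have cR: "coeff R (Suc i) = gmom (2 * Suc i)" .
    have "bmom (2 * Suc i) n = poly R (of_nat n)" for n
    proof (cases n)
      case 0 then show ?thesis by (simp add: bmom_at_0 R_def)
    next
      case (Suc n')
      have "bmom (2 * Suc i) (Suc n') = of_nat (Suc n') *
         (\<Sum>s\<le>Suc (2 * i). of_nat (Suc (2 * i) choose s) * (if odd s then 1 else 0) * bmom (Suc (2 * i) - s) n')"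
        using bmom_Suc[of "Suc (2 * i)" n'] by simp
      also have "(\<Sum>s\<le>Suc (2 * i). of_nat (Suc (2 * i) choose s) * (if odd s then 1 else 0) * bmom (Suc (2 * i) - s) n')
         = (\<Sum>s\<le>2 * i. of_nat (Suc (2 * i) choose Suc s) * (if odd (Suc s) then 1 else 0) * bmom (2 * i - s) n')"
        by (subst sum.atMost_Suc_shift) simp
      also have "\<dots> = (\<Sum>a\<le>i. of_nat (Suc (2 * i) choose Suc (2 * a)) * bmom (2 * i - 2 * a) n')"
        by (subst sum_even_terms) simp_all
      also have "\<dots> = (\<Sum>a\<le>i. poly (Q a) (of_nat (Suc n')))"
      proof (rule sum.cong[OF refl])
        fix a assume "a \<in> {..i}"
        have "2 * i - 2 * a = 2 * (i - a)" by simp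
        then show "of_nat (Suc (2 * i) choose Suc (2 * a)) * bmom (2 * i - 2 * a) n' = poly (Q a) (of_nat (Suc n'))"
          using P(3)[of "i - a" n'] by (simp add: Q_def poly_pcompose)
      qed
      finally show ?thesis unfolding Suc R_def by (simp add: poly_sum)
    qed
    then show ?thesis using dR cR Suc by blast
  qed
qed

text \<open>The factor x on the left replaces the exponent d - 1 on the right, which would be
  truncated at d = 0.\<close>

lemma poly_minus_lead_bound:
  fixes p :: "rat poly"
  assumes "degree p \<le> d"
  shows "\<exists>C\<ge>0. \<forall>x\<ge>1. \<bar>poly p x - coeff p d * x ^ d\<bar> * x \<le> C * x ^ d"
proof (intro exI[of _ "\<Sum>i<d. \<bar>coeff p i\<bar>"] conjI allI impI sum_nonneg)
  fix x :: rat assume x: "x \<ge> 1"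
  have "poly p x = (\<Sum>i\<le>d. coeff p i * x ^ i)"
    unfolding poly_altdef by (rule sum.mono_neutral_left) (use assms in \<open>auto simp: coeff_eq_0\<close>)
  then have "poly p x - coeff p d * x ^ d = (\<Sum>i<d. coeff p i * x ^ i)"
    by (simp flip: lessThan_Suc_atMost)
  then have "\<bar>poly p x - coeff p d * x ^ d\<bar> \<le> (\<Sum>i<d. \<bar>coeff p i\<bar> * x ^ i)"
    using x by (simp add: order.trans[OF sum_abs] abs_mult)
  then have "\<bar>poly p x - coeff p d * x ^ d\<bar> * x \<le> (\<Sum>i<d. \<bar>coeff p i\<bar> * x ^ i) * x"
    using x by (intro mult_right_mono) auto
  also have "\<dots> = (\<Sum>i<d. \<bar>coeff p i\<bar> * x ^ Suc i)"
    unfolding sum_distrib_right by (rule sum.cong) simp_all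
  also have "\<dots> \<le> (\<Sum>i<d. \<bar>coeff p i\<bar> * x ^ d)"
    using x by (intro sum_mono mult_left_mono power_increasing) auto
  finally show "\<bar>poly p x - coeff p d * x ^ d\<bar> * x \<le> (\<Sum>i<d. \<bar>coeff p i\<bar>) * x ^ d"
    by (simp add: sum_distrib_right)
qed auto

text \<open>With 4 q^2 steps the standard deviation is the integer 2 q, so the normalised law lives
  on rational points.\<close>

lemma scaled_bmom_bound:
  "\<exists>C\<ge>0. \<forall>q\<ge>1. \<bar>gmom j - bmom j (4 * q^2) / (2 * of_nat q) ^ j\<bar> \<le> C / of_nat q ^ 2"
proof (cases "even j")
  case False
  then show ?thesis by (intro exI[of _ 0]) (simp add: gmom_odd bmom_odd)
next
  case True
  then obtain a where j: "j = 2 * a" by blast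
  obtain p where p: "degree p \<le> a" "coeff p a = gmom (2 * a)" "\<And>n. bmom (2 * a) n = poly p (of_nat n)"
    using bmom_poly by blast
  obtain C where C: "C \<ge> 0" "\<And>x. x \<ge> 1 \<Longrightarrow> \<bar>poly p x - coeff p a * x ^ a\<bar> * x \<le> C * x ^ a"
    using poly_minus_lead_bound[OF p(1)] by blast
  have "\<bar>gmom j - bmom j (4 * q^2) / (2 * of_nat q) ^ j\<bar> \<le> C / of_nat q ^ 2" if "q \<ge> 1" for q :: nat
  proof -
    define x :: rat where "x = of_nat (4 * q ^ 2)"
    have "q ^ 2 \<ge> 1" using that by (rule one_le_power)
    then have "4 * q ^ 2 \<ge> 1" by linarith
    from of_nat_mono[OF this, where 'a = rat] have x: "x \<ge> 1" unfolding x_def of_nat_1 .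
    have e: "(2 * of_nat q) ^ j = x ^ a" by (simp add: j x_def power_mult power_mult_distrib)
    have b: "bmom j (4 * q^2) = poly p x" by (simp add: j p(3) x_def)
    have "gmom j - bmom j (4 * q^2) / (2 * of_nat q) ^ j = - ((poly p x - coeff p a * x ^ a) / x ^ a)"
      unfolding e b p(2) using x by (simp add: field_simps j)
    then have "\<bar>gmom j - bmom j (4 * q^2) / (2 * of_nat q) ^ j\<bar> = \<bar>poly p x - coeff p a * x ^ a\<bar> / x ^ a"
      using x by (simp add: abs_divide)
    also have "\<dots> \<le> C / x" using C(2)[OF x] x by (simp add: field_simps)
    also have "\<dots> \<le> C / of_nat q ^ 2"
      using that C(1) by (intro divide_left_mono) (auto simp: x_def)
    finally show ?thesis .
  qed
  then show ?thesis using C(1) by blast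
qed

text \<open>By unimodality an atom near the centre dominates all atoms with \<open>1/2 < \<bar>t\<bar>\<close>. These carry a definite mass for
  \<open>\<bar>t\<bar> \<le> 8\<close>, as integrating the quadratic \<open>F\<close> in \<open>t\<^sup>2\<close>, which is positive only there, shows.\<close>

lemma binomial_atom_bound:
  fixes q i0 :: nat
  assumes q: "q \<ge> 1" and i0: "2 * q^2 \<le> i0" "2 * i0 \<le> 4 * q^2 + q"
  shows "rat_of_nat (4 * q^2 choose i0) / 2 ^ (4 * q^2) \<ge> 1 / (400 * of_nat q)"
proof -
  define n where "n = 4 * q^2"
  define Q :: rat where "Q = of_nat q"
  have Q: "Q \<ge> 1" using q by (simp add: Q_def)
  define pr :: "nat \<Rightarrow> rat" where "pr i = of_nat (n choose i) / 2 ^ n" for i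
  define t :: "nat \<Rightarrow> rat" where "t i = (2 * of_nat i - of_nat n) / (2 * Q)" for i
  have nQ: "of_nat n = 4 * Q^2" by (simp add: n_def Q_def)
  have mom: "(\<Sum>i\<le>n. pr i * t i ^ j) = bmom j n / (2 * Q) ^ j" for j
    by (simp add: pr_def t_def bmom_def sum_divide_distrib power_divide)
  have m0: "(\<Sum>i\<le>n. pr i) = 1" using mom[of 0] by simp
  have m2: "(\<Sum>i\<le>n. pr i * t i ^ 2) = 1"
    unfolding mom bmom_2 nQ using Q by (simp add: power2_eq_square)
  have "(\<Sum>i\<le>n. pr i * t i ^ 4) = (3 * of_nat n ^ 2 - 2 * of_nat n) / (2 * Q) ^ 4" unfolding mom bmom_4 ..
  also have "\<dots> \<le> (3 * of_nat n ^ 2) / (2 * Q) ^ 4" using Q by (intro divide_right_mono) auto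
  also have "\<dots> = 3" unfolding nQ using Q by (simp add: field_simps flip: power_mult)
  finally have m4: "(\<Sum>i\<le>n. pr i * t i ^ 4) \<le> 3" .
  \<comment> \<open>As the second moment is 1 and the fourth at most 3, F(t^2) has mean at least
    257/4 - 3 - 16 > 45. Its maximum, at y = 257/8, is (255/8)^2 < 1024.\<close>
  define F :: "rat \<Rightarrow> rat" where "F y = (y - 1/4) * (64 - y)" for y
  have "(\<Sum>i\<le>n. pr i * F (t i ^ 2)) = (\<Sum>i\<le>n. (257/4) * (pr i * t i ^ 2) - pr i * t i ^ 4 - 16 * pr i)"
    by (rule sum.cong[OF refl]) (simp add: F_def power2_eq_square power4_eq_xxxx algebra_simps)
  also have "\<dots> = 257/4 - (\<Sum>i\<le>n. pr i * t i ^ 4) - 16"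
    unfolding sum_subtractf sum_distrib_left[symmetric] m0 m2 by simp
  finally have lower: "(\<Sum>i\<le>n. pr i * F (t i ^ 2)) \<ge> 45" using m4 by simp
  \<comment> \<open>The atoms with |t| <= 8. There are at most 16 q + 1 <= 17 q of them, so 45 <= 17
    q * 1024 * \<open>pr i0\<close>, which is where 1/400 comes from.\<close>
  define J where "J = {i. i \<le> n \<and> i \<le> 2 * q^2 + 8 * q \<and> 2 * q^2 \<le> i + 8 * q}"
  have J: "finite J" "J \<subseteq> {..n}" by (auto simp: J_def)
  have "J \<subseteq> {2 * q^2 - 8 * q..2 * q^2 + 8 * q}" by (auto simp: J_def)
  then have "card J \<le> 17 * q" using card_mono[of "{2 * q^2 - 8 * q..2 * q^2 + 8 * q}" J] q by simp
  then have cJ: "rat_of_nat (card J) \<le> 17 * Q" using of_nat_mono[of "card J" "17 * q", where 'a = rat] by (simp add: Q_def)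
  have pr0: "pr i \<ge> 0" for i by (simp add: pr_def)
  have i0n: "i0 \<le> n"
  proof -
    have "q \<le> q^2" using q by (simp add: power2_eq_square)
    then show ?thesis using i0 unfolding n_def by linarith
  qed
  have upper1: "pr i * F (t i ^ 2) \<le> (if i \<in> J then 1024 * pr i0 else 0)" if i: "i \<le> n" for i
  proof (cases "i \<in> J \<and> F (t i ^ 2) > 0")
    case True
    then have "t i ^ 2 > 1/4"
      using zero_le_power2[of "t i"] by (auto simp: F_def zero_less_mult_iff)
    then have "(t i)^2 > (1/2)^2" by (simp add: power2_eq_square)
    then have "\<bar>t i\<bar> > 1/2" using abs_le_square_iff[of "t i" "1/2"] by simp
    then have "\<bar>2 * of_nat i - rat_of_nat n\<bar> > Q" using Q by (simp add: t_def abs_divide field_simps)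
    then have "2 * of_nat i > of_nat n + Q \<or> of_nat n > 2 * rat_of_nat i + Q" by linarith
    then have "rat_of_nat (2 * i) > of_nat (n + q) \<or> rat_of_nat n > of_nat (2 * i + q)"
      by (simp add: Q_def)
    then have "2 * i > n + q \<or> n > 2 * i + q" unfolding of_nat_less_iff .
    \<comment> \<open>\<open>i0\<close> is at distance at most q/2 from the centre n/2 and
      \<open>i\<close> at distance more than q/2, so the binomial coefficients compare by
      unimodality, after a reflection if \<open>i\<close> is left of the centre.\<close>
    then have "n choose i \<le> n choose i0"
    proof
      assume "2 * i > n + q"
      then show ?thesis using i0 i unfolding n_def by (intro binomial_antimono) auto
    next
      assume *: "n > 2 * i + q"
      have "n choose i = n choose (n - i)" using i by (rule binomial_symmetric)
      also have "\<dots> \<le> n choose i0" using i0 i * unfolding n_def by (intro binomial_antimono) auto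
      finally show ?thesis .
    qed
    then have "pr i \<le> pr i0" by (simp add: pr_def divide_right_mono)
    moreover have "F (t i ^ 2) \<le> 1024"
    proof -
      have "0 \<le> (t i ^ 2 - 257/8)^2" by simp
      then show ?thesis by (simp add: F_def power2_eq_square algebra_simps)
    qed
    ultimately have "pr i * F (t i ^ 2) \<le> pr i0 * 1024" using pr0 True by (intro mult_mono) auto
    then show ?thesis using True by simp
  next
    case False
    have "F (t i ^ 2) \<le> 0" if "i \<notin> J"
    proof -
      have "i > 2 * q^2 + 8 * q \<or> 2 * q^2 > i + 8 * q" using that i by (auto simp: J_def)
      then have "\<bar>2 * of_nat i - rat_of_nat n\<bar> \<ge> 16 * Q"
      proof
        assume "i > 2 * q^2 + 8 * q"
        then have "rat_of_nat i \<ge> of_nat (2 * q^2 + 8 * q)" unfolding of_nat_le_iff by simp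
        then show ?thesis by (simp add: Q_def n_def)
      next
        assume "2 * q^2 > i + 8 * q"
        then have "rat_of_nat (2 * q^2) \<ge> of_nat (i + 8 * q)" unfolding of_nat_le_iff by simp
        then show ?thesis by (simp add: Q_def n_def)
      qed
      then have "\<bar>t i\<bar> \<ge> 8" using Q by (simp add: t_def abs_divide field_simps)
      then have "t i ^ 2 \<ge> 8^2" using abs_le_square_iff[of 8 "t i"] by simp
      then show ?thesis by (simp add: F_def mult_le_0_iff)
    qed
    then have "F (t i ^ 2) \<le> 0" using False by auto
    then have "pr i * F (t i ^ 2) \<le> 0" using pr0 by (simp add: mult_nonneg_nonpos)
    moreover have "0 \<le> (if i \<in> J then 1024 * pr i0 else 0)" using pr0 by simp
    ultimately show ?thesis by linarith
  qed
  have "45 \<le> (\<Sum>i\<le>n. if i \<in> J then 1024 * pr i0 else 0)"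
    by (rule order.trans[OF lower], rule sum_mono) (use upper1 in simp)
  also have "\<dots> = of_nat (card J) * (1024 * pr i0)"
    using J by (simp add: sum.If_cases inf.absorb2)
  also have "\<dots> \<le> 17 * Q * (1024 * pr i0)" using cJ pr0 by (intro mult_right_mono) auto
  finally have "45 \<le> 17408 * Q * pr i0" by simp
  then have "1 / (400 * Q) \<le> pr i0" using Q by (simp add: field_simps)
  then show ?thesis by (simp add: pr_def n_def Q_def)
qed

text \<open>\<open>c j l\<close> is the jth coefficient of the lth Lagrange basis polynomial: the
  weights \<open>c j\<close> read off the jth coefficient of a polynomial of degree at most n from
  its values at the nodes.\<close>

lemma dual_weights:
  fixes \<tau> :: "nat \<Rightarrow> rat"
  assumes "inj_on \<tau> {..n}"
  shows "\<exists>c. \<forall>i\<le>n. \<forall>j\<le>n. (\<Sum>l\<le>n. c j l * \<tau> l ^ i) = (if i = j then 1 else 0)"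
proof -
  define L where "L l = (\<Prod>l'\<in>{..n}-{l}. smult (1 / (\<tau> l - \<tau> l')) [:- \<tau> l', 1:])" for l
  have pL: "poly (L l) (\<tau> a) = (if a = l then 1 else 0)" if "l \<le> n" "a \<le> n" for l a
  proof (cases "a = l")
    case True
    have "\<tau> l \<noteq> \<tau> l'" if "l' \<in> {..n} - {l}" for l'
      using assms that \<open>l \<le> n\<close> by (auto dest: inj_onD)
    then have "poly (L l) (\<tau> a) = (\<Prod>l'\<in>{..n}-{l}. 1)"
      unfolding L_def poly_prod True by (intro prod.cong refl) (simp add: diff_divide_distrib[symmetric])
    then show ?thesis using True by simp
  next
    case False
    have "\<exists>l'\<in>{..n}-{l}. poly (smult (1 / (\<tau> l - \<tau> l')) [:- \<tau> l', 1:]) (\<tau> a) = 0"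
      using that False by (intro bexI[of _ a]) auto
    then show ?thesis unfolding L_def poly_prod using False by (simp add: prod_zero)
  qed
  have dL: "degree (L l) \<le> n" if "l \<le> n" for l
  proof -
    have "degree (L l) \<le> (\<Sum>l'\<in>{..n}-{l}. degree (smult (1 / (\<tau> l - \<tau> l')) [:- \<tau> l', 1:]))"
      unfolding L_def by (rule degree_prod_sum_le[unfolded comp_def]) simp
    also have "\<dots> \<le> (\<Sum>l'\<in>{..n}-{l}. 1)"
      by (intro sum_mono order.trans[OF degree_smult_le]) simp
    also have "\<dots> = n" using that by simp
    finally show ?thesis .
  qed
  have "(\<Sum>l\<le>n. coeff (L l) j * \<tau> l ^ i) = (if i = j then 1 else 0)" if "i \<le> n" for i j
  proof -
    have "(\<Sum>l\<le>n. smult (\<tau> l ^ i) (L l)) = monom 1 i"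
    proof (rule poly_eqI_degree[of "\<tau> ` {..n}"])
      fix x assume "x \<in> \<tau> ` {..n}"
      then obtain a where a: "a \<le> n" "x = \<tau> a" by auto
      have "poly (\<Sum>l\<le>n. smult (\<tau> l ^ i) (L l)) x = (\<Sum>l\<le>n. if l = a then \<tau> l ^ i else 0)"
        unfolding poly_sum by (intro sum.cong refl) (use a pL in auto)
      then show "poly (\<Sum>l\<le>n. smult (\<tau> l ^ i) (L l)) x = poly (monom 1 i) x"
        using a by (simp add: poly_monom)
    next
      have "degree (\<Sum>l\<le>n. smult (\<tau> l ^ i) (L l)) \<le> n"
        by (intro degree_sum_le order.trans[OF degree_smult_le]) (use dL in auto)
      then show "degree (\<Sum>l\<le>n. smult (\<tau> l ^ i) (L l)) < card (\<tau> ` {..n})"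
        using assms by (simp add: card_image)
      show "degree (monom (1::rat) i) < card (\<tau> ` {..n})"
        using assms that by (simp add: card_image degree_monom_eq)
    qed
    then have "coeff (\<Sum>l\<le>n. smult (\<tau> l ^ i) (L l)) j = (if i = j then 1 else 0)" by simp
    then show ?thesis by (simp add: coeff_sum mult.commute)
  qed
  then show ?thesis by (intro exI[of _ "\<lambda>j l. coeff (L l) j"]) auto
qed

text \<open>The law is the binomial law with \<open>4 q\<^sup>2\<close> steps, scaled by \<open>1 / (2 q)\<close> and corrected at the nodes \<open>l / (4 k)\<close>,
  \<open>l \<le> 2 k\<close>. The weights stay positive because the corrections are \<open>O(1 / q\<^sup>2)\<close> while the atoms at these nodes
  are at least \<open>1 / (400 q)\<close>.\<close>

lemma gaussian_quadrature:
  assumes k: "k \<ge> 1"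
  obtains n q :: nat and T :: "nat \<Rightarrow> int" and t w :: "nat \<Rightarrow> rat" and lam :: "nat \<Rightarrow> nat \<Rightarrow> rat"
  where "q > 0" "\<And>b. t b = of_int (T b) / of_nat q"
    "\<And>b. b \<le> n \<Longrightarrow> w b > 0"
    "\<And>i. i \<le> 2 * k \<Longrightarrow> (\<Sum>b\<le>n. w b * t b ^ i) = gmom i"
    "\<And>i j. i \<le> 2 * k \<Longrightarrow> j \<le> 2 * k \<Longrightarrow> (\<Sum>b\<le>n. lam j b * t b ^ i) = (if i = j then 1 else 0)"
proof -
  \<comment> \<open>2k+1 nodes suffice to prescribe the moments of orders 0 to 2k. They lie in
    [0, 1/2], the range covered by \<open>binomial_atom_bound\<close>.\<close>
  define \<tau> :: "nat \<Rightarrow> rat" where "\<tau> l = of_nat l / of_nat (4 * k)" for l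
  have "inj_on \<tau> {..2*k}" using k by (auto simp: inj_on_def \<tau>_def)
  from dual_weights[OF this] obtain c where
    c: "\<And>i j. i \<le> 2*k \<Longrightarrow> j \<le> 2*k \<Longrightarrow> (\<Sum>l\<le>2*k. c j l * \<tau> l ^ i) = (if i = j then 1 else 0)" by blast
  have "\<forall>j. \<exists>C\<ge>0. \<forall>q\<ge>1. \<bar>gmom j - bmom j (4 * q^2) / (2 * of_nat q) ^ j\<bar> \<le> C / of_nat q ^ 2"
    using scaled_bmom_bound by blast
  then obtain C where C: "\<And>j. C j \<ge> 0"
    "\<And>j q. q \<ge> 1 \<Longrightarrow> \<bar>gmom j - bmom j (4 * q^2) / (2 * of_nat q) ^ j\<bar> \<le> C j / of_nat q ^ 2" by metis
  define K where "K = (\<Sum>l\<le>2*k. \<Sum>j\<le>2*k. \<bar>c j l\<bar> * C j)"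
  \<comment> \<open>With q = 4 k r the nodes are atoms of the law, because r/q = 1/(4k). The choice
    r > 400 K makes the corrections, at most K/q^2, smaller than the atoms.\<close>
  obtain r :: nat where r: "of_nat r > 400 * K" using reals_Archimedean2 by blast
  have K0: "K \<ge> 0" unfolding K_def by (intro sum_nonneg mult_nonneg_nonneg) (auto simp: C)
  have r0: "r > 0" using r K0 by (cases r) auto
  define q where "q = 4 * k * r"
  have q1: "q \<ge> 1" using k r0 by (simp add: q_def)
  define Q :: rat where "Q = of_nat q"
  have Q: "Q \<ge> 1" using of_nat_mono[OF q1, where 'a = rat] by (simp add: Q_def)
  have "r \<le> q" using k by (simp add: q_def)
  from of_nat_mono[OF this, where 'a = rat] have QK: "Q > 400 * K" using r by (simp add: Q_def)
  define n where "n = 4 * q^2"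
  define T :: "nat \<Rightarrow> int" where "T b = 2 * int b - int n" for b
  define t :: "nat \<Rightarrow> rat" where "t b = of_int (T b) / of_nat (2 * q)" for b
  define node where "node l = 2 * q^2 + l * r" for l
  have node_le: "node l \<le> n" "2 * node l \<le> 4 * q^2 + q" if "l \<le> 2 * k" for l
  proof -
    have "l * r \<le> 2 * k * r" using that by simp
    then show 1: "2 * node l \<le> 4 * q^2 + q" by (simp add: node_def q_def algebra_simps)
    have "q \<le> q^2" using q1 by (simp add: power2_eq_square)
    then show "node l \<le> n" using 1 unfolding n_def by linarith
  qed
  have t_node: "t (node l) = \<tau> l" for l
    using k r0 by (simp add: t_def T_def node_def n_def \<tau>_def q_def field_simps)
  have inj_node: "node l = node l' \<longleftrightarrow> l = l'" for l l' using r0 by (simp add: node_def)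
  define ind where "ind l b = (if b = node l then 1 else 0 :: rat)" for l b
  have ind: "(\<Sum>b\<le>n. ind l b * f b) = f (node l)" if "l \<le> 2 * k" for l f
  proof -
    have "(\<Sum>b\<le>n. ind l b * f b) = (\<Sum>b\<le>n. if b = node l then f b else 0)"
      by (intro sum.cong) (auto simp: ind_def)
    then show ?thesis using node_le(1)[OF that] by simp
  qed
  define pr :: "nat \<Rightarrow> rat" where "pr i = of_nat (n choose i) / 2 ^ n" for i
  define M where "M j = bmom j n / (2 * Q) ^ j" for j
  have t_alt: "t b = (2 * of_nat b - of_nat n) / (2 * Q)" for b by (simp add: t_def T_def Q_def)
  have mom: "(\<Sum>i\<le>n. pr i * t i ^ j) = M j" for j
    by (simp add: M_def pr_def t_alt bmom_def sum_divide_distrib power_divide)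
  \<comment> \<open>The dual weights are combined so that the correction carries exactly the missing
    moment \<open>gmom j - M j\<close> for every j.\<close>
  define \<delta> where "\<delta> l = (\<Sum>j\<le>2*k. c j l * (gmom j - M j))" for l
  have \<delta>: "\<bar>\<delta> l\<bar> < 1 / (400 * Q)" if "l \<le> 2 * k" for l
  proof -
    have "\<bar>\<delta> l\<bar> \<le> (\<Sum>j\<le>2*k. \<bar>c j l\<bar> * \<bar>gmom j - M j\<bar>)"
      unfolding \<delta>_def by (rule order.trans[OF sum_abs]) (simp add: abs_mult)
    also have "\<dots> \<le> (\<Sum>j\<le>2*k. \<bar>c j l\<bar> * (C j / Q^2))"
      using C(2)[OF q1] by (intro sum_mono mult_left_mono) (auto simp: M_def n_def Q_def)
    also have "\<dots> = (\<Sum>j\<le>2*k. \<bar>c j l\<bar> * C j) / Q^2" by (simp add: sum_divide_distrib)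
    also have "\<dots> \<le> K / Q^2"
    proof (rule divide_right_mono)
      show "(\<Sum>j\<le>2*k. \<bar>c j l\<bar> * C j) \<le> K"
        unfolding K_def using that
        by (intro member_le_sum[of l _ "\<lambda>l. \<Sum>j\<le>2*k. \<bar>c j l\<bar> * C j"]) (auto intro!: sum_nonneg mult_nonneg_nonneg C)
    qed simp
    also have "\<dots> < 1 / (400 * Q)"
      using Q QK by (simp add: field_simps power2_eq_square)
    finally show ?thesis .
  qed
  define w where "w b = pr b + (\<Sum>l\<le>2*k. \<delta> l * ind l b)" for b
  define lam where "lam j b = (\<Sum>l\<le>2*k. c j l * ind l b)" for j b
  have lam_sum: "(\<Sum>b\<le>n. (\<Sum>l\<le>2*k. d l * ind l b) * t b ^ i) = (\<Sum>l\<le>2*k. d l * \<tau> l ^ i)" for d i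
  proof -
    have "(\<Sum>b\<le>n. (\<Sum>l\<le>2*k. d l * ind l b) * t b ^ i) = (\<Sum>l\<le>2*k. \<Sum>b\<le>n. d l * (ind l b * t b ^ i))"
      unfolding sum_distrib_right by (subst sum.swap) (simp add: mult.assoc)
    also have "\<dots> = (\<Sum>l\<le>2*k. d l * \<tau> l ^ i)"
      unfolding sum_distrib_left[symmetric] by (intro sum.cong refl) (simp add: ind t_node)
    finally show ?thesis .
  qed
  show thesis
  proof (rule that[of "2 * q" t T n w lam])
    show "2 * q > 0" using q1 by simp
    show "t b = of_int (T b) / of_nat (2 * q)" for b by (fact t_def)
    show "(\<Sum>b\<le>n. lam j b * t b ^ i) = (if i = j then 1 else 0)" if "i \<le> 2 * k" "j \<le> 2 * k" for i j
      unfolding lam_def lam_sum using c that by simp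
    show "(\<Sum>b\<le>n. w b * t b ^ i) = gmom i" if i: "i \<le> 2 * k" for i
    proof -
      have "(\<Sum>b\<le>n. w b * t b ^ i) = M i + (\<Sum>l\<le>2*k. \<delta> l * \<tau> l ^ i)"
        unfolding w_def distrib_right sum.distrib lam_sum mom ..
      also have "(\<Sum>l\<le>2*k. \<delta> l * \<tau> l ^ i) = (\<Sum>j\<le>2*k. (gmom j - M j) * (\<Sum>l\<le>2*k. c j l * \<tau> l ^ i))"
        unfolding \<delta>_def sum_distrib_right sum_distrib_left by (subst sum.swap) (simp add: mult_ac)
      also have "\<dots> = (\<Sum>j\<le>2*k. if j = i then gmom j - M j else 0)"
        by (intro sum.cong refl) (use c i in auto)
      also have "\<dots> = gmom i - M i" using i by simp
      finally show ?thesis by simp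
    qed
    show "w b > 0" if b: "b \<le> n" for b
    proof (cases "\<exists>l\<le>2*k. b = node l")
      case True
      then obtain l where l: "l \<le> 2 * k" "b = node l" by blast
      have "(\<Sum>l'\<le>2*k. \<delta> l' * ind l' b) = (\<Sum>l'\<le>2*k. if l' = l then \<delta> l' else 0)"
        by (intro sum.cong refl) (auto simp: ind_def l inj_node)
      then have "w b = pr b + \<delta> l" using l by (simp add: w_def)
      moreover have "pr b \<ge> 1 / (400 * Q)"
        using binomial_atom_bound[of q b] q1 node_le(2)[OF l(1)] l by (simp add: pr_def n_def Q_def node_def)
      ultimately show ?thesis using \<delta>[OF l(1)] by linarith
    next
      case False
      then have "w b = pr b" unfolding w_def ind_def by auto
      then show ?thesis using b by (simp add: pr_def)
    qed
  qed
qed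

subsection \<open>Hilbert's identity\<close>

definition tuples :: "nat set \<Rightarrow> nat \<Rightarrow> nat list set" where
  "tuples I N = {bs. set bs \<subseteq> I \<and> length bs = N}"

lemma finite_tuples: "finite I \<Longrightarrow> finite (tuples I N)"
  unfolding tuples_def by (rule finite_lists_length_eq)

lemma tuples_0: "tuples I 0 = {[]}"
  by (auto simp: tuples_def)

lemma sum_tuples_Suc: "(\<Sum>bs\<in>tuples I (Suc N). f bs) = (\<Sum>b\<in>I. \<Sum>bs\<in>tuples I N. f (b # bs))"
proof -
  have e: "tuples I (Suc N) = (\<lambda>(b, bs). b # bs) ` (I \<times> tuples I N)"
    by (auto simp: tuples_def length_Suc_conv image_iff)
  have "inj_on (\<lambda>(b, bs). b # bs) (I \<times> tuples I N)" by (auto simp: inj_on_def)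
  then show ?thesis unfolding e by (simp add: sum.reindex sum.cartesian_product case_prod_unfold)
qed

fun weight :: "(nat \<Rightarrow> rat) list \<Rightarrow> nat list \<Rightarrow> rat" where
  "weight (\<phi> # \<phi>s) (b # bs) = \<phi> b * weight \<phi>s bs"
| "weight _ _ = 1"

fun dot :: "'a::comm_semiring_1 list \<Rightarrow> 'a list \<Rightarrow> 'a" where
  "dot (b # bs) (x # xs) = b * x + dot bs xs"
| "dot _ _ = 0"

fun monomial :: "nat list \<Rightarrow> 'a::comm_semiring_1 list \<Rightarrow> 'a" where
  "monomial (a # as) (x # xs) = x ^ a * monomial as xs"
| "monomial _ _ = 1"

text \<open>The jth moment of the linear form with coefficients \<open>vs\<close> under the product
  of the possibly signed laws in \<open>\<phi>s\<close>, each of which puts mass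
  \<open>\<phi> b\<close> at the point \<open>t b\<close>.\<close>

definition tmom :: "nat set \<Rightarrow> (nat \<Rightarrow> rat) \<Rightarrow> (nat \<Rightarrow> rat) list \<Rightarrow> rat list \<Rightarrow> nat \<Rightarrow> rat" where
  "tmom I t \<phi>s vs j = (\<Sum>bs\<in>tuples I (length \<phi>s). weight \<phi>s bs * dot (map t bs) vs ^ j)"

lemma tmom_Nil: "tmom I t [] vs j = (if j = 0 then 1 else 0)"
  by (simp add: tmom_def tuples_0)

text \<open>Binomial expansion in the first coordinate; the mixed moments factor because the law is
  a product.\<close>

lemma tmom_Cons:
  "tmom I t (\<phi> # \<phi>s) (x # vs) j
     = (\<Sum>i\<le>j. of_nat (j choose i) * (\<Sum>b\<in>I. \<phi> b * t b ^ i) * x ^ i * tmom I t \<phi>s vs (j - i))"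
proof -
  let ?S = "tuples I (length \<phi>s)"
  have "tmom I t (\<phi> # \<phi>s) (x # vs) j
     = (\<Sum>b\<in>I. \<Sum>bs\<in>?S. \<phi> b * weight \<phi>s bs * (t b * x + dot (map t bs) vs) ^ j)"
    by (simp add: tmom_def sum_tuples_Suc)
  also have "\<dots> = (\<Sum>b\<in>I. \<Sum>bs\<in>?S. \<Sum>i\<le>j. \<phi> b * weight \<phi>s bs * (of_nat (j choose i) * (t b * x) ^ i * dot (map t bs) vs ^ (j - i)))"
    unfolding binomial_ring sum_distrib_left ..
  also have "\<dots> = (\<Sum>b\<in>I. \<Sum>i\<le>j. \<Sum>bs\<in>?S. \<phi> b * weight \<phi>s bs * (of_nat (j choose i) * (t b * x) ^ i * dot (map t bs) vs ^ (j - i)))"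
    by (intro sum.cong refl sum.swap)
  also have "\<dots> = (\<Sum>i\<le>j. \<Sum>b\<in>I. \<Sum>bs\<in>?S. \<phi> b * weight \<phi>s bs * (of_nat (j choose i) * (t b * x) ^ i * dot (map t bs) vs ^ (j - i)))"
    by (rule sum.swap)
  also have "\<dots> = (\<Sum>i\<le>j. of_nat (j choose i) * (\<Sum>b\<in>I. \<phi> b * t b ^ i) * x ^ i * tmom I t \<phi>s vs (j - i))"
    unfolding tmom_def sum_distrib_left sum_distrib_right
    by (rule sum.cong[OF refl], subst sum.swap, intro sum.cong refl) (simp add: power_mult_distrib mult_ac)
  finally show ?thesis .
qed

text \<open>Rotation invariance of the Gaussian law: the moments of a linear form depend on its
  coefficient vector only through the Euclidean length.\<close>

lemma tmom_gaussian:
  assumes "\<And>i. i \<le> d \<Longrightarrow> (\<Sum>b\<in>I. w b * t b ^ i) = gmom i" and "j \<le> d"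
  shows "tmom I t (replicate (length vs) w) vs j = gmom j * (\<Sum>v\<leftarrow>vs. v^2) ^ (j div 2)"
  using assms(2)
proof (induction vs arbitrary: j)
  case Nil
  show ?case
  proof (cases "even j")
    case True
    then show ?thesis by (auto simp: tmom_Nil elim!: evenE)
  qed (auto simp: tmom_Nil gmom_odd odd_pos)
next
  case (Cons x vs)
  have "tmom I t (w # replicate (length vs) w) (x # vs) j
     = (\<Sum>i\<le>j. of_nat (j choose i) * gmom i * x ^ i * (gmom (j - i) * (\<Sum>v\<leftarrow>vs. v^2) ^ ((j - i) div 2)))"
    unfolding tmom_Cons using Cons assms(1) by (intro sum.cong refl) simp
  then show ?case unfolding gmom_convolution by simp
qed

text \<open>In the multinomial expansion of the power of the linear form, the product of the dual
  laws annihilates every monomial except the one with exponents \<open>e\<close>. The factorials of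
  the multinomial coefficient are kept as factors on both sides.\<close>

lemma tmom_monomial:
  assumes "\<And>i j. i \<le> d \<Longrightarrow> j \<le> d \<Longrightarrow> (\<Sum>b\<in>I. lam j b * t b ^ i) = (if i = j then 1 else 0)"
    and "sum_list e \<le> d" "length e = length vs"
  shows "prod_list (map fact e) * tmom I t (map lam e) vs (sum_list e) = fact (sum_list e) * monomial e vs"
  using assms(3,2)
proof (induction e vs rule: list_induct2)
  case Nil
  then show ?case by (simp add: tmom_Nil)
next
  case (Cons a e x vs)
  let ?j = "a + sum_list e"
  have "tmom I t (map lam (a # e)) (x # vs) ?j = (\<Sum>i\<le>?j. if i = a then of_nat (?j choose a) * x ^ a * tmom I t (map lam e) vs (?j - a) else 0)"
    unfolding list.map tmom_Cons using Cons assms(1) by (intro sum.cong refl) auto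
  also have "\<dots> = of_nat (?j choose a) * x ^ a * tmom I t (map lam e) vs (sum_list e)" by simp
  also have "of_nat (?j choose a) = (fact ?j / (fact a * fact (sum_list e)) :: rat)"
    using binomial_fact[of a ?j] by simp
  finally have "prod_list (map fact (a # e)) * tmom I t (map lam (a # e)) (x # vs) ?j
    = fact ?j * x ^ a / fact (sum_list e) * (prod_list (map fact e) * tmom I t (map lam e) vs (sum_list e))"
    by simp
  also have "\<dots> = fact ?j * x ^ a / fact (sum_list e) * (fact (sum_list e) * monomial e vs)"
    using Cons by simp
  finally show ?case by simp
qed

lemma common_denominator:
  assumes "finite S"
  shows "\<exists>D::nat. D > 0 \<and> (\<forall>x\<in>S. \<exists>z::int. of_nat D * f x = rat_of_int z)"
  using assms
proof (induction S)
  case empty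
  show ?case by (intro exI[of _ 1]) simp
next
  case (insert x S)
  then obtain D :: nat where D: "D > 0" "\<And>y. y \<in> S \<Longrightarrow> \<exists>z::int. of_nat D * f y = rat_of_int z" by blast
  obtain a b where ab: "quotient_of (f x) = (a, b)" by fastforce
  then have b: "b > 0" "f x = of_int a / of_int b"
    using quotient_of_denom_pos quotient_of_div by blast+
  have "\<exists>z::int. of_nat (D * nat b) * f y = rat_of_int z" if "y \<in> insert x S" for y
  proof (cases "y = x")
    case True
    have "of_nat (D * nat b) * f y = rat_of_int (int D * a)" unfolding True b(2) using b(1) by simp
    then show ?thesis by blast
  next
    case False
    then have "y \<in> S" using that by simp
    then obtain z :: int where "of_nat D * f y = rat_of_int z" using D(2) by blast
    then have "of_nat (D * nat b) * f y = rat_of_int (b * z)" using b(1) by (simp add: mult_ac)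
    then show ?thesis by blast
  qed
  then show ?case using D(1) b(1) by (intro exI[of _ "D * nat b"]) auto
qed

lemma dominating_multiple:
  fixes \<alpha> \<beta> :: "'a \<Rightarrow> rat"
  assumes "finite S" "\<And>x. x \<in> S \<Longrightarrow> \<alpha> x > 0"
  shows "\<exists>A::nat. A > 0 \<and> (\<forall>x\<in>S. of_nat A * \<alpha> x + \<beta> x > 0)"
proof -
  define B where "B = (\<Sum>x\<in>S. \<bar>\<beta> x\<bar> / \<alpha> x)"
  obtain A :: nat where A: "of_nat A > B" using reals_Archimedean2 by blast
  have "of_nat (Suc A) * \<alpha> x + \<beta> x > 0" if x: "x \<in> S" for x
  proof -
    have "\<bar>\<beta> x\<bar> / \<alpha> x \<le> B" unfolding B_def
      using assms x by (intro member_le_sum) (auto simp: less_imp_le)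
    then have "\<bar>\<beta> x\<bar> / \<alpha> x < of_nat (Suc A)" using A by simp
    then have "\<bar>\<beta> x\<bar> < of_nat (Suc A) * \<alpha> x" using assms(2)[OF x] by (simp add: pos_divide_less_eq)
    then show ?thesis by linarith
  qed
  then show ?thesis by blast
qed

lemma weight_replicate_pos:
  "(\<And>b. b \<in> set bs \<Longrightarrow> w b > 0) \<Longrightarrow> length bs = N \<Longrightarrow> weight (replicate N w) bs > 0"
  by (induction bs arbitrary: N) auto

lemma dot_scale:
  "dot (map (\<lambda>b. of_int (T b) / q) bs) (map of_int vs) = (of_int (dot (map T bs) vs) / q :: rat)"
  by (induction "map (\<lambda>b. of_int (T b) / q) bs" "map of_int vs :: rat list" arbitrary: bs vs rule: dot.induct)
     (auto simp: add_divide_distrib map_eq_Cons_conv)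

lemma monomial_of_int: "monomial e (map of_int vs) = (of_int (monomial e vs) :: rat)"
  by (induction e vs rule: monomial.induct) auto

lemma of_int_sum_list_squares: "(\<Sum>v\<leftarrow>map of_int vs. v^2) = (of_int (\<Sum>v\<leftarrow>vs. v^2) :: rat)"
  by (induction vs) auto

text \<open>The weights \<open>w\<close> produce \<open>\<bar>v\<bar>\<close> to the power \<open>2 k\<close> and the signed dual weights \<open>lam\<close> the monomials. All these weights live on the
  same nodes, so a large multiple of the former makes the sum positive.\<close>

theorem hilbert_identity:
  fixes es :: "nat list list"
  assumes k: "k \<ge> 1" and es: "\<And>e. e \<in> set es \<Longrightarrow> length e = N \<and> sum_list e = 2 * k"
  obtains A D :: nat and cbs :: "(nat \<times> int list) list"
  where "A > 0" "D > 0" "\<And>c b. (c, b) \<in> set cbs \<Longrightarrow> c > 0"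
    "\<And>vs :: int list. length vs = N \<Longrightarrow>
       int D * (int A * (\<Sum>v\<leftarrow>vs. v^2) ^ k + (\<Sum>e\<leftarrow>es. monomial e vs)) = (\<Sum>(c, b)\<leftarrow>cbs. int c * dot b vs ^ (2 * k))"
proof -
  obtain n q :: nat and T :: "nat \<Rightarrow> int" and t w :: "nat \<Rightarrow> rat" and lam :: "nat \<Rightarrow> nat \<Rightarrow> rat" where
    q: "q > 0" and t: "\<And>b. t b = of_int (T b) / of_nat q" and w: "\<And>b. b \<le> n \<Longrightarrow> w b > 0"
    and gauss: "\<And>i. i \<le> 2 * k \<Longrightarrow> (\<Sum>b\<le>n. w b * t b ^ i) = gmom i"
    and dual: "\<And>i j. i \<le> 2 * k \<Longrightarrow> j \<le> 2 * k \<Longrightarrow> (\<Sum>b\<le>n. lam j b * t b ^ i) = (if i = j then 1 else 0)"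
    by (rule gaussian_quadrature[OF k]) (rule that)
  define S where "S = tuples {..n} N"
  have finS: "finite S" by (simp add: S_def finite_tuples)
  have g0: "gmom (2 * k) > 0" by (simp add: gmom_even)
  \<comment> \<open>The normalisations are such that the weights \<open>\<alpha>\<close> yield
    exactly |v|^(2k) (fact \<open>1\<close>) and the weights \<open>\<beta>\<close> the sum of the
    monomials (facts \<open>2\<close> and \<open>3\<close>).\<close>
  define \<alpha> where "\<alpha> bs = weight (replicate N w) bs / gmom (2 * k)" for bs
  define cf :: "nat list \<Rightarrow> rat" where "cf e = prod_list (map fact e) / fact (2 * k)" for e
  define \<beta> where "\<beta> bs = (\<Sum>e\<leftarrow>es. cf e * weight (map lam e) bs)" for bs
  have \<alpha>: "\<alpha> bs > 0" if "bs \<in> S" for bs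
    using that w g0 unfolding \<alpha>_def S_def tuples_def
    by (intro divide_pos_pos weight_replicate_pos) auto
  have "\<exists>A::nat. A > 0 \<and> (\<forall>bs\<in>S. of_nat A * \<alpha> bs + \<beta> bs > 0)"
    by (rule dominating_multiple[OF finS]) (rule \<alpha>)
  then obtain A :: nat where A: "A > 0" "\<forall>bs\<in>S. of_nat A * \<alpha> bs + \<beta> bs > 0" by (elim exE conjE)
  \<comment> \<open>The power of q turns the rational nodes \<open>t b\<close> into the integers
    \<open>T b\<close>; the factor \<open>D\<close> below makes the weights natural numbers.\<close>
  define c where "c bs = (of_nat A * \<alpha> bs + \<beta> bs) / of_nat q ^ (2 * k)" for bs
  have c0: "c bs > 0" if "bs \<in> S" for bs using bspec[OF A(2) that] q by (simp add: c_def)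
  have "\<exists>D::nat. D > 0 \<and> (\<forall>bs\<in>S. \<exists>z::int. of_nat D * c bs = rat_of_int z)"
    by (rule common_denominator[OF finS])
  then obtain D :: nat where D: "D > 0" "\<forall>bs\<in>S. \<exists>z::int. of_nat D * c bs = rat_of_int z" by (elim exE conjE)
  define z where "z bs = nat \<lfloor>of_nat D * c bs\<rfloor>" for bs
  have z: "rat_of_nat (z bs) = of_nat D * c bs" if bs: "bs \<in> S" for bs
  proof -
    have "of_nat D * c bs > 0" using D(1) c0[OF bs] by simp
    moreover obtain y :: int where "of_nat D * c bs = rat_of_int y" using bspec[OF D(2) bs] by (elim exE)
    ultimately show ?thesis by (simp add: z_def)
  qed
  have z0: "z bs > 0" if "bs \<in> S" for bs
  proof -
    have "rat_of_nat (z bs) > 0" unfolding z[OF that] using D(1) c0[OF that] by simp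
    then show ?thesis by simp
  qed
  obtain L where L: "set L = S" "distinct L" using finite_distinct_list[OF finS] by blast
  show thesis
  proof (rule that[of A D "map (\<lambda>bs. (z bs, map T bs)) L"])
    show "A > 0" "D > 0" by (fact A D)+
    show "x > 0" if "(x, b) \<in> set (map (\<lambda>bs. (z bs, map T bs)) L)" for x b
      using that z0 L by auto
    fix vs :: "int list" assume len: "length vs = N"
    define u :: "rat list" where "u = map of_int vs"
    have lenu: "length u = N" by (simp add: u_def len)
    have d: "dot (map t bs) u = of_int (dot (map T bs) vs) / of_nat q" for bs
      unfolding t u_def by (rule dot_scale)
    have 1: "(\<Sum>bs\<in>S. \<alpha> bs * dot (map t bs) u ^ (2 * k)) = (\<Sum>v\<leftarrow>u. v^2) ^ k"
    proof -
      have "(\<Sum>bs\<in>S. \<alpha> bs * dot (map t bs) u ^ (2 * k)) = tmom {..n} t (replicate (length u) w) u (2 * k) / gmom (2 * k)"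
        by (simp add: \<alpha>_def tmom_def S_def lenu sum_divide_distrib)
      also have "\<dots> = (\<Sum>v\<leftarrow>u. v^2) ^ k"
        by (subst tmom_gaussian[where d = "2 * k"]) (use gauss g0 in auto)
      finally show ?thesis .
    qed
    have 2: "(\<Sum>bs\<in>S. cf e * weight (map lam e) bs * dot (map t bs) u ^ (2 * k)) = monomial e u" if e: "e \<in> set es" for e
    proof -
      have "(\<Sum>bs\<in>S. cf e * weight (map lam e) bs * dot (map t bs) u ^ (2 * k))
        = prod_list (map fact e) * tmom {..n} t (map lam e) u (sum_list e) / fact (2 * k)"
        using es[OF e] by (simp add: cf_def tmom_def S_def sum_divide_distrib sum_distrib_left mult.assoc)
      also have "\<dots> = monomial e u"
        by (subst tmom_monomial[where d = "2 * k"]) (use dual es[OF e] lenu in auto)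
      finally show ?thesis .
    qed
    have 3: "(\<Sum>bs\<in>S. \<beta> bs * dot (map t bs) u ^ (2 * k)) = (\<Sum>e\<leftarrow>es. monomial e u)"
    proof -
      have "(\<Sum>bs\<in>S. \<beta> bs * dot (map t bs) u ^ (2 * k))
        = (\<Sum>e\<leftarrow>es. \<Sum>bs\<in>S. cf e * weight (map lam e) bs * dot (map t bs) u ^ (2 * k))"
        unfolding \<beta>_def by (induction es) (simp_all add: distrib_right sum.distrib)
      also have "\<dots> = (\<Sum>e\<leftarrow>es. monomial e u)"
        by (intro arg_cong[where f = sum_list] map_cong refl 2)
      finally show ?thesis .
    qed
    have "(\<Sum>bs\<in>S. c bs * of_int (dot (map T bs) vs) ^ (2 * k)) =
       (\<Sum>bs\<in>S. of_nat A * (\<alpha> bs * dot (map t bs) u ^ (2 * k)) + \<beta> bs * dot (map t bs) u ^ (2 * k))"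
      unfolding d by (intro sum.cong refl) (simp add: c_def power_divide algebra_simps add_divide_distrib)
    also have "\<dots> = of_nat A * (\<Sum>v\<leftarrow>u. v^2) ^ k + (\<Sum>e\<leftarrow>es. monomial e u)"
      unfolding sum.distrib sum_distrib_left[symmetric] 1 3 ..
    also have "\<dots> = of_int (int A * (\<Sum>v\<leftarrow>vs. v^2) ^ k + (\<Sum>e\<leftarrow>es. monomial e vs))"
    proof -
      have "(\<Sum>e\<leftarrow>es. monomial e u) = of_int (\<Sum>e\<leftarrow>es. monomial e vs)"
        unfolding u_def by (induction es) (simp_all add: monomial_of_int)
      then show ?thesis unfolding u_def of_int_sum_list_squares by simp
    qed
    finally have 4: "(\<Sum>bs\<in>S. c bs * of_int (dot (map T bs) vs) ^ (2 * k)) = of_int (int A * (\<Sum>v\<leftarrow>vs. v^2) ^ k + (\<Sum>e\<leftarrow>es. monomial e vs))" .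
    have "rat_of_int (\<Sum>bs\<in>S. int (z bs) * dot (map T bs) vs ^ (2 * k)) = (\<Sum>bs\<in>S. of_nat D * (c bs * of_int (dot (map T bs) vs) ^ (2 * k)))"
      unfolding of_int_sum by (intro sum.cong refl) (simp add: z)
    also have "\<dots> = rat_of_int (int D * (int A * (\<Sum>v\<leftarrow>vs. v^2) ^ k + (\<Sum>e\<leftarrow>es. monomial e vs)))"
      unfolding sum_distrib_left[symmetric] 4 by simp
    finally have "(\<Sum>bs\<in>S. int (z bs) * dot (map T bs) vs ^ (2 * k)) = int D * (int A * (\<Sum>v\<leftarrow>vs. v^2) ^ k + (\<Sum>e\<leftarrow>es. monomial e vs))"
      unfolding of_int_eq_iff .
    moreover have "(\<Sum>(c, b)\<leftarrow>map (\<lambda>bs. (z bs, map T bs)) L. int c * dot b vs ^ (2 * k)) = (\<Sum>bs\<in>S. int (z bs) * dot (map T bs) vs ^ (2 * k))"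
      using sum_list_distinct_conv_sum_set[OF L(2), of "\<lambda>bs. int (z bs) * dot (map T bs) vs ^ (2 * k)"] L(1) by (simp add: comp_def)
    ultimately show "int D * (int A * (\<Sum>v\<leftarrow>vs. v^2) ^ k + (\<Sum>e\<leftarrow>es. monomial e vs))
      = (\<Sum>(c, b)\<leftarrow>map (\<lambda>bs. (z bs, map T bs)) L. int c * dot b vs ^ (2 * k))" by simp
  qed
qed

subsection \<open>Waring's problem for even exponents\<close>

text \<open>The semiring and the range of the variables are left open, so that the same calculus
  serves for natural numbers and for rings of integers.\<close>

definition diag_rep :: "nat \<Rightarrow> 'a::comm_semiring_1 set \<Rightarrow> 'a list \<Rightarrow> 'a \<Rightarrow> bool" where
  "diag_rep m S as x \<longleftrightarrow> (\<exists>xs. length xs = length as \<and> set xs \<subseteq> S \<and> x = dot as (map (\<lambda>x. x ^ m) xs))"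

lemma dot_append: "length a = length c \<Longrightarrow> dot (a @ b) (c @ d) = dot a c + dot b d"
  by (induction a c rule: list_induct2) (auto simp: add.assoc)

lemma dot_zero: "dot as (map (\<lambda>_. 0) as) = 0"
  by (induction as) auto

lemma monomial_append: "length a = length c \<Longrightarrow> monomial (a @ b) (c @ d) = monomial a c * monomial b d"
  by (induction a c rule: list_induct2) (auto simp: mult.assoc)

lemma diag_rep_append: "diag_rep m S as x \<Longrightarrow> diag_rep m S bs y \<Longrightarrow> diag_rep m S (as @ bs) (x + y)"
  unfolding diag_rep_def by (elim exE conjE, rule_tac x = "xs @ xsa" in exI) (simp add: dot_append)

lemma diag_rep_0: "m > 0 \<Longrightarrow> 0 \<in> S \<Longrightarrow> diag_rep m S as 0"
  unfolding diag_rep_def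
  by (intro exI[of _ "map (\<lambda>_. 0) as"]) (auto simp: comp_def dot_zero power_0_left)

lemma diag_rep_ones: "m > 0 \<Longrightarrow> j \<le> M \<Longrightarrow> diag_rep m (UNIV :: nat set) (replicate M 1) j"
proof (induction M arbitrary: j)
  case 0
  then show ?case by (simp add: diag_rep_0)
next
  case (Suc M)
  have one: "diag_rep m (UNIV :: nat set) [1] i" if "i \<le> 1" for i
    unfolding diag_rep_def using that \<open>m > 0\<close>
    by (intro exI[of _ "[i]"]) (cases i, auto simp: power_0_left)
  have "diag_rep m UNIV (replicate M 1) (j - 1)" using Suc by simp
  from diag_rep_append[OF one this, of "min 1 j"]
  have "diag_rep m UNIV (replicate (Suc M) 1) (min 1 j + (j - 1))" by simp
  moreover have "min 1 j + (j - 1) = j" by simp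
  ultimately show ?case by (simp only:)
qed

lemma base_digits:
  assumes "\<rho> < s ^ n"
  shows "\<exists>xs :: nat list. length xs = n \<and> (\<forall>x\<in>set xs. x < s) \<and> \<rho> = (\<Sum>j<n. s ^ j * xs ! j)"
  using assms
proof (induction n arbitrary: \<rho>)
  case (Suc n)
  then have s: "s > 0" by (cases s) auto
  have "\<rho> div s < s ^ n" using Suc.prems s by (simp add: div_less_iff_less_mult mult.commute)
  from Suc.IH[OF this] obtain ys where ys: "length ys = n" "\<forall>x\<in>set ys. x < s" "\<rho> div s = (\<Sum>j<n. s ^ j * ys ! j)"
    by blast
  have "\<rho> = \<rho> mod s + s * (\<rho> div s)" by simp
  also have "\<dots> = (\<Sum>j<Suc n. s ^ j * ((\<rho> mod s) # ys) ! j)"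
    unfolding sum.lessThan_Suc_shift ys(3) by (simp add: sum_distrib_left mult.assoc)
  finally show ?case using ys s by (intro exI[of _ "(\<rho> mod s) # ys"]) auto
qed simp

lemma monomial_unit:
  assumes "j < length xs"
  shows "monomial (map (\<lambda>i. if i = j then 1 else 0) [0..<length xs]) xs = xs ! j"
proof -
  have "monomial e xs = (\<Prod>i<length xs. xs ! i ^ (e ! i))" if "length e = length xs" for e
    using that by (induction e xs rule: list_induct2) (auto simp: prod.lessThan_Suc_shift simp del: prod.lessThan_Suc)
  then have "monomial (map (\<lambda>i. if i = j then 1 else 0) [0..<length xs]) xs = (\<Prod>i<length xs. if i = j then xs ! i else 1)"
    by (simp add: if_distrib[of "\<lambda>e. _ ^ e"] cong: if_cong)
  then show ?thesis using assms by simp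
qed

lemma power_Suc_upper: "(T + 1) ^ k \<le> T ^ k + k * (T + 1) ^ (k - 1)" for T k :: nat
proof (induction k)
  case (Suc k)
  have e: "k * (T + 1) ^ (k - 1) * (T + 1) = k * (T + 1) ^ k" by (cases k) (simp_all add: algebra_simps)
  have "(T + 1) ^ Suc k = (T + 1) ^ k * (T + 1)" by simp
  also have "\<dots> \<le> (T ^ k + k * (T + 1) ^ (k - 1)) * (T + 1)" using Suc by (rule mult_right_mono) simp
  also have "\<dots> = T ^ Suc k + T ^ k + k * (T + 1) ^ k" unfolding distrib_right e by simp
  also have "\<dots> \<le> T ^ Suc k + (T + 1) ^ k + k * (T + 1) ^ k" by (simp add: power_mono)
  finally show ?case by simp
qed simp

lemma monotone_bracket:
  fixes f :: "nat \<Rightarrow> nat"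
  assumes "f 0 \<le> n" "n < f b"
  obtains t where "f t \<le> n" "n < f (Suc t)"
proof -
  define t where "t = (LEAST t. n < f (Suc t))"
  have "b > 0" using assms by (cases b) auto
  then have ex: "n < f (Suc (b - 1))" using assms by simp
  have 1: "n < f (Suc t)" unfolding t_def by (rule LeastI[of "\<lambda>t. n < f (Suc t)", OF ex])
  have "f t \<le> n"
  proof (cases t)
    case (Suc t')
    then have "\<not> n < f (Suc t')" using not_less_Least[of t' "\<lambda>t. n < f (Suc t)"] by (simp add: t_def)
    then show ?thesis using Suc by simp
  qed (use assms in simp)
  then show ?thesis using 1 that by blast
qed

text \<open>If T is the largest number with A T^k <= n, the remainder is of order at most T^(k-1).
  For s of order sqrt(T), 2k digits to base s reach s^(2k), which is of order T^k and hence more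
  than enough, while 1 + s^2 and the squares of the digits still sum to at most T.\<close>

lemma interval_representation:
  assumes k: "k \<ge> 1" and A: "A > 0"
  shows "\<exists>n0. \<forall>n\<ge>n0. \<exists>T s xs. n = A * T ^ k + (\<Sum>j<2*k. s ^ j * xs ! j) \<and> length xs = 2 * k
           \<and> 1 + s^2 + (\<Sum>x\<leftarrow>xs. x^2) \<le> (T :: nat)"
proof -
  \<comment> \<open>From \<open>f s \<le> T\<close> and \<open>T < f (Suc s)\<close> follows T + 1
    <= (2k+1)(4 s^2 + s^2), hence the 5. The remainder is then below \<open>Bd\<close> times
    s^(2k-2), and \<open>T0\<close> forces s > \<open>Bd\<close>.\<close>
  define c where "c = 5 * (2 * k + 1)"
  define Bd where "Bd = A * k * c ^ (k - 1)"
  define f where "f s = (2 * k + 1) * s^2 + 1" for s :: nat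
  define T0 where "T0 = f (Bd + 1)"
  have "\<exists>T s xs. n = A * T ^ k + (\<Sum>j<2*k. s ^ j * xs ! j) \<and> length xs = 2 * k \<and> 1 + s^2 + (\<Sum>x\<leftarrow>xs. x^2) \<le> T"
    if n: "n \<ge> A * T0 ^ k" for n
  proof -
    have "n < A * Suc n ^ k"
    proof -
      have "n < Suc n ^ 1" by simp
      also have "\<dots> \<le> Suc n ^ k" using k by (intro power_increasing) auto
      also have "\<dots> \<le> A * Suc n ^ k" using A by simp
      finally show ?thesis .
    qed
    then obtain T where T: "A * T ^ k \<le> n" "n < A * Suc T ^ k"
      using monotone_bracket[of "\<lambda>T. A * T ^ k" n "Suc n"] k by (auto simp: power_0_left)
    have "T0 \<le> T"
    proof (rule ccontr)
      assume "\<not> T0 \<le> T"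
      then have "A * Suc T ^ k \<le> A * T0 ^ k" by (intro mult_left_mono power_mono) auto
      then show False using n T(2) by linarith
    qed
    moreover have "1 \<le> T0" by (simp add: T0_def f_def)
    moreover have "T < f (T + 1)"
    proof -
      have "T + 1 \<le> (2 * k + 1) * (T + 1)^2" by (simp add: power2_eq_square)
      then show ?thesis by (simp add: f_def)
    qed
    ultimately obtain s where s: "f s \<le> T" "T < f (Suc s)"
      using monotone_bracket[of f T "T + 1"] by (auto simp: f_def)
    have sB: "Bd + 1 \<le> s"
    proof (rule ccontr)
      assume "\<not> Bd + 1 \<le> s"
      then have "Suc s ^ 2 \<le> (Bd + 1)^2" by (intro power_mono) auto
      then have "f (Suc s) \<le> f (Bd + 1)" unfolding f_def by (intro add_right_mono mult_left_mono) auto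
      then show False using \<open>T0 \<le> T\<close> s(2) by (simp add: T0_def)
    qed
    define \<rho> where "\<rho> = n - A * T ^ k"
    have \<rho>: "n = A * T ^ k + \<rho>" using T(1) by (simp add: \<rho>_def)
    have Tc: "T + 1 \<le> c * s^2"
    proof -
      have "Suc s \<le> 2 * s" using sB by simp
      then have "Suc s ^ 2 \<le> (2 * s)^2" by (rule power_mono) simp
      then have "Suc s ^ 2 \<le> 4 * s^2" by (simp add: power_mult_distrib)
      then have "(2 * k + 1) * Suc s ^ 2 \<le> (2 * k + 1) * (4 * s^2)" by (rule mult_left_mono) simp
      moreover have "s^2 > 0" using sB by simp
      then have "1 * 1 \<le> (2 * k + 1) * s^2" by (intro mult_le_mono) linarith+
      ultimately have "T + 1 \<le> (2 * k + 1) * (4 * s^2) + (2 * k + 1) * s^2" using s(2) unfolding f_def by linarith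
      then show ?thesis by (simp add: c_def algebra_simps)
    qed
    have "A * Suc T ^ k \<le> A * (T ^ k + k * (T + 1) ^ (k - 1))"
      using power_Suc_upper[of T k] by (intro mult_left_mono) auto
    then have "\<rho> < A * k * (T + 1) ^ (k - 1)" using T(2) \<rho> by (simp add: distrib_left mult.assoc)
    also have "\<dots> \<le> A * k * (c * s^2) ^ (k - 1)" using Tc by (intro mult_left_mono power_mono) auto
    also have "\<dots> = Bd * (s^2) ^ (k - 1)" by (simp add: Bd_def power_mult_distrib)
    also have "\<dots> \<le> s^2 * (s^2) ^ (k - 1)"
    proof (rule mult_right_mono)
      have "Bd \<le> s * 1" using sB by simp
      also have "\<dots> \<le> s * s" using sB by (intro mult_left_mono) auto
      finally show "Bd \<le> s^2" by (simp add: power2_eq_square)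
    qed simp
    also have "\<dots> = (s^2) ^ k" using k by (simp flip: power_Suc)
    also have "\<dots> = s ^ (2 * k)" by (simp add: power_mult)
    finally obtain xs where xs: "length xs = 2 * k" "\<forall>x\<in>set xs. x < s" "\<rho> = (\<Sum>j<2*k. s ^ j * xs ! j)"
      using base_digits by blast
    have "(\<Sum>x\<leftarrow>xs. x^2) \<le> (\<Sum>x\<leftarrow>xs. s^2)" using xs(2) by (intro sum_list_mono power_mono) auto
    also have "\<dots> = 2 * k * s^2" using xs(1) by (simp add: sum_list_triv)
    finally have "1 + s^2 + (\<Sum>x\<leftarrow>xs. x^2) \<le> f s" by (simp add: f_def)
    then show ?thesis using \<rho> xs s(1) by (intro exI[of _ T] exI[of _ s] exI[of _ xs]) auto
  qed
  then show ?thesis by blast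
qed

theorem waring_even:
  assumes k: "k \<ge> 1"
  obtains as :: "nat list" where "\<And>a. a \<in> set as \<Longrightarrow> a > 0" "\<And>n. diag_rep (2 * k) UNIV as n"
proof -
  \<comment> \<open>The variables are 1, s, the 2k digits and the four squares. \<open>ex j\<close>
    is the exponent vector of 1^(2k-1-j) s^j x_j; the variable 1 pads the degree to 2k.\<close>
  define ex where "ex j = [2 * k - 1 - j, j] @ (map (\<lambda>i. if i = j then 1 else 0) [0..<2*k]) @ [0, 0, 0, 0]" for j
  define es where "es = map ex [0..<2*k]"
  have es: "length e = 2 * k + 6 \<and> sum_list e = 2 * k" if e: "e \<in> set es" for e
  proof -
    obtain j where j: "j < 2 * k" "e = ex j" using e by (auto simp: es_def)
    have "sum_list (map (\<lambda>i. if i = j then 1 else 0 :: nat) [0..<2*k]) = 1"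
      using j(1) by (simp add: interv_sum_list_conv_sum_set_nat)
    then show ?thesis using j by (simp add: ex_def)
  qed
  obtain A D :: nat and cbs :: "(nat \<times> int list) list" where A: "A > 0" and D: "D > 0" and cbs: "\<And>c b. (c, b) \<in> set cbs \<Longrightarrow> c > 0"
    and id: "\<And>vs :: int list. length vs = 2 * k + 6 \<Longrightarrow>
       int D * (int A * (\<Sum>v\<leftarrow>vs. v^2) ^ k + (\<Sum>e\<leftarrow>es. monomial e vs)) = (\<Sum>(c, b)\<leftarrow>cbs. int c * dot b vs ^ (2 * k))"
    by (rule hilbert_identity[OF k, where es = es]) (erule es, rule that)
  obtain n0 where n0: "\<And>n. n \<ge> n0 \<Longrightarrow> \<exists>T s xs. n = A * T ^ k + (\<Sum>j<2*k. s ^ j * xs ! j) \<and> length xs = 2 * k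
           \<and> 1 + s^2 + (\<Sum>x\<leftarrow>xs. x^2) \<le> (T :: nat)"
    using interval_representation[OF k A] by blast
  define L where "L = map fst cbs"
  have large: "diag_rep (2 * k) UNIV L (D * n)" if n1: "n \<ge> n0" for n
  proof -
    obtain T s xs where n: "n = A * T ^ k + (\<Sum>j<2*k. s ^ j * xs ! j)" and len: "length xs = 2 * k"
      and T: "1 + s^2 + (\<Sum>x\<leftarrow>xs. x^2) \<le> (T :: nat)" using n0[OF n1] by blast
    \<comment> \<open>The last four variables occur in no monomial and only complete |v|^2 to
      T.\<close>
    have "four_sq (int T - int (1 + s^2 + (\<Sum>x\<leftarrow>xs. x^2)))" by (rule lagrange_four_squares) (use T in linarith)
    then obtain y1 y2 y3 y4 where y: "int T - int (1 + s^2 + (\<Sum>x\<leftarrow>xs. x^2)) = y1^2 + y2^2 + y3^2 + y4^2"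
      unfolding four_sq_def by blast
    define vs where "vs = [1, int s] @ map int xs @ [y1, y2, y3, y4]"
    have sq: "(\<Sum>v\<leftarrow>vs. v^2) = int T"
    proof -
      have "(\<Sum>v\<leftarrow>map int xs. v^2) = int (\<Sum>x\<leftarrow>xs. x^2)" by (induction xs) auto
      then show ?thesis using y by (simp add: vs_def comp_def)
    qed
    have mono: "monomial (ex j) vs = int (s ^ j * xs ! j)" if j: "j < 2 * k" for j
    proof -
      have "monomial (ex j) vs = monomial [2 * k - 1 - j, j] [1, int s] *
        (monomial (map (\<lambda>i. if i = j then 1 else 0) [0..<length (map int xs)]) (map int xs) * monomial [0,0,0,0] [y1,y2,y3,y4])"
        unfolding ex_def vs_def
        by (subst monomial_append, simp, subst monomial_append) (use len in simp_all)
      then show ?thesis using monomial_unit[of j "map int xs"] j len by simp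
    qed
    have "(\<Sum>e\<leftarrow>es. monomial e vs) = (\<Sum>j<2*k. monomial (ex j) vs)"
      by (simp add: es_def interv_sum_list_conv_sum_set_nat comp_def lessThan_atLeast0)
    also have "\<dots> = int (\<Sum>j<2*k. s ^ j * xs ! j)" unfolding of_nat_sum by (intro sum.cong refl mono) simp
    finally have "int (D * n) = (\<Sum>(c, b)\<leftarrow>cbs. int c * dot b vs ^ (2 * k))"
      using id[of vs] len unfolding sq n by (simp add: vs_def)
    \<comment> \<open>The exponent is even, so the values of the linear forms may be replaced by
      their absolute values.\<close>
    also have "\<dots> = int (dot L (map (\<lambda>x. x ^ (2 * k)) (map (\<lambda>(c, b). nat \<bar>dot b vs\<bar>) cbs)))"
      unfolding L_def by (induction cbs) (auto simp: power_even_abs)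
    finally have "D * n = dot L (map (\<lambda>x. x ^ (2 * k)) (map (\<lambda>(c, b). nat \<bar>dot b vs\<bar>) cbs))"
      unfolding of_nat_eq_iff .
    moreover have "length (map (\<lambda>(c, b). nat \<bar>dot b vs\<bar>) cbs) = length L" by (simp add: L_def)
    ultimately show ?thesis unfolding diag_rep_def by blast
  qed
  \<comment> \<open>\<open>L\<close> alone reaches the multiples of D from D n0 on. The M
    coefficients 1 supply the residue mod D there, and by themselves every smaller number.\<close>
  define M where "M = D * n0 + D"
  have all: "diag_rep (2 * k) UNIV (L @ replicate M 1) n" for n
  proof (cases "n div D \<ge> n0")
    case True
    have "n mod D \<le> M" using D mod_less_divisor[of D n] unfolding M_def by linarith
    then have "diag_rep (2 * k) UNIV (L @ replicate M 1) (D * (n div D) + n mod D)"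
      using large[OF True] k by (intro diag_rep_append diag_rep_ones) auto
    then show ?thesis by simp
  next
    case False
    have "n = D * (n div D) + n mod D" by simp
    also have "\<dots> \<le> D * n0 + D" using False D by (intro add_mono mult_left_mono) (auto simp: less_imp_le)
    finally have "diag_rep (2 * k) UNIV (L @ replicate M 1) (0 + n)"
      unfolding M_def[symmetric] using k by (intro diag_rep_append diag_rep_ones diag_rep_0) auto
    then show ?thesis by simp
  qed
  show thesis
    by (rule that[OF _ all]) (use cbs in \<open>auto simp: L_def\<close>)
qed

subsection \<open>Algebraic integers form a ring\<close>

text \<open>Determinant trick: v is an eigenvector of the coefficient matrix with eigenvalue z, so
  the characteristic polynomial annihilates z. \<open>h\<close> will be \<open>of_int\<close> for
  integrality and \<open>of_rat\<close> for algebraicity.\<close>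

lemma monic_annihilator_of_stable_span:
  fixes h :: "'r::comm_ring_1 \<Rightarrow> 'k::field" and v :: "'i \<Rightarrow> 'k"
  assumes h: "comm_ring_hom h" and fin: "finite I" and nz: "i0 \<in> I" "v i0 \<noteq> 0"
    and stab: "\<And>i. i \<in> I \<Longrightarrow> \<exists>a. z * v i = (\<Sum>j\<in>I. h (a j) * v j)"
  shows "\<exists>p. lead_coeff p = 1 \<and> poly (map_poly h p) z = 0"
proof -
  interpret h: comm_ring_hom h by (fact h)
  define n where "n = card I"
  obtain e where e: "bij_betw e {0..<n} I" using ex_bij_betw_nat_finite[OF fin] n_def by blast
  have "\<forall>i. \<exists>a. i \<in> I \<longrightarrow> z * v i = (\<Sum>j\<in>I. h (a j) * v j)" using stab by blast
  then obtain a where a: "\<And>i. i \<in> I \<Longrightarrow> z * v i = (\<Sum>j\<in>I. h (a i j) * v j)" by metis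
  define A where "A = mat n n (\<lambda>(i, j). a (e i) (e j))"
  define w where "w = vec n (\<lambda>i. v (e i))"
  have A: "A \<in> carrier_mat n n" by (simp add: A_def)
  have hA: "map_mat h A \<in> carrier_mat n n" using A by simp
  have "map_mat h A *\<^sub>v w = z \<cdot>\<^sub>v w"
  proof (rule eq_vecI)
    fix i assume "i < dim_vec (z \<cdot>\<^sub>v w)"
    then have i: "i < n" by (simp add: w_def)
    then have ei: "e i \<in> I" using e by (auto dest: bij_betwE)
    have "vec_index (map_mat h A *\<^sub>v w) i = (\<Sum>j\<in>{0..<n}. h (a (e i) (e j)) * v (e j))"
      using i by (simp add: A_def w_def scalar_prod_def)
    also have "\<dots> = (\<Sum>j\<in>I. h (a (e i) j) * v j)"
      by (rule sum.reindex_bij_betw[OF e])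
    also have "\<dots> = z * v (e i)" using a[OF ei] by simp
    finally show "vec_index (map_mat h A *\<^sub>v w) i = vec_index (z \<cdot>\<^sub>v w) i" using i by (simp add: w_def)
  qed (simp add: A_def w_def)
  moreover have "w \<noteq> 0\<^sub>v n"
  proof
    assume w0: "w = 0\<^sub>v n"
    obtain i where i: "i < n" "e i = i0" using e nz(1) by (metis atLeastLessThan_iff bij_betw_iff_bijections)
    have "vec_index w i = 0" unfolding w0 using i by simp
    then show False using i nz by (simp add: w_def)
  qed
  moreover have "w \<in> carrier_vec n" by (simp add: w_def)
  ultimately have "eigenvector (map_mat h A) w z" using hA by (simp add: eigenvector_def)
  then have "eigenvalue (map_mat h A) z" by (auto simp: eigenvalue_def)
  then have "poly (char_poly (map_mat h A)) z = 0" using eigenvalue_root_char_poly[OF hA] by simp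
  then have "poly (map_poly h (char_poly A)) z = 0" using h.char_poly_hom[OF A] by simp
  then show ?thesis using degree_monic_char_poly[OF A] by (intro exI[of _ "char_poly A"]) simp
qed

lemma algebraic_int_stable:
  fixes v :: "'i \<Rightarrow> 'k::field_char_0"
  assumes "finite I" "i0 \<in> I" "v i0 \<noteq> 0"
    and "\<And>i. i \<in> I \<Longrightarrow> \<exists>a::'i \<Rightarrow> int. z * v i = (\<Sum>j\<in>I. of_int (a j) * v j)"
  shows "algebraic_int z"
proof -
  have "comm_ring_hom (of_int :: int \<Rightarrow> 'k)" by unfold_locales auto
  from monic_annihilator_of_stable_span[OF this assms] show ?thesis
    unfolding algebraic_int_altdef_ipoly by blast
qed

lemma algebraic_int_power_reduce:
  fixes x :: "'k::field_char_0"
  assumes "algebraic_int x"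
  obtains n :: nat and c :: "nat \<Rightarrow> int" where "n > 0" "x ^ n = (\<Sum>i<n. of_int (c i) * x ^ i)"
proof -
  obtain p where p: "poly (map_poly of_int p) x = 0" "lead_coeff p = 1"
    using assms unfolding algebraic_int_altdef_ipoly by blast
  define n where "n = degree p"
  have "n > 0"
  proof (rule ccontr)
    assume "\<not> n > 0"
    then obtain c where "p = [:c:]" unfolding n_def by (metis degree_eq_zeroE neq0_conv)
    then show False using p by (simp add: map_poly_pCons)
  qed
  have "poly (map_poly of_int p) x = (\<Sum>i\<le>n. of_int (coeff p i) * x ^ i)"
    unfolding poly_altdef n_def by (simp add: coeff_map_poly degree_map_poly)
  also have "\<dots> = (\<Sum>i<n. of_int (coeff p i) * x ^ i) + x ^ n"
    using p(2) by (simp add: n_def flip: lessThan_Suc_atMost)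
  finally have "x ^ n = - (\<Sum>i<n. of_int (coeff p i) * x ^ i)" using p(1) by (simp add: eq_neg_iff_add_eq_0 add.commute)
  also have "\<dots> = (\<Sum>i<n. of_int (- coeff p i) * x ^ i)" by (simp add: sum_negf)
  finally show ?thesis by (rule that[OF \<open>n > 0\<close>])
qed

text \<open>The integer span of the products x^i y^j, with i and j below the degrees of the monic
  relations, is stable under x and y, hence under their sum and product.\<close>

lemma algebraic_int_plus_times:
  fixes x y :: "'k::field_char_0"
  assumes x: "algebraic_int x" and y: "algebraic_int y"
  shows "algebraic_int (x + y)" "algebraic_int (x * y)"
proof -
  obtain m c where m: "m > 0" "x ^ m = (\<Sum>i<m. of_int (c i) * x ^ i)"
    by (rule algebraic_int_power_reduce[OF x]) (rule that)
  obtain n d where n: "n > 0" "y ^ n = (\<Sum>i<n. of_int (d i) * y ^ i)"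
    by (rule algebraic_int_power_reduce[OF y]) (rule that)
  define I where "I = {..<m} \<times> {..<n}"
  define v where "v = (\<lambda>(i, j). x ^ i * y ^ j)"
  have fin: "finite I" by (simp add: I_def)
  define stab where "stab z \<longleftrightarrow> (\<forall>i\<in>I. \<exists>a::nat \<times> nat \<Rightarrow> int. z * v i = (\<Sum>j\<in>I. of_int (a j) * v j))" for z
  have single: "\<exists>a::nat \<times> nat \<Rightarrow> int. v i = (\<Sum>j\<in>I. of_int (a j) * v j)" if "i \<in> I" for i
  proof (intro exI[of _ "\<lambda>j. if j = i then 1 else 0"])
    have "(\<Sum>j\<in>I. of_int (if j = i then 1 else 0) * v j) = (\<Sum>j\<in>I. if j = i then v j else 0)"
      by (intro sum.cong) auto
    then show "v i = (\<Sum>j\<in>I. of_int (if j = i then 1 else 0) * v j)" using fin that by simp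
  qed
  have stab_x: "stab x" unfolding stab_def
  proof
    fix i assume "i \<in> I"
    then obtain s t where st: "i = (s, t)" "s < m" "t < n" by (auto simp: I_def)
    show "\<exists>a::nat \<times> nat \<Rightarrow> int. x * v i = (\<Sum>j\<in>I. of_int (a j) * v j)"
    proof (cases "Suc s < m")
      case True
      have "x * v i = v (Suc s, t)" by (simp add: st v_def)
      then show ?thesis using single[of "(Suc s, t)"] True st by (simp add: I_def)
    next
      case False
      then have "m = Suc s" using st by simp
      then have "x * v i = x ^ m * y ^ t" by (simp add: st v_def)
      also have "\<dots> = (\<Sum>i<m. \<Sum>j<n. of_int (c i * (if j = t then 1 else 0)) * (x ^ i * y ^ j))"
      proof -
        have "(\<Sum>j<n. of_int (c i * (if j = t then 1 else 0)) * (x ^ i * y ^ j)) = of_int (c i) * x ^ i * y ^ t" for i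
        proof -
          have "(\<Sum>j<n. of_int (c i * (if j = t then 1 else 0)) * (x ^ i * y ^ j)) = (\<Sum>j<n. if j = t then of_int (c i) * (x ^ i * y ^ j) else 0)"
            by (intro sum.cong) auto
          then show ?thesis using st by simp
        qed
        then show ?thesis unfolding m(2) sum_distrib_right by simp
      qed
      also have "\<dots> = (\<Sum>j\<in>I. of_int (case j of (i, j) \<Rightarrow> c i * (if j = t then 1 else 0)) * v j)"
        unfolding I_def sum.cartesian_product v_def by (intro sum.cong refl) auto
      finally show ?thesis by (rule exI[of _ "\<lambda>j. case j of (i, j) \<Rightarrow> c i * (if j = t then 1 else 0)"])
    qed
  qed
  have stab_y: "stab y" unfolding stab_def
  proof
    fix i assume "i \<in> I"
    then obtain s t where st: "i = (s, t)" "s < m" "t < n" by (auto simp: I_def)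
    show "\<exists>a::nat \<times> nat \<Rightarrow> int. y * v i = (\<Sum>j\<in>I. of_int (a j) * v j)"
    proof (cases "Suc t < n")
      case True
      have "y * v i = v (s, Suc t)" by (simp add: st v_def)
      then show ?thesis using single[of "(s, Suc t)"] True st by (simp add: I_def)
    next
      case False
      then have "n = Suc t" using st by simp
      then have "y * v i = x ^ s * y ^ n" by (simp add: st v_def)
      also have "\<dots> = (\<Sum>i<m. \<Sum>j<n. of_int ((if i = s then 1 else 0) * d j) * (x ^ i * y ^ j))"
      proof -
        have "(\<Sum>i<m. \<Sum>j<n. of_int ((if i = s then 1 else 0) * d j) * (x ^ i * y ^ j))
           = (\<Sum>i<m. if i = s then (\<Sum>j<n. of_int (d j) * (x ^ i * y ^ j)) else 0)"
          by (intro sum.cong) auto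
        then show ?thesis using st unfolding n(2) sum_distrib_left by (simp add: mult_ac)
      qed
      also have "\<dots> = (\<Sum>j\<in>I. of_int (case j of (i, j) \<Rightarrow> (if i = s then 1 else 0) * d j) * v j)"
        unfolding I_def sum.cartesian_product v_def by (intro sum.cong refl) auto
      finally show ?thesis by (rule exI[of _ "\<lambda>j. case j of (i, j) \<Rightarrow> (if i = s then 1 else 0) * d j"])
    qed
  qed
  have "stab (x + y)" unfolding stab_def
  proof
    fix i assume i: "i \<in> I"
    obtain a :: "nat \<times> nat \<Rightarrow> int" where a: "x * v i = (\<Sum>j\<in>I. of_int (a j) * v j)"
      using stab_x i unfolding stab_def by blast
    obtain b :: "nat \<times> nat \<Rightarrow> int" where b: "y * v i = (\<Sum>j\<in>I. of_int (b j) * v j)"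
      using stab_y i unfolding stab_def by blast
    have "(x + y) * v i = (\<Sum>j\<in>I. of_int (a j + b j) * v j)"
      by (simp add: distrib_right a b sum.distrib)
    then show "\<exists>a::nat \<times> nat \<Rightarrow> int. (x + y) * v i = (\<Sum>j\<in>I. of_int (a j) * v j)"
      by (rule exI[of _ "\<lambda>j. a j + b j"])
  qed
  moreover have "stab (x * y)" unfolding stab_def
  proof
    fix i assume i: "i \<in> I"
    have "\<forall>i. \<exists>a::nat \<times> nat \<Rightarrow> int. i \<in> I \<longrightarrow> x * v i = (\<Sum>j\<in>I. of_int (a j) * v j)"
      using stab_x unfolding stab_def by blast
    then obtain a :: "nat \<times> nat \<Rightarrow> nat \<times> nat \<Rightarrow> int"
      where a: "\<And>i. i \<in> I \<Longrightarrow> x * v i = (\<Sum>j\<in>I. of_int (a i j) * v j)" by metis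
    obtain b :: "nat \<times> nat \<Rightarrow> int" where b: "y * v i = (\<Sum>j\<in>I. of_int (b j) * v j)"
      using stab_y i unfolding stab_def by blast
    have "x * y * v i = (\<Sum>l\<in>I. of_int (b l) * (x * v l))"
      by (simp add: mult.assoc b sum_distrib_left mult.left_commute)
    also have "\<dots> = (\<Sum>l\<in>I. \<Sum>j\<in>I. of_int (b l * a l j) * v j)"
      by (intro sum.cong refl) (simp add: a sum_distrib_left mult.assoc)
    also have "\<dots> = (\<Sum>j\<in>I. of_int (\<Sum>l\<in>I. b l * a l j) * v j)"
      by (subst sum.swap) (simp add: sum_distrib_right)
    finally show "\<exists>a::nat \<times> nat \<Rightarrow> int. (x * y) * v i = (\<Sum>j\<in>I. of_int (a j) * v j)"
      by (rule exI[of _ "\<lambda>j. \<Sum>l\<in>I. b l * a l j"])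
  qed
  moreover have "(0, 0) \<in> I" "v (0, 0) \<noteq> 0" using m n by (auto simp: I_def v_def)
  ultimately show "algebraic_int (x + y)" "algebraic_int (x * y)"
    using algebraic_int_stable[OF fin, of "(0, 0)" v] unfolding stab_def by blast+
qed

lemma ring_of_integers_closed:
  fixes x y :: "'k::field_char_0"
  shows "x \<in> ring_of_integers \<Longrightarrow> y \<in> ring_of_integers \<Longrightarrow> x + y \<in> ring_of_integers"
    and "x \<in> ring_of_integers \<Longrightarrow> y \<in> ring_of_integers \<Longrightarrow> x * y \<in> ring_of_integers"
    and "x \<in> ring_of_integers \<Longrightarrow> - x \<in> ring_of_integers"
    and "x \<in> ring_of_integers \<Longrightarrow> y \<in> ring_of_integers \<Longrightarrow> x - y \<in> ring_of_integers"
    and "of_int k \<in> (ring_of_integers :: 'k set)"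
    and "x \<in> ring_of_integers \<Longrightarrow> x ^ n \<in> ring_of_integers"
proof -
  show add: "x \<in> ring_of_integers \<Longrightarrow> y \<in> ring_of_integers \<Longrightarrow> x + y \<in> ring_of_integers" for x y :: 'k
    by (simp add: ring_of_integers_def algebraic_int_plus_times)
  show mult: "x \<in> ring_of_integers \<Longrightarrow> y \<in> ring_of_integers \<Longrightarrow> x * y \<in> ring_of_integers" for x y :: 'k
    by (simp add: ring_of_integers_def algebraic_int_plus_times)
  show minus: "x \<in> ring_of_integers \<Longrightarrow> - x \<in> ring_of_integers" for x :: 'k
    by (simp add: ring_of_integers_def)
  show "x \<in> ring_of_integers \<Longrightarrow> y \<in> ring_of_integers \<Longrightarrow> x - y \<in> ring_of_integers"
    using add[of x "- y"] minus[of y] by simp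
  show int: "of_int k \<in> (ring_of_integers :: 'k set)" for k
    by (simp add: ring_of_integers_def int_imp_algebraic_int)
  show "x \<in> ring_of_integers \<Longrightarrow> x ^ n \<in> ring_of_integers"
    using int[of 1] mult by (induction n) auto
qed

subsection \<open>Rational polynomials evaluated in a field\<close>

definition ratp :: "rat poly \<Rightarrow> 'a::field_char_0 \<Rightarrow> 'a" where
  "ratp p x = poly (map_poly of_rat p) x"

lemma ratp_0 [simp]: "ratp 0 x = 0" and ratp_1 [simp]: "ratp 1 x = 1"
  and ratp_pCons: "ratp (pCons a p) x = of_rat a + x * ratp p x"
  by (simp_all add: ratp_def) (cases "a = 0 \<and> p = 0", auto simp: map_poly_pCons)

lemma ratp_add: "ratp (p + q) x = ratp p x + ratp q x"
  by (induction p q rule: poly_induct2) (simp_all add: ratp_pCons of_rat_add algebra_simps)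

lemma ratp_smult: "ratp (smult c p) x = of_rat c * ratp p x"
  by (induction p) (simp_all add: ratp_pCons of_rat_mult algebra_simps)

lemma ratp_minus: "ratp (- p) x = - ratp p x"
  using ratp_smult[of "-1" p x] by simp

lemma ratp_diff: "ratp (p - q) x = ratp p x - ratp q x"
  using ratp_add[of p "- q" x] by (simp add: ratp_minus)

lemma ratp_mult: "ratp (p * q) x = ratp p x * ratp q x"
  by (induction p) (simp_all add: ratp_pCons ratp_add ratp_smult algebra_simps)

lemma ratp_pcompose: "ratp (pcompose p q) x = ratp p (ratp q x)"
  by (induction p) (simp_all add: pcompose_pCons ratp_pCons ratp_add ratp_mult)

lemma ratp_altdef: "ratp p x = (\<Sum>i\<le>degree p. of_rat (coeff p i) * x ^ i)"
  by (simp add: ratp_def poly_altdef degree_map_poly coeff_map_poly)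

lemma finite_ratp_roots: "p \<noteq> 0 \<Longrightarrow> finite {x. ratp p x = 0}"
  unfolding ratp_def by (rule poly_roots_finite) (simp add: map_poly_eq_0_iff)

lemma pderiv_map_poly_of_rat: "pderiv (map_poly of_rat p) = (map_poly of_rat (pderiv p) :: 'a::field_char_0 poly)"
  by (rule poly_eqI) (simp add: coeff_pderiv coeff_map_poly of_rat_mult of_rat_add)

lemma field_embeddingD:
  assumes "field_embedding \<sigma>"
  shows "\<sigma> 1 = 1" "\<sigma> (x + y) = \<sigma> x + \<sigma> y" "\<sigma> (x * y) = \<sigma> x * \<sigma> y"
  using assms by (auto simp: field_embedding_def)

lemma field_embedding_simps:
  fixes \<sigma> :: "'k::field_char_0 \<Rightarrow> 'l::field_char_0"
  assumes "field_embedding \<sigma>"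
  shows "\<sigma> 0 = 0" "\<sigma> (- x) = - \<sigma> x" "\<sigma> (x - y) = \<sigma> x - \<sigma> y" "\<sigma> (x ^ n) = \<sigma> x ^ n"
    "\<sigma> (of_nat n) = of_nat n" "\<sigma> (of_int i) = of_int i" "\<sigma> (inverse x) = inverse (\<sigma> x)"
    "\<sigma> (x / y) = \<sigma> x / \<sigma> y" "\<sigma> (of_rat q) = of_rat q" "\<sigma> x = 0 \<longleftrightarrow> x = 0"
proof -
  note d = field_embeddingD[OF assms]
  have "\<sigma> 0 + \<sigma> 0 = \<sigma> 0 + 0" using d(2)[of 0 0] by simp
  then show z: "\<sigma> 0 = 0" by (rule add_left_imp_eq)
  show m: "\<sigma> (- x) = - \<sigma> x" for x using d(2)[of x "- x"] z by (simp add: add_eq_0_iff)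
  show "\<sigma> (x - y) = \<sigma> x - \<sigma> y" using d(2)[of x "- y"] m by simp
  show "\<sigma> (x ^ n) = \<sigma> x ^ n" by (induction n) (simp_all add: d)
  show n: "\<sigma> (of_nat n) = of_nat n" for n by (induction n) (simp_all add: d z)
  show i: "\<sigma> (of_int i) = of_int i" for i by (cases i rule: int_cases2) (simp_all add: n m)
  have inv: "\<sigma> x * \<sigma> (inverse x) = 1" if "x \<noteq> 0" for x using d(3)[of x "inverse x"] d(1) that by simp
  show nz: "\<sigma> x = 0 \<longleftrightarrow> x = 0" for x using inv[of x] z by (cases "x = 0") auto
  show v: "\<sigma> (inverse x) = inverse (\<sigma> x)" for x
    using inv[of x] z by (cases "x = 0") (simp_all add: inverse_unique)
  show q: "\<sigma> (x / y) = \<sigma> x / \<sigma> y" for x y by (simp add: divide_inverse d v)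
  show "\<sigma> (of_rat q) = of_rat q" by (cases q) (simp add: of_rat_rat q i)
qed

lemma field_embedding_sum:
  fixes \<sigma> :: "'k::field_char_0 \<Rightarrow> 'l::field_char_0"
  shows "field_embedding \<sigma> \<Longrightarrow> \<sigma> (sum f A) = (\<Sum>a\<in>A. \<sigma> (f a))"
  by (induction A rule: infinite_finite_induct) (simp_all add: field_embedding_simps field_embeddingD)

lemma field_embedding_ratp:
  fixes \<sigma> :: "'k::field_char_0 \<Rightarrow> 'l::field_char_0"
  shows "field_embedding \<sigma> \<Longrightarrow> \<sigma> (ratp p x) = ratp p (\<sigma> x)"
  by (induction p) (simp_all add: ratp_pCons field_embedding_simps field_embeddingD)

lemma field_embedding_algebraic_int_iff:
  fixes \<sigma> :: "'k::field_char_0 \<Rightarrow> 'l::field_char_0"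
  assumes "field_embedding \<sigma>"
  shows "algebraic_int (\<sigma> x) \<longleftrightarrow> algebraic_int x"
proof -
  have "poly (map_poly of_int p) (\<sigma> x) = \<sigma> (poly (map_poly of_int p) x)" for p :: "int poly"
    by (induction p) (simp_all add: map_poly_pCons field_embedding_simps[OF assms] field_embeddingD[OF assms])
  then show ?thesis unfolding algebraic_int_altdef_ipoly by (simp add: field_embedding_simps(10)[OF assms])
qed

subsection \<open>The primitive element\<close>

text \<open>Multiplication by x preserves the finite-dimensional space K, so the determinant trick
  applies with rational coefficients.\<close>

lemma number_field_algebraic:
  fixes x :: "'k::field_char_0"
  assumes "number_field TYPE('k)"
  shows "\<exists>p. p \<noteq> 0 \<and> ratp p x = 0"
proof -
  interpret vs: vector_space "\<lambda>(q::rat) (x::'k). of_rat q * x" by (rule vector_space_of_rat)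
  obtain B :: "'k set" where B: "finite B" "vs.span B = UNIV"
    using assms unfolding number_field_def by blast
  have sp: "\<exists>u. y = (\<Sum>v\<in>B. of_rat (u v) * v)" for y :: 'k
  proof -
    have "y \<in> range (\<lambda>u. \<Sum>v\<in>B. of_rat (u v) * v)"
      unfolding vs.span_finite[OF B(1), symmetric] B(2) by (rule UNIV_I)
    then show ?thesis by (rule imageE) (rule exI)
  qed
  have "\<exists>b\<in>B. b \<noteq> 0"
  proof (rule ccontr)
    assume "\<not> (\<exists>b\<in>B. b \<noteq> 0)"
    then have "(\<Sum>v\<in>B. of_rat (u v) * v) = 0" for u :: "'k \<Rightarrow> rat" by (intro sum.neutral) auto
    then show False using sp[of 1] by simp
  qed
  then obtain b where b: "b \<in> B" "b \<noteq> 0" by blast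
  have "comm_ring_hom (of_rat :: rat \<Rightarrow> 'k)" by unfold_locales (auto simp: of_rat_add of_rat_mult)
  then have "\<exists>p :: rat poly. lead_coeff p = 1 \<and> poly (map_poly of_rat p) x = 0"
    by (rule monic_annihilator_of_stable_span[OF _ B(1) b(1), of _ "\<lambda>v. v"]) (rule b(2), rule sp)
  then obtain p :: "rat poly" where "lead_coeff p = 1" "poly (map_poly of_rat p) x = 0" by (elim exE conjE)
  then show ?thesis by (intro exI[of _ p]) (auto simp: ratp_def)
qed

lemma minimal_polynomial:
  fixes x :: "'k::field_char_0"
  assumes "p \<noteq> 0" "ratp p x = 0"
  obtains f where "f \<noteq> 0" "ratp f x = 0" "\<And>g. ratp g x = 0 \<Longrightarrow> f dvd g" "degree f > 0"
proof -
  define P where "P f \<longleftrightarrow> f \<noteq> 0 \<and> ratp f x = 0" for f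
  have Pp: "P p" using assms by (simp add: P_def)
  define f where "f = arg_min degree P"
  have f: "P f" unfolding f_def by (rule arg_min_natI[where P = P and k = p]) (rule Pp)
  have min: "degree f \<le> degree g" if "P g" for g unfolding f_def using that by (rule arg_min_nat_le[where P = P])
  have dv: "f dvd g" if g: "ratp g x = 0" for g
  proof -
    have "ratp (g mod f) x = ratp g x - ratp (g div f) x * ratp f x"
      by (simp add: ratp_diff ratp_mult flip: minus_div_mult_eq_mod)
    then have "ratp (g mod f) x = 0" using g f by (simp add: P_def)
    then have "g mod f = 0" using min[of "g mod f"] degree_mod_less'[of f g] f by (auto simp: P_def)
    then show ?thesis by (simp add: mod_eq_0_iff_dvd)
  qed
  have "degree f > 0"
  proof (rule ccontr)
    assume "\<not> degree f > 0"
    then obtain c where "f = [:c:]" by (metis degree_eq_zeroE neq0_conv)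
    then show False using f by (simp add: P_def ratp_pCons)
  qed
  then show ?thesis using f unfolding P_def by (intro that[of f] dv) auto
qed

definition rat_adjoin :: "'k::field_char_0 \<Rightarrow> 'k set" where
  "rat_adjoin \<theta> = range (\<lambda>p. ratp p \<theta>)"

lemma rat_adjoin_closed:
  shows "of_rat q \<in> rat_adjoin \<theta>" "\<theta> \<in> rat_adjoin \<theta>"
    "x \<in> rat_adjoin \<theta> \<Longrightarrow> y \<in> rat_adjoin \<theta> \<Longrightarrow> x + y \<in> rat_adjoin \<theta>"
    "x \<in> rat_adjoin \<theta> \<Longrightarrow> y \<in> rat_adjoin \<theta> \<Longrightarrow> x - y \<in> rat_adjoin \<theta>"
    "x \<in> rat_adjoin \<theta> \<Longrightarrow> y \<in> rat_adjoin \<theta> \<Longrightarrow> x * y \<in> rat_adjoin \<theta>"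
    "x \<in> rat_adjoin \<theta> \<Longrightarrow> ratp p x \<in> rat_adjoin \<theta>"
proof -
  show "of_rat q \<in> rat_adjoin \<theta>" unfolding rat_adjoin_def by (rule range_eqI[of _ _ "[:q:]"]) (simp add: ratp_pCons)
  show "\<theta> \<in> rat_adjoin \<theta>" unfolding rat_adjoin_def by (rule range_eqI[of _ _ "[:0, 1:]"]) (simp add: ratp_pCons)
qed (auto simp: rat_adjoin_def ratp_add[symmetric] ratp_diff[symmetric] ratp_mult[symmetric] ratp_pcompose[symmetric])

text \<open>By minimality the constant term a of the minimal polynomial a + X g is nonzero, so 1/x =
  - g(x)/a.\<close>

lemma rat_adjoin_inverse:
  fixes x :: "'k::field_char_0"
  assumes nf: "number_field TYPE('k)" and x: "x \<in> rat_adjoin \<theta>"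
  shows "inverse x \<in> rat_adjoin \<theta>"
proof (cases "x = 0")
  case True
  then show ?thesis using x by simp
next
  case False
  obtain p where "p \<noteq> 0" "ratp p x = 0" using number_field_algebraic[OF nf] by blast
  then obtain f where f: "f \<noteq> 0" "ratp f x = 0" "\<And>g. ratp g x = 0 \<Longrightarrow> f dvd g" "degree f > 0"
    by (rule minimal_polynomial) (rule that)
  obtain a g where fg: "f = pCons a g" by (cases f)
  have eq: "of_rat a + x * ratp g x = 0" using f(2) by (simp add: fg ratp_pCons)
  have "a \<noteq> 0"
  proof
    assume "a = 0"
    then have "ratp g x = 0" using eq False by simp
    then have "f dvd g" by (rule f(3))
    moreover have "g \<noteq> 0" using f(1) fg \<open>a = 0\<close> by auto
    ultimately have "degree f \<le> degree g" by (rule dvd_imp_degree_le)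
    then show False using fg \<open>g \<noteq> 0\<close> by simp
  qed
  then have "inverse x = of_rat (- 1 / a) * ratp g x"
    using eq False by (simp add: of_rat_divide of_rat_minus field_simps add_eq_0_iff)
  then show ?thesis using x by (simp add: rat_adjoin_closed)
qed

text \<open>A monic divisor never requires a division of coefficients, so closure under subtraction
  and multiplication keeps the remainder over \<open>F\<close>. In the application \<open>F\<close>
  is the field generated by the candidate \<theta>.\<close>

lemma monic_division:
  fixes h p :: "'k::field poly"
  assumes F: "0 \<in> F" "\<And>x y. x \<in> F \<Longrightarrow> y \<in> F \<Longrightarrow> x - y \<in> F" "\<And>x y. x \<in> F \<Longrightarrow> y \<in> F \<Longrightarrow> x * y \<in> F"
    and h: "\<And>i. coeff h i \<in> F" "lead_coeff h = 1"
    and p: "\<And>i. coeff p i \<in> F"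
  shows "\<exists>q r. p = q * h + r \<and> (\<forall>i. coeff r i \<in> F) \<and> (r = 0 \<or> degree r < degree h)"
  using p
proof (induction "degree p" arbitrary: p rule: less_induct)
  case less
  show ?case
  proof (cases "p = 0 \<or> degree p < degree h")
    case True
    then show ?thesis using less.prems by (intro exI[of _ 0] exI[of _ p]) auto
  next
    case False
    define m where "m = monom (lead_coeff p) (degree p - degree h)"
    define p' where "p' = p - m * h"
    have h0: "h \<noteq> 0" using h(2) by auto
    have m0: "m \<noteq> 0" using False by (simp add: m_def)
    have dm: "degree (m * h) = degree p"
      using False h0 m0 by (simp add: degree_mult_eq) (simp add: m_def degree_monom_eq)
    have "lead_coeff m = lead_coeff p" unfolding m_def by (rule lead_coeff_monom)
    then have "lead_coeff (m * h) = lead_coeff p" unfolding lead_coeff_mult h(2) by simp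
    then have "coeff p' (degree p) = 0" using dm by (simp add: p'_def)
    moreover have "degree p' \<le> degree p" unfolding p'_def by (rule degree_diff_le) (simp_all add: dm)
    ultimately have deg: "p' = 0 \<or> degree p' < degree p" using eq_zero_or_degree_less by blast
    have cp': "coeff p' i \<in> F" for i
    proof -
      have "coeff (m * h) i = (if degree p - degree h \<le> i then lead_coeff p * coeff h (i - (degree p - degree h)) else 0)"
        by (simp add: m_def coeff_monom_mult)
      then have "coeff (m * h) i \<in> F" using F h less.prems by simp
      then show ?thesis using F(2) less.prems by (simp add: p'_def)
    qed
    show ?thesis
    proof (cases "p' = 0")
      case True
      then show ?thesis using F(1) by (intro exI[of _ m] exI[of _ 0]) (simp add: p'_def)
    next
      case p'0: False
      then obtain q r where qr: "p' = q * h + r" "\<forall>i. coeff r i \<in> F" "r = 0 \<or> degree r < degree h"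
        using less.hyps[of p'] deg cp' by blast
      have "p = (q + m) * h + r" using qr(1) by (simp add: p'_def algebra_simps)
      then show ?thesis using qr by blast
    qed
  qed
qed

definition hpoly :: "('k::field_char_0 \<Rightarrow> 'l::field_char_0) \<Rightarrow> 'k poly \<Rightarrow> 'l \<Rightarrow> 'l" where
  "hpoly \<sigma> p x = poly (map_poly \<sigma> p) x"

lemma hpoly_simps:
  assumes \<sigma>: "field_embedding \<sigma>"
  shows "hpoly \<sigma> 0 x = 0" "hpoly \<sigma> (pCons a p) x = \<sigma> a + x * hpoly \<sigma> p x"
    "hpoly \<sigma> (p + q) x = hpoly \<sigma> p x + hpoly \<sigma> q x"
    "hpoly \<sigma> (smult a p) x = \<sigma> a * hpoly \<sigma> p x"
    "hpoly \<sigma> (p * q) x = hpoly \<sigma> p x * hpoly \<sigma> q x"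
    "hpoly \<sigma> (pcompose p q) x = hpoly \<sigma> p (hpoly \<sigma> q x)"
    "hpoly \<sigma> (map_poly of_rat r) x = ratp r x"
    "hpoly \<sigma> p (\<sigma> y) = \<sigma> (poly p y)"
proof -
  note simps = field_embedding_simps[OF \<sigma>] field_embeddingD[OF \<sigma>]
  show z: "hpoly \<sigma> 0 x = 0" for x by (simp add: hpoly_def)
  show c: "hpoly \<sigma> (pCons a p) x = \<sigma> a + x * hpoly \<sigma> p x" for a p x
    unfolding hpoly_def by (cases "a = 0 \<and> p = 0") (auto simp: map_poly_pCons simps)
  show add: "hpoly \<sigma> (p + q) x = hpoly \<sigma> p x + hpoly \<sigma> q x" for p q x
    by (induction p q rule: poly_induct2) (simp_all add: z c simps algebra_simps)
  show sm: "hpoly \<sigma> (smult a p) x = \<sigma> a * hpoly \<sigma> p x" for a p x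
    by (induction p) (simp_all add: z c simps algebra_simps)
  show mult: "hpoly \<sigma> (p * q) x = hpoly \<sigma> p x * hpoly \<sigma> q x" for p q x
    by (induction p) (simp_all add: z c add sm simps algebra_simps)
  show "hpoly \<sigma> (pcompose p q) x = hpoly \<sigma> p (hpoly \<sigma> q x)"
    by (induction p) (simp_all add: z c add mult pcompose_pCons simps)
  show "hpoly \<sigma> (map_poly of_rat r) x = ratp r x"
    by (induction r) (simp_all add: z c map_poly_pCons ratp_pCons simps)
  show "hpoly \<sigma> p (\<sigma> y) = \<sigma> (poly p y)"
    by (induction p) (simp_all add: z c simps)
qed

text \<open>For \<open>\<theta> = a + c b\<close> with \<open>c\<close> outside a finite set, \<open>b\<close> is the only common root of its minimal polynomial and of
  \<open>f (\<theta> - c x)\<close> in the algebraic closure.\<close>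

lemma primitive_element_step:
  fixes a b :: "'k::field_char_0"
  assumes nf: "number_field TYPE('k)"
  shows "\<exists>\<theta>. a \<in> rat_adjoin \<theta> \<and> b \<in> rat_adjoin \<theta>"
proof -
  let ?h = "to_ac :: 'k \<Rightarrow> 'k alg_closure"
  have emb: "field_embedding ?h" by (simp add: field_embedding_def)
  note H = hpoly_simps[OF emb] and E = field_embedding_simps[OF emb] field_embeddingD[OF emb]
  obtain f where f: "f \<noteq> 0" "ratp f a = 0" using number_field_algebraic[OF nf] by blast
  obtain g0 where "g0 \<noteq> 0" "ratp g0 b = 0" using number_field_algebraic[OF nf] by blast
  then obtain g where g: "g \<noteq> 0" "ratp g b = 0" "\<And>g'. ratp g' b = 0 \<Longrightarrow> g dvd g'" "degree g > 0"
    by (rule minimal_polynomial) (rule that)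
  have g': "ratp (pderiv g) b \<noteq> 0"
  proof
    assume "ratp (pderiv g) b = 0"
    then have "g dvd pderiv g" by (rule g(3))
    moreover have "pderiv g \<noteq> 0" using g(4) by (simp add: pderiv_eq_0_iff)
    ultimately have "degree g \<le> degree (pderiv g)" by (rule dvd_imp_degree_le)
    then show False using g(4) by (simp add: degree_pderiv)
  qed
  define Rf where "Rf = {\<alpha> :: 'k alg_closure. ratp f \<alpha> = 0}"
  define Rg where "Rg = {\<beta> :: 'k alg_closure. ratp g \<beta> = 0}"
  have fin: "finite Rf" "finite Rg" unfolding Rf_def Rg_def by (intro finite_ratp_roots f g)+
  \<comment> \<open>The c for which \<theta> - c \<beta> is a root of f for some root \<beta> of g
    other than b.\<close>
  define bad where "bad = {c :: rat. \<exists>\<alpha>\<in>Rf. \<exists>\<beta>\<in>Rg. \<beta> \<noteq> ?h b \<and> \<alpha> = ?h a + of_rat c * (?h b - \<beta>)}"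
  have "of_rat ` bad \<subseteq> (\<lambda>(\<alpha>, \<beta>). (\<alpha> - ?h a) / (?h b - \<beta>)) ` (Rf \<times> Rg)"
  proof
    fix y :: "'k alg_closure" assume "y \<in> of_rat ` bad"
    then obtain c \<alpha> \<beta> where c: "y = of_rat c" "\<alpha> \<in> Rf" "\<beta> \<in> Rg" "\<beta> \<noteq> ?h b" "\<alpha> = ?h a + of_rat c * (?h b - \<beta>)"
      by (auto simp: bad_def)
    then have "y = (\<alpha> - ?h a) / (?h b - \<beta>)" by simp
    then show "y \<in> (\<lambda>(\<alpha>, \<beta>). (\<alpha> - ?h a) / (?h b - \<beta>)) ` (Rf \<times> Rg)" using c by force
  qed
  then have "finite (of_rat ` bad :: 'k alg_closure set)" by (rule finite_subset) (intro finite_imageI finite_cartesian_product fin)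
  then have "finite bad" by (rule finite_imageD) (auto simp: inj_on_def)
  then obtain c where c: "c \<notin> bad" using ex_new_if_finite[OF infinite_UNIV_char_0] by blast
  define \<theta> where "\<theta> = a + of_rat c * b"
  define F where "F = rat_adjoin \<theta>"
  have F: "0 \<in> F" "\<And>x y. x \<in> F \<Longrightarrow> y \<in> F \<Longrightarrow> x - y \<in> F" "\<And>x y. x \<in> F \<Longrightarrow> y \<in> F \<Longrightarrow> x * y \<in> F"
    "\<And>x y. x \<in> F \<Longrightarrow> y \<in> F \<Longrightarrow> x + y \<in> F" "\<And>q. of_rat q \<in> F" "\<theta> \<in> F" "\<And>x. x \<in> F \<Longrightarrow> inverse x \<in> F"
    using rat_adjoin_closed rat_adjoin_closed(1)[of 0] rat_adjoin_inverse[OF nf] by (auto simp: F_def)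
  define P where "P h \<longleftrightarrow> h \<noteq> 0 \<and> (\<forall>i. coeff h i \<in> F) \<and> poly h b = 0" for h :: "'k poly"
  define gK where "gK = (map_poly of_rat g :: 'k poly)"
  have PgK: "P gK" using g F by (simp add: P_def gK_def coeff_map_poly map_poly_eq_0_iff ratp_def)
  \<comment> \<open>After normalisation this is the minimal polynomial of b over F. The aim is to
    show that it is X - b, which puts b into F.\<close>
  define h0 where "h0 = arg_min degree P"
  have h0: "P h0" unfolding h0_def by (rule arg_min_natI[where P = P and k = gK]) (rule PgK)
  have min: "degree h0 \<le> degree h" if "P h" for h unfolding h0_def using that by (rule arg_min_nat_le[where P = P])
  define h where "h = smult (inverse (lead_coeff h0)) h0"
  have hP: "P h" and hdeg: "degree h = degree h0" and hmon: "lead_coeff h = 1"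
    using h0 F by (auto simp: P_def h_def)
  have dvd: "h dvd p" if p: "\<And>i. coeff p i \<in> F" "poly p b = 0" for p
  proof -
    obtain q r where qr: "p = q * h + r" "\<forall>i. coeff r i \<in> F" "r = 0 \<or> degree r < degree h"
      using monic_division[of F h p] F hP hmon p(1) by (auto simp: P_def)
    have "poly r b = 0" using p(2) hP unfolding qr(1) by (simp add: P_def)
    have "r = 0"
    proof (rule ccontr)
      assume "r \<noteq> 0"
      then have "P r" using qr \<open>poly r b = 0\<close> by (simp add: P_def)
      from min[OF this] show False using qr \<open>r \<noteq> 0\<close> hdeg by simp
    qed
    then show ?thesis using qr(1) by simp
  qed
  have "h dvd gK" using dvd PgK by (simp add: P_def)
  then obtain s1 where s1: "gK = h * s1" by (rule dvdE)
  define fc where "fc = pcompose (map_poly of_rat f) [:\<theta>, - of_rat c:]"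
  have cF: "coeff (pcompose p [:\<theta>, - of_rat c:]) i \<in> F" if "\<And>i. coeff p i \<in> F" for p :: "'k poly" and i
    using that
  proof (induction p arbitrary: i)
    case 0
    then show ?case using F by simp
  next
    case (pCons u p)
    have u: "u \<in> F" using pCons.prems[of 0] by simp
    have "coeff p i \<in> F" for i using pCons.prems[of "Suc i"] by simp
    then have IH: "coeff (pcompose p [:\<theta>, - of_rat c:]) i \<in> F" for i using pCons.IH by blast
    have mc: "- of_rat c \<in> F" using F(2)[OF F(1) F(5)[of c]] by simp
    have "coeff ([:\<theta>, - of_rat c:] * pcompose p [:\<theta>, - of_rat c:]) i \<in> F"
    proof -
      have sumF: "(\<Sum>k\<le>n. f k) \<in> F" if "\<And>k. f k \<in> F" for f and n :: nat
        by (induction n) (use that F in auto)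
      have linF: "coeff [:\<theta>, - of_rat c:] k \<in> F" for k
        using F mc by (auto simp: coeff_pCons split: nat.split)
      show ?thesis unfolding coeff_mult by (rule sumF) (intro F(3) linF IH)
    qed
    moreover have "coeff [:u:] i \<in> F" using u F(1) by (cases i) auto
    ultimately show ?case using F(4) by (simp add: pcompose_pCons del: mult_pCons_left)
  qed
  have "h dvd fc"
  proof (rule dvd)
    show "coeff fc i \<in> F" for i unfolding fc_def by (rule cF) (simp add: coeff_map_poly F)
    show "poly fc b = 0" using f(2) by (simp add: fc_def poly_pcompose \<theta>_def ratp_def mult.commute)
  qed
  then obtain s2 where s2: "fc = h * s2" by (rule dvdE)
  have "[:-b, 1:] dvd h" using hP by (simp add: P_def poly_eq_0_iff_dvd)
  then obtain q where q: "h = [:-b, 1:] * q" by (rule dvdE)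
  have q0: "q \<noteq> 0" using hP q by (auto simp: P_def)
  have "degree h = 1 + degree q" unfolding q by (subst degree_mult_eq) (use q0 in auto)
  have "degree q = 0"
  proof (rule ccontr)
    \<comment> \<open>A root \<xi> of q is also a root of g and of f(\<theta> - c x). If it equals
      b, then b is a double root of g, against separability; otherwise c is bad.\<close>
    assume dq: "degree q \<noteq> 0"
    have "degree (map_poly ?h q) = degree q" by (rule degree_map_poly) (simp add: E)
    then have "degree (map_poly ?h q) > 0" using dq by simp
    then obtain \<xi> where "poly (map_poly ?h q) \<xi> = 0" using alg_closed_imp_poly_has_root by blast
    then have \<xi>: "hpoly ?h q \<xi> = 0" by (simp add: hpoly_def)
    then have hx: "hpoly ?h h \<xi> = 0" unfolding q H by simp
    show False
    proof (cases "\<xi> = ?h b")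
      case True
      then have "poly q b = 0" using \<xi> H(8)[of q b] by simp
      then have "poly (pderiv gK) b = 0"
        unfolding s1 q by (simp add: pderiv_mult pderiv_pCons pderiv_diff pderiv_smult)
      then show False using g' by (simp add: gK_def pderiv_map_poly_of_rat ratp_def)
    next
      case False
      have "ratp g \<xi> = 0" using H(5)[of h s1 \<xi>] hx H(7)[of g \<xi>] by (simp add: s1[symmetric] gK_def)
      moreover have "ratp f (hpoly ?h [:\<theta>, - of_rat c:] \<xi>) = 0"
        using H(5)[of h s2 \<xi>] hx H(7)[of f] by (simp add: s2[symmetric] fc_def H)
      moreover have "hpoly ?h [:\<theta>, - of_rat c:] \<xi> = ?h a + of_rat c * (?h b - \<xi>)"
        by (simp add: H E \<theta>_def algebra_simps)
      ultimately have "c \<in> bad" using False by (auto simp: bad_def Rf_def Rg_def)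
      then show False using c by simp
    qed
  qed
  then obtain k where "q = [:k:]" by (metis degree_eq_zeroE)
  then have "h = [:- b * k, k:]" using q by simp
  moreover have "k = 1" using hmon calculation q0 \<open>q = [:k:]\<close> by simp
  ultimately have "- b \<in> F" using hP by (auto simp: P_def dest: spec[of _ 0])
  then have b: "b \<in> F" using F(2)[OF F(1), of "- b"] by simp
  have "a = \<theta> - of_rat c * b" by (simp add: \<theta>_def)
  then have "a \<in> F" using F b by simp
  then show ?thesis using b unfolding F_def by blast
qed

theorem primitive_element:
  assumes nf: "number_field TYPE('k::field_char_0)"
  obtains \<theta> :: "'k::field_char_0" where "rat_adjoin \<theta> = UNIV"
proof -
  interpret vs: vector_space "\<lambda>(q::rat) (x::'k). of_rat q * x" by (rule vector_space_of_rat)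
  obtain B :: "'k set" where B: "finite B" "vs.span B = UNIV"
    using nf unfolding number_field_def by blast
  have "\<exists>\<theta>. B \<subseteq> rat_adjoin \<theta>" using B(1)
  proof (induction B)
    case (insert b B)
    then obtain \<theta> where \<theta>: "B \<subseteq> rat_adjoin \<theta>" by blast
    obtain \<theta>' where \<theta>': "\<theta> \<in> rat_adjoin \<theta>'" "b \<in> rat_adjoin \<theta>'" using primitive_element_step[OF nf] by blast
    have "rat_adjoin \<theta> \<subseteq> rat_adjoin \<theta>'" using rat_adjoin_closed(6)[OF \<theta>'(1)] by (auto simp: rat_adjoin_def[of \<theta>])
    then show ?case using \<theta> \<theta>' by blast
  qed simp
  then obtain \<theta> where \<theta>: "B \<subseteq> rat_adjoin \<theta>" by blast
  have "vs.subspace (rat_adjoin \<theta>)"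
    by (rule vs.subspaceI) (use rat_adjoin_closed(1)[of 0 \<theta>] in \<open>auto intro: rat_adjoin_closed\<close>)
  then have "vs.span B \<subseteq> rat_adjoin \<theta>" by (rule vs.span_minimal[OF \<theta>])
  then show ?thesis using that[of \<theta>] B(2) by blast
qed

subsection \<open>Real embeddings and the norm\<close>

definition real_embeddings :: "('k::field_char_0 \<Rightarrow> real) set" where
  "real_embeddings = {\<sigma>. field_embedding \<sigma>}"

lemma field_embedding_of_real: "field_embedding (of_real :: real \<Rightarrow> complex)"
  by (simp add: field_embedding_def)

lemma ratp_of_real: "ratp p (complex_of_real x) = complex_of_real (ratp p x)"
  using field_embedding_ratp[OF field_embedding_of_real] by metis

locale primitive_generator =
  fixes \<theta> :: "'k::field_char_0" and f :: "rat poly"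
  assumes gen: "rat_adjoin \<theta> = UNIV"
    and f0: "f \<noteq> 0" and f\<theta>: "ratp f \<theta> = 0"
    and fmin: "\<And>g. ratp g \<theta> = 0 \<Longrightarrow> f dvd g" and fdeg: "degree f > 0"
begin

definition repr :: "'k \<Rightarrow> rat poly" where
  "repr y = (SOME p. ratp p \<theta> = y)"

lemma ratp_repr [simp]: "ratp (repr y) \<theta> = y"
proof -
  have "y \<in> rat_adjoin \<theta>" using gen by simp
  then have "\<exists>p. ratp p \<theta> = y" by (auto simp: rat_adjoin_def)
  then show ?thesis unfolding repr_def by (rule someI_ex)
qed

text \<open>Polynomials that agree at \<theta> differ by a multiple of f. Hence the choice made in
  \<open>repr\<close> does not matter, and \<theta> can be sent to any root of f.\<close>

lemma ratp_eq_at_root: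
  assumes "ratp f r = 0" "ratp p \<theta> = ratp q \<theta>"
  shows "ratp p r = ratp q r"
proof -
  have "ratp (p - q) \<theta> = 0" using assms(2) by (simp add: ratp_diff)
  then obtain s where "p - q = f * s" using fmin by (elim dvdE[OF fmin])
  then have "ratp p r - ratp q r = ratp f r * ratp s r" by (metis ratp_diff ratp_mult)
  then show ?thesis using assms(1) by simp
qed

lemma embedding_of_root:
  fixes r :: "'l::field_char_0"
  assumes "ratp f r = 0"
  shows "field_embedding (\<lambda>y. ratp (repr y) r)" "ratp (repr \<theta>) r = r"
proof -
  note e = ratp_eq_at_root[OF assms]
  have "ratp (repr 1) r = ratp 1 r" by (rule e) simp
  moreover have "ratp (repr (x + y)) r = ratp (repr x + repr y) r" for x y
    by (rule e) (simp add: ratp_add)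
  moreover have "ratp (repr (x * y)) r = ratp (repr x * repr y) r" for x y
    by (rule e) (simp add: ratp_mult)
  ultimately show "field_embedding (\<lambda>y. ratp (repr y) r)"
    by (simp add: field_embedding_def ratp_add ratp_mult)
  have "ratp (repr \<theta>) r = ratp [:0, 1:] r" by (rule e) (simp add: ratp_pCons)
  then show "ratp (repr \<theta>) r = r" by (simp add: ratp_pCons)
qed

text \<open>By irreducibility f divides the minimal polynomial of any of its roots. A root shared
  with the derivative would make f divide \<open>pderiv f\<close>, which has smaller degree.\<close>

lemma pderiv_at_root:
  fixes r :: "'l::field_char_0"
  assumes r: "ratp f r = 0"
  shows "ratp (pderiv f) r \<noteq> 0"
proof
  assume d: "ratp (pderiv f) r = 0"
  obtain f' where f': "f' \<noteq> 0" "ratp f' r = 0" "\<And>g. ratp g r = 0 \<Longrightarrow> f' dvd g" "degree f' > 0"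
    by (rule minimal_polynomial[OF f0 r]) (rule that)
  obtain s where s: "f = f' * s" by (rule dvdE[OF f'(3)[OF r]])
  have "ratp f' \<theta> = 0"
  proof (rule ccontr)
    assume "ratp f' \<theta> \<noteq> 0"
    then have "ratp s \<theta> = 0" using f\<theta> by (simp add: s ratp_mult)
    then have "f dvd s" by (rule fmin)
    moreover have "s \<noteq> 0" using f0 s by auto
    ultimately have "degree f \<le> degree s" by (rule dvd_imp_degree_le)
    moreover have "degree f = degree f' + degree s" unfolding s by (rule degree_mult_eq) (use f' \<open>s \<noteq> 0\<close> in auto)
    ultimately show False using f'(4) by simp
  qed
  then have "f dvd f'" by (rule fmin)
  also have "f' dvd pderiv f" by (rule f'(3)[OF d])
  finally have "f dvd pderiv f" .
  moreover have "pderiv f \<noteq> 0" using fdeg by (simp add: pderiv_eq_0_iff)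
  ultimately have "degree f \<le> degree (pderiv f)" by (rule dvd_imp_degree_le)
  then show False using fdeg by (simp add: degree_pderiv)
qed

lemma card_complex_roots: "card {z :: complex. ratp f z = 0} = degree f"
proof -
  let ?F = "map_poly of_rat f :: complex poly"
  have "rsquarefree ?F"
    unfolding rsquarefree_roots using pderiv_at_root[where 'l = complex]
    by (auto simp: pderiv_map_poly_of_rat ratp_def)
  from complex_poly_decompose_rsquarefree[OF this]
  have "degree (smult (lead_coeff ?F) (\<Prod>z|poly ?F z = 0. [:- z, 1:])) = degree ?F" by simp
  moreover have "lead_coeff ?F \<noteq> 0" using f0 by (simp add: map_poly_eq_0_iff)
  moreover have "degree (\<Prod>z|poly ?F z = 0. [:- z, 1:]) = card {z. poly ?F z = 0}"
    by (subst degree_prod_eq_sum_degree) auto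
  ultimately show ?thesis by (simp add: degree_map_poly ratp_def)
qed

context
  assumes tr: "totally_real TYPE('k)"
begin

text \<open>Every complex root is the image of \<theta> under a complex embedding.\<close>

lemma complex_root_real:
  assumes "ratp f (z::complex) = 0"
  shows "z \<in> \<real>"
proof -
  have "range (\<lambda>y. ratp (repr y) z) \<subseteq> \<real>"
    using tr embedding_of_root(1)[OF assms] by (simp add: totally_real_def)
  then have "ratp (repr \<theta>) z \<in> \<real>" by blast
  then show ?thesis using embedding_of_root(2)[OF assms] by simp
qed

lemma bij_betw_real_roots: "bij_betw (\<lambda>\<sigma>. \<sigma> \<theta>) real_embeddings {r::real. ratp f r = 0}"
proof (rule bij_betwI')
  fix \<sigma> \<tau> :: "'k \<Rightarrow> real" assume "\<sigma> \<in> real_embeddings" "\<tau> \<in> real_embeddings"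
  then have e: "field_embedding \<sigma>" "field_embedding \<tau>" by (auto simp: real_embeddings_def)
  show "(\<sigma> \<theta> = \<tau> \<theta>) = (\<sigma> = \<tau>)"
  proof
    assume eq: "\<sigma> \<theta> = \<tau> \<theta>"
    show "\<sigma> = \<tau>"
    proof
      fix y
      have "\<sigma> (ratp (repr y) \<theta>) = \<tau> (ratp (repr y) \<theta>)"
        unfolding field_embedding_ratp[OF e(1)] field_embedding_ratp[OF e(2)] eq ..
      then show "\<sigma> y = \<tau> y" by simp
    qed
  qed simp
next
  fix \<sigma> :: "'k \<Rightarrow> real" assume "\<sigma> \<in> real_embeddings"
  then have e: "field_embedding \<sigma>" by (simp add: real_embeddings_def)
  have "ratp f (\<sigma> \<theta>) = \<sigma> (ratp f \<theta>)" by (rule field_embedding_ratp[OF e, symmetric])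
  then show "\<sigma> \<theta> \<in> {r. ratp f r = 0}" using f\<theta> field_embedding_simps(1)[OF e] by simp
next
  fix r :: real assume "r \<in> {r. ratp f r = 0}"
  then have r: "ratp f r = 0" by simp
  show "\<exists>\<sigma>\<in>real_embeddings. r = \<sigma> \<theta>"
    using embedding_of_root[OF r] by (intro bexI[of _ "\<lambda>y. ratp (repr y) r"]) (auto simp: real_embeddings_def)
qed

lemma finite_real_embeddings: "finite (real_embeddings :: ('k \<Rightarrow> real) set)"
  using bij_betw_finite[OF bij_betw_real_roots] finite_ratp_roots[OF f0] by blast

text \<open>All complex roots of f are simple and real, and real embeddings correspond to real
  roots.\<close>

lemma card_real_embeddings: "card (real_embeddings :: ('k \<Rightarrow> real) set) = degree f"
proof -
  have "bij_betw complex_of_real {r::real. ratp f r = 0} {z. ratp f z = 0}"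
  proof (rule bij_betwI')
    show "complex_of_real x = complex_of_real y \<longleftrightarrow> x = y" for x y by simp
    show "complex_of_real x \<in> {z. ratp f z = 0}" if "x \<in> {r. ratp f r = 0}" for x
      using that by (simp add: ratp_of_real)
    fix z assume z: "z \<in> {z::complex. ratp f z = 0}"
    then have "z \<in> \<real>" by (intro complex_root_real) simp
    then obtain x where "z = complex_of_real x" by (rule Reals_cases)
    then show "\<exists>x\<in>{r. ratp f r = 0}. z = complex_of_real x" using z by (auto simp: ratp_of_real)
  qed
  then show ?thesis
    using bij_betw_same_card[OF bij_betw_real_roots] bij_betw_same_card card_complex_roots by metis
qed

end

lemma power_basis: "\<exists>c. y = (\<Sum>j<degree f. of_rat (c j) * \<theta> ^ j)"
proof -
  define p where "p = repr y mod f"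
  have "ratp p \<theta> = ratp (repr y) \<theta> - ratp (repr y div f) \<theta> * ratp f \<theta>"
    by (simp add: p_def ratp_diff ratp_mult flip: minus_div_mult_eq_mod)
  then have p: "ratp p \<theta> = y" using f\<theta> by simp
  have "degree p < degree f" unfolding p_def using f0 fdeg degree_mod_less[of f "repr y"] by auto
  have "ratp p \<theta> = (\<Sum>j<degree f. of_rat (coeff p j) * \<theta> ^ j)"
    unfolding ratp_altdef
    by (rule sum.mono_neutral_left) (use \<open>degree p < degree f\<close> in \<open>auto simp: coeff_eq_0\<close>)
  then show ?thesis using p by auto
qed

end

theorem field_structure:
  assumes nf: "number_field TYPE('k::field_char_0)" and tr: "totally_real TYPE('k)"
  obtains \<theta> :: "'k::field_char_0" where
    "finite (real_embeddings :: ('k \<Rightarrow> real) set)"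
    "card (real_embeddings :: ('k \<Rightarrow> real) set) > 0"
    "inj_on (\<lambda>\<sigma>. \<sigma> \<theta>) (real_embeddings :: ('k \<Rightarrow> real) set)"
    "\<And>y. \<exists>c. y = (\<Sum>j<card (real_embeddings :: ('k \<Rightarrow> real) set). of_rat (c j) * \<theta> ^ j)"
proof -
  obtain \<theta> :: 'k where gen: "rat_adjoin \<theta> = UNIV" by (rule primitive_element[OF nf]) (rule that)
  obtain p where "p \<noteq> 0" "ratp p \<theta> = 0" using number_field_algebraic[OF nf] by blast
  then obtain f where f: "f \<noteq> 0" "ratp f \<theta> = 0" "\<And>g. ratp g \<theta> = 0 \<Longrightarrow> f dvd g" "degree f > 0"
    by (rule minimal_polynomial) (rule that)
  interpret primitive_generator \<theta> f by unfold_locales (use gen f in auto)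
  show thesis
  proof (rule that[of \<theta>])
    show "finite (real_embeddings :: ('k \<Rightarrow> real) set)" by (rule finite_real_embeddings[OF tr])
    show "card (real_embeddings :: ('k \<Rightarrow> real) set) > 0" using card_real_embeddings[OF tr] f(4) by simp
    show "inj_on (\<lambda>\<sigma>. \<sigma> \<theta>) (real_embeddings :: ('k \<Rightarrow> real) set)"
      using bij_betw_real_roots[OF tr] by (rule bij_betw_imp_inj_on)
    show "\<exists>c. y = (\<Sum>j<card (real_embeddings :: ('k \<Rightarrow> real) set). of_rat (c j) * \<theta> ^ j)" for y
      unfolding card_real_embeddings[OF tr] by (rule power_basis)
  qed
qed

lemma algebraic_int_prod:
  "(\<And>a. a \<in> A \<Longrightarrow> algebraic_int (g a :: 'l::field_char_0)) \<Longrightarrow> algebraic_int (\<Prod>a\<in>A. g a)"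
  by (induction A rule: infinite_finite_induct) (auto intro: algebraic_int_plus_times)

text \<open>A polynomial of degree below n with n distinct roots is zero.\<close>

lemma vandermonde_kernel:
  fixes g :: "'i \<Rightarrow> 'a::idom"
  assumes A: "finite A" "inj_on g A" "card A = n"
    and zero: "\<forall>x\<in>A. (\<Sum>j<n. a j * g x ^ j) = 0" and j: "j < n"
  shows "a j = 0"
proof -
  define p where "p = (\<Sum>j<n. monom (a j) j)"
  have coeffp: "coeff p j = (if j < n then a j else 0)" for j
    by (simp add: p_def coeff_sum)
  have sub: "g ` A \<subseteq> {x. poly p x = 0}"
    using zero by (auto simp: p_def poly_sum poly_monom)
  have "p = 0"
  proof (rule ccontr)
    assume "p \<noteq> 0"
    have "degree p \<le> n - 1" by (rule degree_le) (auto simp: coeffp)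
    moreover have "card {x. poly p x = 0} \<le> degree p" by (rule card_poly_roots_bound[OF \<open>p \<noteq> 0\<close>])
    moreover have "card (g ` A) \<le> card {x. poly p x = 0}"
      by (rule card_mono[OF poly_roots_finite[OF \<open>p \<noteq> 0\<close>] sub])
    ultimately show False using j card_image[OF A(2)] A(3) by linarith
  qed
  then show ?thesis using coeffp[of j] j by simp
qed

text \<open>Multiplication by \<open>x\<close> is a rational matrix in the power basis; the Vandermonde matrix of
  the embeddings diagonalises it, so the product of the conjugates is its determinant.\<close>

lemma norm_rational:
  assumes nf: "number_field TYPE('k::field_char_0)" and tr: "totally_real TYPE('k)"
  shows "(\<Prod>\<sigma>\<in>real_embeddings. \<sigma> (x::'k)) \<in> \<rat>"
proof -
  let ?E = "real_embeddings :: ('k \<Rightarrow> real) set"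
  obtain \<theta> :: 'k where fin: "finite ?E" and inj: "inj_on (\<lambda>\<sigma>. \<sigma> \<theta>) ?E"
    and basis: "\<And>y. \<exists>c. y = (\<Sum>j<card ?E. of_rat (c j) * \<theta> ^ j)"
    by (rule field_structure[OF nf tr]) (rule that)
  define n where "n = card ?E"
  obtain e where e: "bij_betw e {0..<n} ?E" using ex_bij_betw_nat_finite[OF fin] n_def by blast
  have emb: "field_embedding (e i)" if "i < n" for i
    using e that by (auto dest!: bij_betwE simp: real_embeddings_def)
  have "\<forall>i. \<exists>c. x * \<theta> ^ i = (\<Sum>j<n. of_rat (c j) * \<theta> ^ j)" using basis unfolding n_def by blast
  then obtain c where c: "\<And>i. x * \<theta> ^ i = (\<Sum>j<n. of_rat (c i j) * \<theta> ^ j)" by metis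
  define M where "M = mat n n (\<lambda>(l, j). c j l)"
  define W where "W = mat n n (\<lambda>(i, j). e i \<theta> ^ j)"
  define D where "D = mat n n (\<lambda>(i, j). if i = j then e i x else 0)"
  have carr: "M \<in> carrier_mat n n" "W \<in> carrier_mat n n" "D \<in> carrier_mat n n"
    by (simp_all add: M_def W_def D_def)
  have "W * map_mat of_rat M = D * W"
  proof (rule eq_matI)
    fix i j assume "i < dim_row (D * W)" "j < dim_col (D * W)"
    then have ij: "i < n" "j < n" using carr by auto
    have "index_mat (W * map_mat of_rat M) (i, j) = (\<Sum>l = 0..<n. e i \<theta> ^ l * of_rat (c j l))"
      using ij by (simp add: W_def M_def scalar_prod_def)
    also have "\<dots> = e i (\<Sum>l<n. of_rat (c j l) * \<theta> ^ l)"
      using emb[OF ij(1)] by (simp add: field_embedding_sum field_embedding_simps field_embeddingD lessThan_atLeast0 mult.commute)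
    also have "\<dots> = e i x * e i \<theta> ^ j"
      unfolding c[symmetric] using emb[OF ij(1)] by (simp add: field_embedding_simps field_embeddingD)
    also have "\<dots> = (\<Sum>l = 0..<n. (if i = l then e i x else 0) * e l \<theta> ^ j)"
    proof -
      have "(\<Sum>l = 0..<n. (if i = l then e i x else 0) * e l \<theta> ^ j) = (\<Sum>l = 0..<n. if i = l then e i x * e l \<theta> ^ j else 0)"
        by (intro sum.cong) auto
      then show ?thesis using ij by simp
    qed
    also have "\<dots> = index_mat (D * W) (i, j)"
      using ij by (simp add: W_def D_def scalar_prod_def)
    finally show "index_mat (W * map_mat of_rat M) (i, j) = index_mat (D * W) (i, j)" .
  qed (use carr in auto)
  then have "det (W * map_mat of_rat M) = det (D * W)" by (rule arg_cong)
  moreover have "det (W * map_mat of_rat M) = det W * det (map_mat of_rat M)"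
    by (rule det_mult) (use carr in auto)
  moreover have "det (D * W) = det D * det W" by (rule det_mult) (use carr in auto)
  ultimately have "det W * det (map_mat of_rat M) = det D * det W" by (simp only:)
  \<comment> \<open>A kernel vector would give a polynomial of degree below n vanishing at the n
    distinct conjugates of \<theta>.\<close>
  moreover have "det W \<noteq> 0"
  proof
    assume "det W = 0"
    then obtain v where v: "v \<in> carrier_vec n" "v \<noteq> 0\<^sub>v n" "W *\<^sub>v v = 0\<^sub>v n"
      using det_0_iff_vec_prod_zero[OF carr(2)] by blast
    have roots: "\<forall>i\<in>{0..<n}. (\<Sum>j<n. vec_index v j * e i \<theta> ^ j) = 0"
    proof
      fix i assume i: "i \<in> {0..<n}"
      have "vec_index (W *\<^sub>v v) i = (\<Sum>j = 0..<n. e i \<theta> ^ j * vec_index v j)"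
        using i v(1) by (simp add: W_def scalar_prod_def)
      then show "(\<Sum>j<n. vec_index v j * e i \<theta> ^ j) = 0"
        using v(3) i by (simp add: lessThan_atLeast0 mult.commute)
    qed
    have "inj_on (\<lambda>i. e i \<theta>) {0..<n}"
      using comp_inj_on[OF bij_betw_imp_inj_on[OF e], of "\<lambda>\<sigma>. \<sigma> \<theta>"] inj bij_betw_imp_surj_on[OF e] by (simp add: comp_def)
    from vandermonde_kernel[where a = "vec_index v" and g = "\<lambda>i. e i \<theta>", OF _ this _ roots]
    have "vec_index v j = 0" if "j < n" for j using that by simp
    then have "v = 0\<^sub>v n" using v(1) by (intro eq_vecI) auto
    then show False using v(2) by simp
  qed
  ultimately have "det (map_mat of_rat M) = det D" by auto
  moreover have "det (map_mat of_rat M) = (of_rat (det M) :: real)" by (rule of_rat_hom.hom_det)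
  moreover have "det D = (\<Prod>i = 0..<n. e i x)"
  proof -
    have "upper_triangular D" unfolding upper_triangular_def D_def by auto
    then have "det D = prod_list (diag_mat D)" by (rule det_upper_triangular[OF _ carr(3)])
    also have "\<dots> = (\<Prod>i = 0..<n. e i x)" unfolding prod_list_diag_prod by (simp add: D_def)
    finally show ?thesis .
  qed
  moreover have "(\<Prod>i = 0..<n. e i x) = (\<Prod>\<sigma>\<in>?E. \<sigma> x)" by (rule prod.reindex_bij_betw[OF e])
  ultimately show ?thesis by (metis Rats_of_rat)
qed

text \<open>The product of the conjugates is rational and also an algebraic integer, hence an
  integer.\<close>

theorem abs_norm_ge_1:
  assumes nf: "number_field TYPE('k::field_char_0)" and tr: "totally_real TYPE('k)"
    and x: "x \<in> ring_of_integers" "x \<noteq> (0::'k)"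
  obtains N :: int where "(\<Prod>\<sigma>\<in>real_embeddings. \<sigma> x) = of_int N" "\<bar>N\<bar> \<ge> 1"
proof -
  have emb: "field_embedding \<sigma>" if "\<sigma> \<in> real_embeddings" for \<sigma> :: "'k \<Rightarrow> real"
    using that by (simp add: real_embeddings_def)
  have "algebraic_int (\<Prod>\<sigma>\<in>real_embeddings. \<sigma> x)"
    by (rule algebraic_int_prod) (use x emb in \<open>auto simp: field_embedding_algebraic_int_iff ring_of_integers_def\<close>)
  then have "(\<Prod>\<sigma>\<in>real_embeddings. \<sigma> x) \<in> \<int>"
    using norm_rational[OF nf tr] by (rule rational_algebraic_int_is_int)
  then obtain N where N: "(\<Prod>\<sigma>\<in>real_embeddings. \<sigma> x) = of_int N" by (rule Ints_cases)
  obtain \<theta> :: 'k where fin: "finite (real_embeddings :: ('k \<Rightarrow> real) set)"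
    by (rule field_structure[OF nf tr]) (rule that)
  have "(\<Prod>\<sigma>\<in>real_embeddings. \<sigma> x) \<noteq> 0"
    using fin x emb by (simp add: field_embedding_simps)
  then have "\<bar>N\<bar> \<ge> 1" using N by auto
  then show ?thesis by (rule that[OF N])
qed

subsection \<open>The lattice of integers\<close>

text \<open>The powers of \<theta> in general span only a sublattice of the integers, hence the
  rational coefficients in \<open>basis\<close>. Positivity of the conjugates makes combinations
  with nonnegative coefficients easy to bound from both sides.\<close>

locale integral_frame =
  fixes E :: "('k::field_char_0 \<Rightarrow> real) set" and \<theta> :: 'k and n :: nat
  assumes E_def: "E = real_embeddings" and finE: "finite E" and n_def: "n = card E" and n0: "n > 0"
    and \<theta>_int: "\<theta> \<in> ring_of_integers" and \<theta>_pos: "\<And>\<sigma>. \<sigma> \<in> E \<Longrightarrow> \<sigma> \<theta> > 0"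
    and inj: "inj_on (\<lambda>\<sigma>. \<sigma> \<theta>) E"
    and basis: "\<And>y. \<exists>c. y = (\<Sum>j<n. of_rat (c j) * \<theta> ^ j)"
    and norm: "\<And>x. x \<in> ring_of_integers \<Longrightarrow> x \<noteq> 0 \<Longrightarrow> \<exists>N::int. (\<Prod>\<sigma>\<in>E. \<sigma> x) = of_int N \<and> \<bar>N\<bar> \<ge> 1"
begin

lemma emb: "\<sigma> \<in> E \<Longrightarrow> field_embedding \<sigma>"
  by (simp add: E_def real_embeddings_def)

lemmas emb_simps = field_embedding_simps[OF emb] field_embeddingD[OF emb] field_embedding_sum[OF emb]

lemma E_nonempty: "E \<noteq> {}"
  using n0 n_def by auto

lemma totally_positive_iff: "totally_positive x \<longleftrightarrow> (\<forall>\<sigma>\<in>E. \<sigma> x > 0)"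
  by (auto simp: totally_positive_def E_def real_embeddings_def)

lemma integral_iff: "\<sigma> \<in> E \<Longrightarrow> x \<in> ring_of_integers \<longleftrightarrow> algebraic_int (\<sigma> x)"
  by (simp add: ring_of_integers_def field_embedding_algebraic_int_iff[OF emb])

lemma abs_norm: "x \<in> ring_of_integers \<Longrightarrow> x \<noteq> 0 \<Longrightarrow> (\<Prod>\<sigma>\<in>E. \<bar>\<sigma> x\<bar>) \<ge> 1"
proof -
  assume "x \<in> ring_of_integers" "x \<noteq> 0"
  then obtain N :: int where N: "(\<Prod>\<sigma>\<in>E. \<sigma> x) = of_int N" "\<bar>N\<bar> \<ge> 1" using norm by blast
  have "(\<Prod>\<sigma>\<in>E. \<bar>\<sigma> x\<bar>) = \<bar>of_int N\<bar>" by (simp add: N(1)[symmetric] abs_prod)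
  then show ?thesis using N(2) by linarith
qed

text \<open>Otherwise the difference would be a nonzero integer of absolute norm at most 2^(-n) <
  1.\<close>

lemma eq_if_close:
  assumes "x \<in> ring_of_integers" "y \<in> ring_of_integers" "\<And>\<sigma>. \<sigma> \<in> E \<Longrightarrow> \<bar>\<sigma> x - \<sigma> y\<bar> \<le> 1/2"
  shows "x = y"
proof (rule ccontr)
  assume "x \<noteq> y"
  then have "1 \<le> (\<Prod>\<sigma>\<in>E. \<bar>\<sigma> (x - y)\<bar>)" using assms by (intro abs_norm ring_of_integers_closed) auto
  also have "\<dots> \<le> (\<Prod>\<sigma>\<in>E. 1/2)" using assms(3) by (intro prod_mono) (auto simp: emb_simps)
  also have "\<dots> = (1/2)^n" by (simp add: n_def)
  also have "\<dots> \<le> (1/2)^1" using n0 by (intro power_decreasing) auto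
  finally show False by simp
qed

text \<open>By \<open>eq_if_close\<close> an integer is determined by the floors of its doubled
  conjugates.\<close>

lemma finite_bounded_integers: "finite {x \<in> ring_of_integers. \<forall>\<sigma>\<in>E. \<bar>\<sigma> x\<bar> \<le> B}"
proof -
  let ?S = "{x \<in> ring_of_integers. \<forall>\<sigma>\<in>E. \<bar>\<sigma> x\<bar> \<le> B}"
  define \<phi> where "\<phi> x = restrict (\<lambda>\<sigma>. \<lfloor>2 * \<sigma> x\<rfloor>) E" for x :: 'k
  have "inj_on \<phi> ?S"
  proof (rule inj_onI)
    fix x y assume xy: "x \<in> ?S" "y \<in> ?S" "\<phi> x = \<phi> y"
    show "x = y"
    proof (rule eq_if_close)
      fix \<sigma> assume "\<sigma> \<in> E"
      then have "\<lfloor>2 * \<sigma> x\<rfloor> = \<lfloor>2 * \<sigma> y\<rfloor>" using fun_cong[OF xy(3), of \<sigma>] by (simp add: \<phi>_def)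
      then show "\<bar>\<sigma> x - \<sigma> y\<bar> \<le> 1/2"
        using floor_correct[of "2 * \<sigma> x"] floor_correct[of "2 * \<sigma> y"] by linarith
    qed (use xy in auto)
  qed
  moreover have "\<phi> ` ?S \<subseteq> PiE E (\<lambda>_. {\<lfloor>- 2 * B\<rfloor>..\<lfloor>2 * B\<rfloor>})"
  proof (rule image_subsetI)
    fix x assume "x \<in> ?S"
    then have "\<bar>\<sigma> x\<bar> \<le> B" if "\<sigma> \<in> E" for \<sigma> using that by auto
    then show "\<phi> x \<in> PiE E (\<lambda>_. {\<lfloor>- 2 * B\<rfloor>..\<lfloor>2 * B\<rfloor>})"
      unfolding \<phi>_def by (intro restrict_PiE_iff[THEN iffD2]) (fastforce simp: abs_le_iff intro: floor_mono)
  qed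
  then have "finite (\<phi> ` ?S)" by (rule finite_subset) (simp add: finE finite_PiE)
  ultimately show ?thesis by (rule finite_imageD[rotated])
qed

text \<open>A bound for all conjugates of combinations of the \<theta>^j with coefficients in
  [0, 1]; the summand 1 ensures W >= 1.\<close>

definition W :: real where "W = 1 + (\<Sum>\<sigma>\<in>E. \<Sum>j<n. \<sigma> \<theta> ^ j)"

lemma W_pos: "W \<ge> 1"
  unfolding W_def using \<theta>_pos by (auto intro!: sum_nonneg simp: less_imp_le)

lemma combination_bounds:
  assumes "\<sigma> \<in> E" "\<And>j. j < n \<Longrightarrow> 0 \<le> a j \<and> a j \<le> B" "B \<ge> 0"
  shows "0 \<le> (\<Sum>j<n. a j * \<sigma> \<theta> ^ j)" "(\<Sum>j<n. a j * \<sigma> \<theta> ^ j) \<le> B * W"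
proof -
  have p: "\<sigma> \<theta> ^ j \<ge> 0" if "\<sigma> \<in> E" for \<sigma> j using \<theta>_pos[OF that] by simp
  show "0 \<le> (\<Sum>j<n. a j * \<sigma> \<theta> ^ j)" using assms p by (intro sum_nonneg mult_nonneg_nonneg) auto
  have "(\<Sum>j<n. a j * \<sigma> \<theta> ^ j) \<le> (\<Sum>j<n. B * \<sigma> \<theta> ^ j)"
    using assms p by (intro sum_mono mult_right_mono) auto
  also have "\<dots> = B * (\<Sum>j<n. \<sigma> \<theta> ^ j)" by (simp add: sum_distrib_left)
  also have "\<dots> \<le> B * W"
  proof (rule mult_left_mono[OF _ assms(3)])
    have "(\<Sum>j<n. \<sigma> \<theta> ^ j) \<le> (\<Sum>\<sigma>\<in>E. \<Sum>j<n. \<sigma> \<theta> ^ j)"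
      using assms(1) finE p by (intro member_le_sum[of \<sigma> E "\<lambda>\<sigma>. \<Sum>j<n. \<sigma> \<theta> ^ j"] sum_nonneg) auto
    then show "(\<Sum>j<n. \<sigma> \<theta> ^ j) \<le> W" by (simp add: W_def)
  qed
  finally show "(\<Sum>j<n. a j * \<sigma> \<theta> ^ j) \<le> B * W" .
qed

definition comb :: "(nat \<Rightarrow> int) \<Rightarrow> 'k" where
  "comb a = (\<Sum>j<n. of_int (a j) * \<theta> ^ j)"

lemma sum_integral:
  assumes "\<And>j. j \<in> A \<Longrightarrow> g j \<in> (ring_of_integers :: 'k set)"
  shows "sum g A \<in> ring_of_integers"
  using assms
proof (induction A rule: infinite_finite_induct)
  case (insert a A)
  then show ?case by (simp add: ring_of_integers_closed)
qed (use ring_of_integers_closed(5)[of 0] in auto)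

lemma comb_integral: "comb a \<in> ring_of_integers"
  unfolding comb_def by (intro sum_integral ring_of_integers_closed \<theta>_int)

lemma emb_comb: "\<sigma> \<in> E \<Longrightarrow> \<sigma> (comb a) = (\<Sum>j<n. of_int (a j) * \<sigma> \<theta> ^ j)"
  by (simp add: comb_def emb_simps)

lemma comb_zero:
  assumes "comb a = 0" "j < n"
  shows "a j = 0"
proof -
  have "\<forall>\<sigma>\<in>E. (\<Sum>j<n. real_of_int (a j) * \<sigma> \<theta> ^ j) = 0"
    using emb_comb[of _ a] assms(1) by (auto simp: emb_simps)
  from vandermonde_kernel[where g = "\<lambda>\<sigma>. \<sigma> \<theta>" and a = "\<lambda>j. real_of_int (a j)", OF finE inj n_def[symmetric] this assms(2)]
  show ?thesis by simp
qed

lemma comb_diff: "comb a - comb b = comb (\<lambda>j. a j - b j)"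
  by (simp add: comb_def left_diff_distrib sum_subtractf)

text \<open>Minkowski's theorem for boxes, with a worse constant, from the pigeonhole principle.\<close>

lemma small_integer:
  assumes t: "\<And>\<sigma>. \<sigma> \<in> E \<Longrightarrow> t \<sigma> > 0" and t1: "(\<Prod>\<sigma>\<in>E. t \<sigma>) = 1"
  shows "\<exists>\<gamma>\<in>ring_of_integers. \<gamma> \<noteq> 0 \<and> (\<forall>\<sigma>\<in>E. \<bar>\<sigma> \<gamma>\<bar> \<le> 3 * W * t \<sigma>)"
proof -
  \<comment> \<open>The M^n combinations with coefficients below M have \<sigma>-values in [0, M W],
    which is cut into intervals of length 3 W t(\<sigma>). As M >= 3 t(\<sigma>), there are at most
    2M/(3 t(\<sigma>)) of these, so at most (2M/3)^n boxes, fewer than combinations.\<close>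
  obtain M :: nat where M: "of_nat M > 3 * (\<Sum>\<sigma>\<in>E. t \<sigma>)" using reals_Archimedean2 by blast
  have tM: "3 * t \<sigma> \<le> of_nat M" if "\<sigma> \<in> E" for \<sigma>
  proof -
    have "t \<sigma> \<le> (\<Sum>\<sigma>\<in>E. t \<sigma>)" using that finE t by (intro member_le_sum) (auto simp: less_imp_le)
    then show ?thesis using M by linarith
  qed
  have "3 * (\<Sum>\<sigma>\<in>E. t \<sigma>) \<ge> 0" using t by (auto intro!: sum_nonneg simp: less_imp_le)
  then have M0: "M > 0" using M by (cases M) auto
  define A where "A = PiE {..<n} (\<lambda>_. {0..<int M})"
  define \<phi> where "\<phi> a = restrict (\<lambda>\<sigma>. \<lfloor>\<sigma> (comb a) / (3 * W * t \<sigma>)\<rfloor>) E" for a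
  define K where "K \<sigma> = {0..\<lfloor>real M / (3 * t \<sigma>)\<rfloor>}" for \<sigma>
  have cardA: "card A = M ^ n" by (simp add: A_def card_PiE)
  have rng: "\<phi> ` A \<subseteq> PiE E K"
  proof (rule image_subsetI)
    fix a assume a: "a \<in> A"
    have "\<lfloor>\<sigma> (comb a) / (3 * W * t \<sigma>)\<rfloor> \<in> K \<sigma>" if \<sigma>: "\<sigma> \<in> E" for \<sigma>
    proof -
      have "0 \<le> real_of_int (a j) \<and> real_of_int (a j) \<le> real M" if "j < n" for j
      proof -
        have "0 \<le> a j" "a j \<le> int M" using a that by (auto simp: A_def PiE_iff less_imp_le)
        then have "0 \<le> real_of_int (a j)" "real_of_int (a j) \<le> real_of_int (int M)"
          by (simp_all only: of_int_le_iff of_int_0_le_iff)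
        then show ?thesis by simp
      qed
      from combination_bounds[OF \<sigma> this] have b: "0 \<le> \<sigma> (comb a)" "\<sigma> (comb a) \<le> real M * W"
        by (simp_all add: emb_comb[OF \<sigma>])
      have pos: "3 * W * t \<sigma> > 0" using W_pos t[OF \<sigma>] by simp
      have "\<sigma> (comb a) / (3 * W * t \<sigma>) \<le> (real M * W) / (3 * W * t \<sigma>)"
        using b pos by (intro divide_right_mono) auto
      also have "\<dots> = real M / (3 * t \<sigma>)" using W_pos by simp
      finally have "\<lfloor>\<sigma> (comb a) / (3 * W * t \<sigma>)\<rfloor> \<le> \<lfloor>real M / (3 * t \<sigma>)\<rfloor>" by (rule floor_mono)
      moreover have "0 \<le> \<lfloor>\<sigma> (comb a) / (3 * W * t \<sigma>)\<rfloor>" using b pos by simp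
      ultimately show ?thesis by (simp add: K_def)
    qed
    then show "\<phi> a \<in> PiE E K" unfolding \<phi>_def by (intro restrict_PiE_iff[THEN iffD2]) auto
  qed
  have "real (card (PiE E K)) = (\<Prod>\<sigma>\<in>E. real (card (K \<sigma>)))" by (simp add: card_PiE finE)
  also have "\<dots> \<le> (\<Prod>\<sigma>\<in>E. (2/3) * real M / t \<sigma>)"
  proof (rule prod_mono, intro conjI)
    fix \<sigma> assume \<sigma>: "\<sigma> \<in> E"
    have ge: "1 \<le> real M / (3 * t \<sigma>)" using tM[OF \<sigma>] t[OF \<sigma>] by simp
    have "real (card (K \<sigma>)) = of_int (\<lfloor>real M / (3 * t \<sigma>)\<rfloor> + 1)"
      using ge by (simp add: K_def)
    also have "\<dots> \<le> real M / (3 * t \<sigma>) + 1" using of_int_floor_le[of "real M / (3 * t \<sigma>)"] by simp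
    also have "\<dots> \<le> 2 * (real M / (3 * t \<sigma>))" using ge by simp
    finally show "real (card (K \<sigma>)) \<le> (2/3) * real M / t \<sigma>" by simp
  qed simp
  also have "\<dots> = ((2/3) * real M) ^ n" unfolding prod_dividef t1 by (simp add: n_def)
  also have "\<dots> < real M ^ n" using M0 n0 by (intro power_strict_mono) auto
  finally have "card (PiE E K) < card A" by (simp add: cardA)
  moreover have "card (\<phi> ` A) \<le> card (PiE E K)"
    by (rule card_mono[OF _ rng]) (simp add: finite_PiE finE K_def)
  ultimately have "\<not> inj_on \<phi> A" by (intro pigeonhole) simp
  then obtain a b where ab: "a \<in> A" "b \<in> A" "\<phi> a = \<phi> b" "a \<noteq> b" by (auto simp: inj_on_def)
  show ?thesis
  proof (intro bexI conjI ballI)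
    show "comb a - comb b \<in> ring_of_integers" by (intro ring_of_integers_closed comb_integral)
    show "comb a - comb b \<noteq> 0"
    proof
      assume "comb a - comb b = 0"
      then have "a j = b j" if "j < n" for j using comb_zero[of "\<lambda>j. a j - b j" j] that by (simp add: comb_diff)
      then have "a = b" using ab unfolding A_def by (intro PiE_ext) auto
      then show False using ab by simp
    qed
    fix \<sigma> assume \<sigma>: "\<sigma> \<in> E"
    have pos: "3 * W * t \<sigma> > 0" using W_pos t[OF \<sigma>] by simp
    have "\<lfloor>\<sigma> (comb a) / (3 * W * t \<sigma>)\<rfloor> = \<lfloor>\<sigma> (comb b) / (3 * W * t \<sigma>)\<rfloor>"
      using fun_cong[OF ab(3), of \<sigma>] \<sigma> by (simp add: \<phi>_def)
    then have "\<bar>\<sigma> (comb a) / (3 * W * t \<sigma>) - \<sigma> (comb b) / (3 * W * t \<sigma>)\<bar> \<le> 1"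
      using floor_correct[of "\<sigma> (comb a) / (3 * W * t \<sigma>)"] floor_correct[of "\<sigma> (comb b) / (3 * W * t \<sigma>)"] by linarith
    then have "\<bar>\<sigma> (comb a) - \<sigma> (comb b)\<bar> / (3 * W * t \<sigma>) \<le> 1"
      using pos by (simp flip: diff_divide_distrib add: abs_divide)
    then show "\<bar>\<sigma> (comb a - comb b)\<bar> \<le> 3 * W * t \<sigma>" using pos \<sigma> by (simp add: emb_simps)
  qed
qed

text \<open>Division by k in the power basis: the quotient has integer coordinates, the remainder
  rational ones.\<close>

lemma floor_decomposition:
  assumes "k > 0"
  obtains a :: "nat \<Rightarrow> int" and e :: "nat \<Rightarrow> rat"
  where "y = of_nat k * comb a + (\<Sum>j<n. of_rat (e j) * \<theta> ^ j)" "\<And>j. 0 \<le> e j" "\<And>j. e j < of_nat k"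
proof -
  obtain c where c: "y = (\<Sum>j<n. of_rat (c j) * \<theta> ^ j)" using basis by blast
  define a where "a j = \<lfloor>c j / of_nat k\<rfloor>" for j
  define e where "e j = c j - of_nat k * of_int (a j)" for j
  have "y = (\<Sum>j<n. of_nat k * (of_int (a j) * \<theta> ^ j) + of_rat (e j) * \<theta> ^ j)"
    unfolding c by (intro sum.cong refl) (simp add: e_def of_rat_diff of_rat_mult algebra_simps)
  also have "\<dots> = of_nat k * comb a + (\<Sum>j<n. of_rat (e j) * \<theta> ^ j)"
    by (simp add: sum.distrib comb_def sum_distrib_left)
  finally have 1: "y = of_nat k * comb a + (\<Sum>j<n. of_rat (e j) * \<theta> ^ j)" .
  have k: "rat_of_nat k > 0" using assms by simp
  have "0 \<le> e j \<and> e j < of_nat k" for j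
  proof -
    have "of_int (a j) \<le> c j / of_nat k" "c j / of_nat k < of_int (a j) + 1"
      using floor_correct[of "c j / of_nat k"] by (auto simp: a_def)
    then have "of_int (a j) * of_nat k \<le> c j" "c j < (of_int (a j) + 1) * of_nat k"
      using k by (simp_all add: pos_le_divide_eq pos_divide_less_eq)
    then show ?thesis by (simp add: e_def algebra_simps)
  qed
  then show ?thesis using that[OF 1] by blast
qed

lemma emb_rat_comb:
  "\<sigma> \<in> E \<Longrightarrow> \<sigma> (\<Sum>j<n. of_rat (e j) * \<theta> ^ j) = (\<Sum>j<n. of_rat (e j) * \<sigma> \<theta> ^ j)"
  by (simp add: emb_simps)

text \<open>Together with \<open>finite_bounded_integers\<close> this leaves finitely many residues
  mod k.\<close>

lemma residues_finite:
  assumes k: "k > 0" and y: "y \<in> ring_of_integers"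
  shows "\<exists>\<rho> z. \<rho> \<in> ring_of_integers \<and> (\<forall>\<sigma>\<in>E. \<bar>\<sigma> \<rho>\<bar> \<le> of_nat k * W) \<and> z \<in> ring_of_integers \<and> y = \<rho> + of_nat k * z"
proof -
  obtain a e where ae: "y = of_nat k * comb a + (\<Sum>j<n. of_rat (e j) * \<theta> ^ j)" "\<And>j. 0 \<le> e j" "\<And>j. e j < of_nat k"
    by (rule floor_decomposition[OF k, of y]) (rule that)
  define \<rho> where "\<rho> = (\<Sum>j<n. of_rat (e j) * \<theta> ^ j)"
  have \<rho>: "y = \<rho> + of_nat k * comb a" using ae(1) by (simp add: \<rho>_def)
  have "\<rho> = y - of_int (int k) * comb a" using \<rho> by simp
  then have "\<rho> \<in> ring_of_integers" using y by (simp only: ring_of_integers_closed comb_integral)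
  moreover have "\<bar>\<sigma> \<rho>\<bar> \<le> of_nat k * W" if \<sigma>: "\<sigma> \<in> E" for \<sigma>
  proof -
    have "0 \<le> real_of_rat (e j) \<and> real_of_rat (e j) \<le> of_nat k" for j
      using ae(2,3)[of j] of_rat_less_eq[of "e j" "of_nat k", where 'a = real] by (simp add: less_imp_le)
    from combination_bounds[OF \<sigma> this] show ?thesis unfolding \<rho>_def emb_rat_comb[OF \<sigma>] by simp
  qed
  ultimately show ?thesis using \<rho> comb_integral by blast
qed

text \<open>N/g is the product of the remaining conjugates of g. These are real numbers, so
  integrality is transported along one embedding.\<close>

lemma norm_multiple:
  assumes g: "g \<in> ring_of_integers" "g \<noteq> 0" and N: "(\<Prod>\<sigma>\<in>E. \<sigma> g) = of_int N"
  shows "of_int N / g \<in> ring_of_integers"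
proof -
  obtain \<sigma> where \<sigma>: "\<sigma> \<in> E" using E_nonempty by blast
  have nz: "\<sigma> g \<noteq> 0" using g \<sigma> by (simp add: emb_simps)
  have "\<sigma> (of_int N / g) = of_int N / \<sigma> g" using \<sigma> by (simp add: emb_simps)
  also have "\<dots> = (\<Prod>\<tau>\<in>E - {\<sigma>}. \<tau> g)"
    unfolding N[symmetric] using nz by (simp add: prod.remove[OF finE \<sigma>])
  finally have e: "\<sigma> (of_int N / g) = (\<Prod>\<tau>\<in>E - {\<sigma>}. \<tau> g)" .
  have "algebraic_int (\<Prod>\<tau>\<in>E - {\<sigma>}. \<tau> g)"
    by (rule algebraic_int_prod) (use integral_iff g(1) in auto)
  then show ?thesis using integral_iff[OF \<sigma>] e by simp
qed

text \<open>Elements \<gamma> and g of equal absolute norm k and equal residue mod k are associated: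
  \<gamma>/g = 1 + (k/g)(z(\<gamma>) - z(g)) is integral because k/g is, and likewise
  g/\<gamma>.\<close>

lemma finite_associates:
  "\<exists>\<Gamma>. finite \<Gamma> \<and> \<Gamma> \<subseteq> ring_of_integers - {0} \<and>
     (\<forall>\<gamma>\<in>ring_of_integers. \<gamma> \<noteq> 0 \<and> (\<Prod>\<sigma>\<in>E. \<bar>\<sigma> \<gamma>\<bar>) \<le> B \<longrightarrow> (\<exists>g\<in>\<Gamma>. \<exists>u\<in>integer_units. \<gamma> = g * u))"
proof -
  define S where "S = {\<gamma> \<in> ring_of_integers. \<gamma> \<noteq> 0 \<and> (\<Prod>\<sigma>\<in>E. \<bar>\<sigma> \<gamma>\<bar>) \<le> B}"
  have "\<forall>\<gamma>. \<exists>N::int. \<gamma> \<in> S \<longrightarrow> (\<Prod>\<sigma>\<in>E. \<sigma> \<gamma>) = of_int N \<and> \<bar>N\<bar> \<ge> 1" using norm by (auto simp: S_def)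
  then obtain N :: "'k \<Rightarrow> int" where N: "\<And>\<gamma>. \<gamma> \<in> S \<Longrightarrow> (\<Prod>\<sigma>\<in>E. \<sigma> \<gamma>) = of_int (N \<gamma>)" "\<And>\<gamma>. \<gamma> \<in> S \<Longrightarrow> \<bar>N \<gamma>\<bar> \<ge> 1" by metis
  define k where "k \<gamma> = nat \<bar>N \<gamma>\<bar>" for \<gamma>
  have k0: "k \<gamma> > 0" if "\<gamma> \<in> S" for \<gamma> using N(2)[OF that] by (simp add: k_def)
  have kB: "real (k \<gamma>) \<le> B" if "\<gamma> \<in> S" for \<gamma>
  proof -
    have "(\<Prod>\<sigma>\<in>E. \<bar>\<sigma> \<gamma>\<bar>) = \<bar>of_int (N \<gamma>)\<bar>" using N(1)[OF that] by (simp flip: abs_prod)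
    then show ?thesis using that by (simp add: S_def k_def)
  qed
  have kdvd: "of_nat (k \<gamma>) / \<gamma> \<in> ring_of_integers" if "\<gamma> \<in> S" for \<gamma>
  proof -
    have "of_int (N \<gamma>) / \<gamma> \<in> ring_of_integers" using that N(1)[OF that] by (intro norm_multiple) (auto simp: S_def)
    moreover have "of_nat (k \<gamma>) = (of_int (N \<gamma>) :: 'k) \<or> of_nat (k \<gamma>) = - (of_int (N \<gamma>) :: 'k)"
      unfolding k_def by (cases "N \<gamma> \<ge> 0") auto
    ultimately show ?thesis using ring_of_integers_closed(3) by fastforce
  qed
  have "\<forall>\<gamma>. \<exists>\<rho> z. \<gamma> \<in> S \<longrightarrow> \<rho> \<in> ring_of_integers \<and> (\<forall>\<sigma>\<in>E. \<bar>\<sigma> \<rho>\<bar> \<le> of_nat (k \<gamma>) * W) \<and> z \<in> ring_of_integers \<and> \<gamma> = \<rho> + of_nat (k \<gamma>) * z"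
    using residues_finite k0 by (auto simp: S_def)
  then obtain \<rho> z where \<rho>: "\<And>\<gamma>. \<gamma> \<in> S \<Longrightarrow> \<rho> \<gamma> \<in> ring_of_integers"
    "\<And>\<gamma>. \<gamma> \<in> S \<Longrightarrow> \<forall>\<sigma>\<in>E. \<bar>\<sigma> (\<rho> \<gamma>)\<bar> \<le> of_nat (k \<gamma>) * W"
    "\<And>\<gamma>. \<gamma> \<in> S \<Longrightarrow> z \<gamma> \<in> ring_of_integers" "\<And>\<gamma>. \<gamma> \<in> S \<Longrightarrow> \<gamma> = \<rho> \<gamma> + of_nat (k \<gamma>) * z \<gamma>" by metis
  define \<phi> where "\<phi> \<gamma> = (k \<gamma>, \<rho> \<gamma>)" for \<gamma>
  have "\<phi> ` S \<subseteq> {..nat \<lfloor>B\<rfloor>} \<times> {x \<in> ring_of_integers. \<forall>\<sigma>\<in>E. \<bar>\<sigma> x\<bar> \<le> B * W}"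
  proof (rule image_subsetI)
    fix \<gamma> assume \<gamma>: "\<gamma> \<in> S"
    have "k \<gamma> \<le> nat \<lfloor>B\<rfloor>" using kB[OF \<gamma>] by (simp add: le_nat_floor)
    moreover have "of_nat (k \<gamma>) * W \<le> B * W" using kB[OF \<gamma>] W_pos by (intro mult_right_mono) auto
    ultimately show "\<phi> \<gamma> \<in> {..nat \<lfloor>B\<rfloor>} \<times> {x \<in> ring_of_integers. \<forall>\<sigma>\<in>E. \<bar>\<sigma> x\<bar> \<le> B * W}"
      using \<rho>(1,2)[OF \<gamma>] by (fastforce simp: \<phi>_def)
  qed
  then have "finite (\<phi> ` S)" by (rule finite_subset) (simp add: finite_bounded_integers)
  then obtain \<Gamma> where \<Gamma>: "\<Gamma> \<subseteq> S" "finite \<Gamma>" "\<phi> ` S = \<phi> ` \<Gamma>" using finite_subset_image[of "\<phi> ` S" \<phi> S] by blast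
  have quot: "\<gamma> / g \<in> ring_of_integers" if g: "\<gamma> \<in> S" "g \<in> S" "\<phi> \<gamma> = \<phi> g" for \<gamma> g
  proof -
    have "g \<noteq> 0" using g by (simp add: S_def)
    have "k \<gamma> = k g" "\<rho> \<gamma> = \<rho> g" using g(3) by (auto simp: \<phi>_def)
    then have "\<gamma> = \<rho> g + of_nat (k g) * z \<gamma>" "g = \<rho> g + of_nat (k g) * z g"
      using \<rho>(4)[OF g(1)] \<rho>(4)[OF g(2)] by simp_all
    then have "\<gamma> - g = (\<rho> g + of_nat (k g) * z \<gamma>) - (\<rho> g + of_nat (k g) * z g)"
      by (rule arg_cong2)
    also have "\<dots> = of_nat (k g) * (z \<gamma> - z g)" by (simp add: algebra_simps)
    finally have "\<gamma> - g = of_nat (k g) * (z \<gamma> - z g)" .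
    then have "\<gamma> / g = of_int 1 + of_nat (k g) / g * (z \<gamma> - z g)" using \<open>g \<noteq> 0\<close> by (simp add: field_simps)
    then show ?thesis using kdvd[OF g(2)] \<rho>(3) g by (simp only: ring_of_integers_closed)
  qed
  have "\<exists>g\<in>\<Gamma>. \<exists>u\<in>integer_units. \<gamma> = g * u" if \<gamma>: "\<gamma> \<in> S" for \<gamma>
  proof -
    have "\<phi> \<gamma> \<in> \<phi> ` \<Gamma>" using \<Gamma>(3) \<gamma> by blast
    then obtain g where g: "g \<in> \<Gamma>" "\<phi> \<gamma> = \<phi> g" by blast
    then have gS: "g \<in> S" using \<Gamma> by blast
    have nz: "g \<noteq> 0" "\<gamma> \<noteq> 0" using gS \<gamma> by (auto simp: S_def)
    have "\<gamma> / g \<in> integer_units" unfolding integer_units_def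
      using quot[OF \<gamma> gS g(2)] quot[OF gS \<gamma> g(2)[symmetric]] nz by (auto intro!: bexI[of _ "g / \<gamma>"])
    then show ?thesis using g nz by (intro bexI[of _ g] bexI[of _ "\<gamma> / g"]) auto
  qed
  then show ?thesis using \<Gamma> by (intro exI[of _ \<Gamma>]) (auto simp: S_def)
qed

end

section \<open>Balancing totally positive integers by powers of units\<close>

context integral_frame
begin

lemma units_closed:
  assumes "u \<in> integer_units"
  obtains v where "v \<in> integer_units" "u * v = 1" "u \<noteq> 0" "v \<noteq> 0"
proof -
  obtain v where v: "v \<in> ring_of_integers" "u * v = 1" using assms by (auto simp: integer_units_def)
  have "v * u = 1" using v(2) by (simp add: mult.commute)
  then have "v \<in> integer_units" using v assms by (auto simp: integer_units_def)
  moreover have "u \<noteq> 0" "v \<noteq> 0" using v(2) by auto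
  ultimately show ?thesis using that v by blast
qed

lemma finite_value_bounds:
  assumes "finite \<Gamma>" "0 \<notin> \<Gamma>"
  obtains lo hi :: real where "lo > 0" "\<And>g \<sigma>. g \<in> \<Gamma> \<Longrightarrow> \<sigma> \<in> E \<Longrightarrow> lo \<le> \<bar>\<sigma> g\<bar>" "\<And>g \<sigma>. g \<in> \<Gamma> \<Longrightarrow> \<sigma> \<in> E \<Longrightarrow> \<bar>\<sigma> g\<bar> \<le> hi"
proof -
  \<comment> \<open>The element 1 keeps minimum and maximum defined when \<Gamma> is empty.\<close>
  define V where "V = insert 1 ((\<lambda>(g, \<sigma>). \<bar>\<sigma> g\<bar>) ` (\<Gamma> \<times> E))"
  have V: "finite V" "V \<noteq> {}" using assms finE by (auto simp: V_def)
  have pos: "v > 0" if "v \<in> V" for v using that assms(2) by (auto simp: V_def emb_simps)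
  have inV: "\<bar>\<sigma> g\<bar> \<in> V" if "g \<in> \<Gamma>" "\<sigma> \<in> E" for g \<sigma> using that by (auto simp: V_def)
  show ?thesis
  proof (rule that[of "Min V" "Max V"])
    show "Min V > 0" using pos Min_in[OF V] by blast
    show "Min V \<le> \<bar>\<sigma> g\<bar>" if "g \<in> \<Gamma>" "\<sigma> \<in> E" for g \<sigma> using V(1) inV[OF that] by simp
    show "\<bar>\<sigma> g\<bar> \<le> Max V" if "g \<in> \<Gamma>" "\<sigma> \<in> E" for g \<sigma> using V(1) inV[OF that] by simp
  qed
qed

text \<open>A weak form of Dirichlet's unit theorem: a small \<open>\<gamma>\<close> adapted to \<open>\<beta>\<close> has bounded norm, so up to
  finitely many choices it is a unit, and its \<open>m\<close>th power evens out the conjugates of \<open>\<beta>\<close>.\<close>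

lemma balanced_representative:
  assumes m: "m > 0" "even m"
  obtains c C :: real where "c > 0"
    "\<And>\<beta>. \<beta> \<in> positive_integers \<Longrightarrow>
       \<exists>u\<in>integer_units. \<exists>R>0. \<forall>\<sigma>\<in>E. c * R \<le> \<sigma> (\<beta> * u ^ m) \<and> \<sigma> (\<beta> * u ^ m) \<le> C * R"
proof -
  define K where "K = 3 * W"
  have K: "K > 0" using W_pos by (simp add: K_def)
  obtain \<Gamma> where \<Gamma>: "finite \<Gamma>" "\<Gamma> \<subseteq> ring_of_integers - {0}"
    "\<forall>\<gamma>\<in>ring_of_integers. \<gamma> \<noteq> 0 \<and> (\<Prod>\<sigma>\<in>E. \<bar>\<sigma> \<gamma>\<bar>) \<le> K ^ n \<longrightarrow> (\<exists>g\<in>\<Gamma>. \<exists>u\<in>integer_units. \<gamma> = g * u)"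
    using finite_associates[of "K ^ n"] by (elim exE conjE) (rule that)
  have "0 \<notin> \<Gamma>" using \<Gamma>(2) by auto
  obtain lo hi where lo: "lo > 0" "\<And>g \<sigma>. g \<in> \<Gamma> \<Longrightarrow> \<sigma> \<in> E \<Longrightarrow> lo \<le> \<bar>\<sigma> g\<bar>"
    and hi: "\<And>g \<sigma>. g \<in> \<Gamma> \<Longrightarrow> \<sigma> \<in> E \<Longrightarrow> \<bar>\<sigma> g\<bar> \<le> hi"
    by (rule finite_value_bounds[OF \<Gamma>(1) \<open>0 \<notin> \<Gamma>\<close>]) (rule that)
  show thesis
  proof (rule that[of "(lo / K) ^ m" "(K ^ (n - 1) * hi) ^ m"])
    show "(lo / K) ^ m > 0" using lo(1) K by simp
    fix \<beta> :: 'k assume "\<beta> \<in> positive_integers"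
    then have \<beta>: "\<beta> \<in> ring_of_integers" "\<And>\<sigma>. \<sigma> \<in> E \<Longrightarrow> \<sigma> \<beta> > 0"
      by (auto simp: positive_integers_def totally_positive_iff)
    \<comment> \<open>R is the geometric mean of the conjugates. The t(\<sigma>) are mth roots of
      the conjugates divided by R, so their product is 1, as \<open>small_integer\<close>
      demands.\<close>
    define R where "R = root n (\<Prod>\<sigma>\<in>E. \<sigma> \<beta>)"
    have P0: "(\<Prod>\<sigma>\<in>E. \<sigma> \<beta>) > 0" using \<beta>(2) by (intro prod_pos) auto
    have R0: "R > 0" and Rn: "R ^ n = (\<Prod>\<sigma>\<in>E. \<sigma> \<beta>)" unfolding R_def using P0 n0 by simp_all
    define t where "t \<sigma> = root m (\<sigma> \<beta> / R)" for \<sigma> :: "'k \<Rightarrow> real"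
    have t0: "t \<sigma> > 0" and tm: "t \<sigma> ^ m = \<sigma> \<beta> / R" if "\<sigma> \<in> E" for \<sigma>
      unfolding t_def using \<beta>(2)[OF that] R0 m by simp_all
    have "(\<Prod>\<sigma>\<in>E. t \<sigma>) ^ m = (\<Prod>\<sigma>\<in>E. \<sigma> \<beta> / R)" unfolding prod_power_distrib by (intro prod.cong refl tm)
    also have "\<dots> = 1 ^ m" using R0 P0 by (simp add: prod_dividef n_def[symmetric] Rn)
    finally have t1: "(\<Prod>\<sigma>\<in>E. t \<sigma>) = 1"
      by (rule power_eq_imp_eq_base) (use t0 m in \<open>auto intro!: prod_nonneg simp: less_imp_le\<close>)
    obtain \<gamma> where \<gamma>: "\<gamma> \<in> ring_of_integers" "\<gamma> \<noteq> 0" "\<And>\<sigma>. \<sigma> \<in> E \<Longrightarrow> \<bar>\<sigma> \<gamma>\<bar> \<le> K * t \<sigma>"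
      using small_integer[of t, OF t0 t1] by (auto simp: K_def)
    have "(\<Prod>\<sigma>\<in>E. \<bar>\<sigma> \<gamma>\<bar>) \<le> (\<Prod>\<sigma>\<in>E. K * t \<sigma>)" using \<gamma>(3) by (intro prod_mono) auto
    also have "\<dots> = K ^ n" by (simp add: prod.distrib t1 n_def)
    finally obtain g u where gu: "g \<in> \<Gamma>" "u \<in> integer_units" "\<gamma> = g * u" using \<Gamma>(3) \<gamma>(1,2) by blast
    \<comment> \<open>The balancing unit is v = g/\<gamma>. Up to bounded factors, its mth power
      divides \<sigma>(\<beta>) by t(\<sigma>)^m, which leaves R.\<close>
    obtain v where v: "v \<in> integer_units" "u * v = 1" by (rule units_closed[OF gu(2)]) (rule that)
    have main: "\<sigma> (\<beta> * v ^ m) = (t \<sigma> * \<bar>\<sigma> g\<bar> / \<bar>\<sigma> \<gamma>\<bar>) ^ m * R" and nz: "\<bar>\<sigma> \<gamma>\<bar> > 0" if \<sigma>: "\<sigma> \<in> E" for \<sigma>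
    proof -
      have g0: "\<sigma> g \<noteq> 0" "\<sigma> \<gamma> \<noteq> 0" using \<gamma>(2) gu(3) \<sigma> by (auto simp: emb_simps)
      then show "\<bar>\<sigma> \<gamma>\<bar> > 0" by simp
      have "\<gamma> * v = g * (u * v)" unfolding gu(3) by (simp add: mult_ac)
      then have "\<sigma> \<gamma> * \<sigma> v = \<sigma> g" using v(2) emb_simps(13)[OF \<sigma>, of \<gamma> v] by simp
      then have "\<sigma> v = \<sigma> g / \<sigma> \<gamma>" using g0 by (simp add: field_simps)
      then have "\<sigma> (\<beta> * v ^ m) = \<sigma> \<beta> * (\<sigma> g / \<sigma> \<gamma>) ^ m" using \<sigma> by (simp add: emb_simps)
      also have "(\<sigma> g / \<sigma> \<gamma>) ^ m = (\<bar>\<sigma> g\<bar> / \<bar>\<sigma> \<gamma>\<bar>) ^ m"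
        using power_even_abs[OF m(2), of "\<sigma> g / \<sigma> \<gamma>"] by (simp add: abs_divide)
      also have "\<sigma> \<beta> = t \<sigma> ^ m * R" using tm[OF \<sigma>] R0 by simp
      finally show "\<sigma> (\<beta> * v ^ m) = (t \<sigma> * \<bar>\<sigma> g\<bar> / \<bar>\<sigma> \<gamma>\<bar>) ^ m * R"
        by (simp add: power_mult_distrib power_divide)
    qed
    have "(lo / K) ^ m * R \<le> \<sigma> (\<beta> * v ^ m) \<and> \<sigma> (\<beta> * v ^ m) \<le> (K ^ (n - 1) * hi) ^ m * R" if \<sigma>: "\<sigma> \<in> E" for \<sigma>
    proof -
      have "lo / K * \<bar>\<sigma> \<gamma>\<bar> \<le> lo / K * (K * t \<sigma>)" using \<gamma>(3)[OF \<sigma>] lo(1) K by (intro mult_left_mono) auto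
      also have "\<dots> = lo * t \<sigma>" using K by simp
      also have "\<dots> \<le> \<bar>\<sigma> g\<bar> * t \<sigma>" using lo(2)[OF gu(1) \<sigma>] t0[OF \<sigma>] by (intro mult_right_mono) auto
      finally have 1: "lo / K \<le> t \<sigma> * \<bar>\<sigma> g\<bar> / \<bar>\<sigma> \<gamma>\<bar>" using nz[OF \<sigma>] by (simp add: pos_le_divide_eq mult.commute)
      \<comment> \<open>The upper bound requires that |\<sigma>(\<gamma>)| is not much smaller than
        t(\<sigma>). This holds because the absolute norm of \<gamma> is at least 1 while the other
        conjugates are at most K t(\<tau>).\<close>
      define Q where "Q = (\<Prod>\<tau>\<in>E - {\<sigma>}. \<bar>\<tau> \<gamma>\<bar>)"
      have Q1: "1 \<le> \<bar>\<sigma> \<gamma>\<bar> * Q" using abs_norm[OF \<gamma>(1,2)] unfolding Q_def by (simp add: prod.remove[OF finE \<sigma>])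
      have "t \<sigma> * Q \<le> t \<sigma> * (\<Prod>\<tau>\<in>E - {\<sigma>}. K * t \<tau>)"
        unfolding Q_def using \<gamma>(3) t0[OF \<sigma>] by (intro mult_left_mono prod_mono) auto
      also have "\<dots> = K ^ (n - 1) * (t \<sigma> * (\<Prod>\<tau>\<in>E - {\<sigma>}. t \<tau>))"
        using finE \<sigma> by (simp add: prod.distrib n_def)
      also have "t \<sigma> * (\<Prod>\<tau>\<in>E - {\<sigma>}. t \<tau>) = 1" using t1 by (simp add: prod.remove[OF finE \<sigma>])
      finally have Q2: "t \<sigma> * Q \<le> K ^ (n - 1)" by simp
      have "t \<sigma> * 1 \<le> t \<sigma> * (\<bar>\<sigma> \<gamma>\<bar> * Q)" using Q1 t0[OF \<sigma>] by (intro mult_left_mono) auto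
      also have "\<dots> = \<bar>\<sigma> \<gamma>\<bar> * (t \<sigma> * Q)" by simp
      also have "\<dots> \<le> \<bar>\<sigma> \<gamma>\<bar> * K ^ (n - 1)" using Q2 by (intro mult_left_mono) auto
      finally have "t \<sigma> * \<bar>\<sigma> g\<bar> \<le> (\<bar>\<sigma> \<gamma>\<bar> * K ^ (n - 1)) * hi"
        using hi[OF gu(1) \<sigma>] K t0[OF \<sigma>] by (intro mult_mono) auto
      then have 2: "t \<sigma> * \<bar>\<sigma> g\<bar> / \<bar>\<sigma> \<gamma>\<bar> \<le> K ^ (n - 1) * hi" using nz[OF \<sigma>] by (simp add: pos_divide_le_eq mult_ac)
      have "(lo / K) ^ m \<le> (t \<sigma> * \<bar>\<sigma> g\<bar> / \<bar>\<sigma> \<gamma>\<bar>) ^ m" using 1 lo(1) K by (intro power_mono) auto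
      moreover have "(t \<sigma> * \<bar>\<sigma> g\<bar> / \<bar>\<sigma> \<gamma>\<bar>) ^ m \<le> (K ^ (n - 1) * hi) ^ m"
        using 2 t0[OF \<sigma>] by (intro power_mono) auto
      ultimately show ?thesis unfolding main[OF \<sigma>] using R0 by (auto intro!: mult_right_mono)
    qed
    then show "\<exists>u\<in>integer_units. \<exists>R>0. \<forall>\<sigma>\<in>E. (lo / K) ^ m * R \<le> \<sigma> (\<beta> * u ^ m) \<and> \<sigma> (\<beta> * u ^ m) \<le> (K ^ (n - 1) * hi) ^ m * R"
      using v(1) R0 by blast
  qed
qed

definition bounded_positive :: "real \<Rightarrow> 'k set" where
  "bounded_positive B = {x \<in> positive_integers. \<forall>\<sigma>\<in>E. \<sigma> x \<le> B}"

lemma finite_bounded_positive: "finite (bounded_positive B)"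
  by (rule finite_subset[OF _ finite_bounded_integers[of B]])
     (auto simp: bounded_positive_def positive_integers_def totally_positive_iff)

definition decomposables :: "'k set" where
  "decomposables = {x + y | x y. x \<in> positive_integers \<and> y \<in> positive_integers}"

text \<open>The shifts by \<open>2\<close> keep every multiplicity at least \<open>2\<close> and make the remainder decomposable, so that no
  coefficient has to be an indecomposable element.\<close>

lemma balanced_decomposition:
  assumes c: "c > 0" and R: "R > 0" and \<beta>: "\<beta> \<in> positive_integers"
    and balanced: "\<forall>\<sigma>\<in>E. c * R \<le> \<sigma> \<beta> \<and> \<sigma> \<beta> \<le> C * R"
  shows "\<beta> \<in> bounded_positive (8 * C * W / c) \<or>
    (\<exists>N \<tau> k \<rho>. N \<ge> 2 \<and> \<tau> \<in> bounded_positive (8 * C * W / c) \<and> (\<forall>j<n. k j \<ge> 2) \<and>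
       \<rho> \<in> bounded_positive (3 * W) \<inter> decomposables \<and>
       \<beta> = of_nat N * \<tau> + (\<Sum>j<n. of_nat (k j) * \<theta> ^ j) + \<rho>)"
proof -
  note bal = bspec[OF balanced]
  have \<beta>O: "\<beta> \<in> ring_of_integers" using \<beta> by (simp add: positive_integers_def)
  obtain \<sigma>0 where \<sigma>0: "\<sigma>0 \<in> E" using E_nonempty by blast
  have "c * R \<le> C * R" using bal[OF \<sigma>0] by linarith
  then have cC: "c \<le> C" using R by simp
  \<comment> \<open>The factor 4 W leaves room for positivity of \<tau>: from \<sigma>(\<beta>) >= 4
    W N one removes 2 N \<sigma>(T1) <= 2 N W and a remainder of at most N W, so \<sigma>(\<tau>) >=
    W.\<close>
  define y where "y = c * R / (4 * W)"
  have Ry: "C * R = 4 * C * W / c * y" using c W_pos by (simp add: y_def)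
  have cRy: "c * R = 4 * W * y" using W_pos by (simp add: y_def)
  have coefp: "4 * C * W / c > 0" using c cC W_pos by simp
  show ?thesis
  proof (cases "y < 2")
    case True
    have "\<sigma> \<beta> \<le> 8 * C * W / c" if "\<sigma> \<in> E" for \<sigma>
    proof -
      have "\<sigma> \<beta> \<le> 4 * C * W / c * y" using bal[OF that] Ry by simp
      also have "\<dots> \<le> 4 * C * W / c * 2" using True coefp by (intro mult_left_mono) auto
      finally show ?thesis by simp
    qed
    then show ?thesis using \<beta> by (simp add: bounded_positive_def)
  next
    case False
    define N where "N = nat \<lfloor>y\<rfloor>"
    have N2: "N \<ge> 2" using False by (simp add: N_def le_nat_iff le_floor_iff)
    have Ny: "real N \<le> y" "y \<le> 2 * real N"
    proof -
      have "real N = of_int \<lfloor>y\<rfloor>" using False by (simp add: N_def)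
      then show "real N \<le> y" "y \<le> 2 * real N" using floor_correct[of y] N2 by linarith+
    qed
    have "N > 0" using N2 by simp
    obtain a e where ae: "\<beta> = of_nat N * comb a + (\<Sum>j<n. of_rat (e j) * \<theta> ^ j)" "\<And>j. 0 \<le> e j" "\<And>j. e j < of_nat N"
      by (rule floor_decomposition[OF \<open>N > 0\<close>, of \<beta>]) (rule that)
    define i where "i j = \<lfloor>e j\<rfloor>" for j
    define f where "f j = e j - of_int (i j)" for j
    have f: "0 \<le> f j" "f j \<le> 1" for j using floor_correct[of "e j"] by (auto simp: f_def i_def)
    have i0: "0 \<le> i j" for j using ae(2)[of j] by (simp add: i_def)
    \<comment> \<open>Lowering the coordinates of \<open>comb a\<close> by 2 frees 2 N T1. Of this,
      (2N - 2) T1 goes into the multiplicities \<open>k\<close>, one T1 into \<open>\<rho>'\<close>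
      to make it totally positive, and one T1 is the second summand of
      \<open>\<rho>\<close>.\<close>
    define \<tau> where "\<tau> = comb (\<lambda>j. a j - 2)"
    define k where "k j = nat (i j) + 2 * N - 2" for j
    define T1 where "T1 = (\<Sum>j<n. \<theta> ^ j)"
    define \<rho>' where "\<rho>' = (\<Sum>j<n. of_rat (f j + 1) * \<theta> ^ j)"
    define \<rho> where "\<rho> = \<rho>' + T1"
    have T1O: "T1 \<in> ring_of_integers" unfolding T1_def by (intro sum_integral ring_of_integers_closed \<theta>_int)
    have k2: "k j \<ge> 2" for j using N2 by (simp add: k_def)
    have \<tau>': "\<tau> = comb a - 2 * T1"
      by (simp add: \<tau>_def comb_def T1_def left_diff_distrib sum_subtractf sum_distrib_left)
    have kk: "of_nat (k j) = (of_int (i j) + 2 * of_nat N - 2 :: 'k)" for j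
    proof -
      have "int (k j) = i j + 2 * int N - 2" using i0[of j] N2 by (simp add: k_def)
      then have "(of_int (int (k j)) :: 'k) = of_int (i j + 2 * int N - 2)" by (rule arg_cong)
      then show ?thesis by simp
    qed
    have ksum: "(\<Sum>j<n. of_nat (k j) * \<theta> ^ j) = (\<Sum>j<n. of_int (i j) * \<theta> ^ j) + (2 * of_nat N - 2) * T1"
      by (simp add: kk T1_def sum_distrib_left algebra_simps sum.distrib sum_subtractf)
    have esum: "(\<Sum>j<n. of_rat (e j) * \<theta> ^ j) = (\<Sum>j<n. of_int (i j) * \<theta> ^ j) + \<rho>' - T1"
      by (simp add: \<rho>'_def T1_def f_def of_rat_add of_rat_diff algebra_simps sum.distrib sum_subtractf)
    have dec: "\<beta> = of_nat N * \<tau> + (\<Sum>j<n. of_nat (k j) * \<theta> ^ j) + \<rho>"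
      unfolding ae(1) esum ksum \<tau>' \<rho>_def by (simp add: algebra_simps)
    \<comment> \<open>The coordinates of \<open>\<rho>'\<close> are merely rational, so its
      integrality is read off from this difference.\<close>
    have "\<rho>' = \<beta> - of_int (int N) * \<tau> - (\<Sum>j<n. of_int (int (k j)) * \<theta> ^ j) - T1"
      using dec by (simp add: \<rho>_def)
    then have \<rho>'O: "\<rho>' \<in> ring_of_integers"
      unfolding \<tau>_def by (simp only:) (intro ring_of_integers_closed \<beta>O comb_integral sum_integral T1O \<theta>_int)
    have pw: "\<sigma> \<theta> ^ j > 0" if "\<sigma> \<in> E" for \<sigma> j using \<theta>_pos[OF that] by simp
    have T1\<sigma>: "\<sigma> T1 = (\<Sum>j<n. 1 * \<sigma> \<theta> ^ j)" if "\<sigma> \<in> E" for \<sigma> using that by (simp add: T1_def emb_simps)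
    have T1pos: "\<sigma> T1 > 0" if "\<sigma> \<in> E" for \<sigma>
      unfolding T1\<sigma>[OF that] using pw[OF that] n0 by (intro sum_pos) auto
    have T1le: "\<sigma> T1 \<le> W" if "\<sigma> \<in> E" for \<sigma>
      using combination_bounds(2)[OF that, of "\<lambda>_. 1" 1] T1\<sigma>[OF that] by simp
    have fr: "0 \<le> real_of_rat (f j)" "real_of_rat (f j) \<le> 1" for j using f[of j] by simp_all
    have \<rho>'\<sigma>: "\<sigma> \<rho>' = (\<Sum>j<n. (of_rat (f j) + 1) * \<sigma> \<theta> ^ j)" if "\<sigma> \<in> E" for \<sigma>
      unfolding \<rho>'_def emb_rat_comb[OF that] by (simp add: of_rat_add)
    have \<rho>'pos: "\<sigma> \<rho>' > 0" if "\<sigma> \<in> E" for \<sigma>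
      unfolding \<rho>'\<sigma>[OF that] using pw[OF that] n0 fr by (intro sum_pos mult_pos_pos add_nonneg_pos) auto
    have \<rho>'le: "\<sigma> \<rho>' \<le> 2 * W" if "\<sigma> \<in> E" for \<sigma>
      using combination_bounds(2)[OF that, of "\<lambda>j. of_rat (f j) + 1" 2] fr \<rho>'\<sigma>[OF that] by simp
    have T1P: "T1 \<in> positive_integers" using T1O T1pos by (simp add: positive_integers_def totally_positive_iff)
    have \<rho>'P: "\<rho>' \<in> positive_integers" using \<rho>'O \<rho>'pos by (simp add: positive_integers_def totally_positive_iff)
    have \<rho>P: "\<rho> \<in> positive_integers"
      using \<rho>'O T1O \<rho>'pos T1pos
      by (simp add: \<rho>_def positive_integers_def totally_positive_iff ring_of_integers_closed emb_simps add_pos_pos)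
    have \<rho>: "\<rho> \<in> bounded_positive (3 * W) \<inter> decomposables"
    proof
      show "\<rho> \<in> decomposables" unfolding decomposables_def \<rho>_def using T1P \<rho>'P by blast
      have "\<sigma> \<rho> \<le> 3 * W" if "\<sigma> \<in> E" for \<sigma> using \<rho>'le[OF that] T1le[OF that] that by (simp add: \<rho>_def emb_simps)
      then show "\<rho> \<in> bounded_positive (3 * W)" using \<rho>P by (simp add: bounded_positive_def)
    qed
    have \<tau>b: "\<sigma> \<tau> > 0 \<and> \<sigma> \<tau> \<le> 8 * C * W / c" if \<sigma>: "\<sigma> \<in> E" for \<sigma>
    proof -
      have er: "0 \<le> real_of_rat (e j) \<and> real_of_rat (e j) \<le> real N" for j
        using ae(2,3)[of j] of_rat_less_eq[of "e j" "of_nat N", where 'a = real] by (simp add: less_imp_le)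
      define s where "s = (\<Sum>j<n. of_rat (e j) * \<sigma> \<theta> ^ j)"
      have s: "0 \<le> s" "s \<le> real N * W" using combination_bounds[OF \<sigma> er] by (simp_all add: s_def)
      have "\<beta> = of_nat N * \<tau> + 2 * of_nat N * T1 + (\<Sum>j<n. of_rat (e j) * \<theta> ^ j)"
        unfolding ae(1) \<tau>' by (simp add: algebra_simps)
      then have "\<sigma> \<beta> = \<sigma> (of_nat N * \<tau> + 2 * of_nat N * T1) + s"
        unfolding s_def emb_rat_comb[OF \<sigma>, symmetric] emb_simps(12)[OF \<sigma>, symmetric] by (rule arg_cong)
      also have "\<sigma> (of_nat N * \<tau> + 2 * of_nat N * T1) = real N * \<sigma> \<tau> + 2 * real N * \<sigma> T1"
        using \<sigma> emb_simps(5)[OF \<sigma>, of 2] by (simp add: emb_simps)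
      finally have eq: "\<sigma> \<beta> = real N * \<sigma> \<tau> + 2 * real N * \<sigma> T1 + s" .
      have Nr: "real N > 0" using N2 by simp
      have "4 * W * real N \<le> 4 * W * y" using Ny(1) W_pos by (intro mult_left_mono) auto
      moreover have "real N * \<sigma> T1 \<le> real N * W" using T1le[OF \<sigma>] Nr by (intro mult_left_mono) auto
      ultimately have "real N * W \<le> real N * \<sigma> \<tau>"
        using eq s bal[OF \<sigma>] cRy by (simp add: algebra_simps)
      then have "W \<le> \<sigma> \<tau>" using Nr by simp
      moreover have "real N * \<sigma> \<tau> \<le> real N * (8 * C * W / c)"
      proof -
        have "0 \<le> real N * \<sigma> T1" using T1pos[OF \<sigma>] Nr by simp
        then have "real N * \<sigma> \<tau> \<le> 4 * C * W / c * y" using eq s bal[OF \<sigma>] Ry by simp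
        also have "\<dots> \<le> 4 * C * W / c * (2 * real N)" using Ny(2) coefp by (intro mult_left_mono) auto
        finally show ?thesis by (simp add: mult_ac)
      qed
      then have "\<sigma> \<tau> \<le> 8 * C * W / c" using Nr by (simp only: mult_le_cancel_left_pos)
      ultimately show ?thesis using W_pos by simp
    qed
    have "\<tau> \<in> bounded_positive (8 * C * W / c)"
      using \<tau>b comb_integral by (simp add: bounded_positive_def positive_integers_def totally_positive_iff \<tau>_def)
    then show ?thesis
      by (intro disjI2 exI[of _ N] exI[of _ \<tau>] exI[of _ k] exI[of _ \<rho>] conjI allI impI N2 k2 \<rho> dec)
  qed
qed

end

text \<open>A generator becomes integral after multiplication by a common denominator D of its
  multiplication matrix, and totally positive after adding a large natural number M.\<close>

lemma integral_frame_exists: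
  assumes nf: "number_field TYPE('k::field_char_0)" and tr: "totally_real TYPE('k)"
  shows "\<exists>\<theta>::'k. integral_frame real_embeddings \<theta> (card (real_embeddings :: ('k \<Rightarrow> real) set))"
proof -
  let ?E = "real_embeddings :: ('k \<Rightarrow> real) set"
  define n where "n = card ?E"
  obtain \<theta>0 :: 'k where fin: "finite ?E" and n0': "card ?E > 0" and inj: "inj_on (\<lambda>\<sigma>. \<sigma> \<theta>0) ?E"
    and basis': "\<And>y. \<exists>c. y = (\<Sum>j<card ?E. of_rat (c j) * \<theta>0 ^ j)"
    by (rule field_structure[OF nf tr]) (rule that)
  note n0 = n0'[folded n_def] and basis = basis'[folded n_def]
  have emb: "field_embedding \<sigma>" if "\<sigma> \<in> ?E" for \<sigma> using that by (simp add: real_embeddings_def)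
  have "\<forall>i. \<exists>c. \<theta>0 * \<theta>0 ^ i = (\<Sum>j<n. of_rat (c j) * \<theta>0 ^ j)" using basis by blast
  then obtain c where c: "\<And>i. \<theta>0 * \<theta>0 ^ i = (\<Sum>j<n. of_rat (c i j) * \<theta>0 ^ j)" by metis
  have "\<exists>D::nat. D > 0 \<and> (\<forall>x\<in>{..<n} \<times> {..<n}. \<exists>z::int. of_nat D * (case x of (i, j) \<Rightarrow> c i j) = rat_of_int z)"
    by (rule common_denominator) simp
  then obtain D :: nat where D: "D > 0"
    "\<forall>x\<in>{..<n} \<times> {..<n}. \<exists>z::int. of_nat D * (case x of (i, j) \<Rightarrow> c i j) = rat_of_int z" by (elim exE conjE)
  have "\<forall>i j. \<exists>z::int. i < n \<longrightarrow> j < n \<longrightarrow> of_nat D * c i j = rat_of_int z" using D(2) by auto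
  then obtain z :: "nat \<Rightarrow> nat \<Rightarrow> int" where z: "\<And>i j. i < n \<Longrightarrow> j < n \<Longrightarrow> of_nat D * c i j = rat_of_int (z i j)" by metis
  have int: "algebraic_int (of_nat D * \<theta>0)"
  proof (rule algebraic_int_stable[of "{..<n}" 0 "\<lambda>j. \<theta>0 ^ j"])
    fix i assume i: "i \<in> {..<n}"
    have "of_nat D * \<theta>0 * \<theta>0 ^ i = of_nat D * (\<Sum>j<n. of_rat (c i j) * \<theta>0 ^ j)" by (simp add: c[symmetric] mult.assoc)
    also have "\<dots> = (\<Sum>j<n. of_rat (of_nat D * c i j) * \<theta>0 ^ j)"
      by (simp add: sum_distrib_left of_rat_mult mult.assoc)
    also have "\<dots> = (\<Sum>j<n. of_int (z i j) * \<theta>0 ^ j)" using i z by (intro sum.cong refl) simp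
    finally show "\<exists>a::nat \<Rightarrow> int. of_nat D * \<theta>0 * \<theta>0 ^ i = (\<Sum>j<n. of_int (a j) * \<theta>0 ^ j)"
      by (rule exI[of _ "z i"])
  qed (use n0 in auto)
  obtain M :: nat where M: "of_nat M > (\<Sum>\<sigma>\<in>?E. \<bar>\<sigma> (of_nat D * \<theta>0)\<bar>)" using reals_Archimedean2 by blast
  define \<theta> where "\<theta> = of_nat D * \<theta>0 + of_int (int M)"
  have \<sigma>\<theta>: "\<sigma> \<theta> = of_nat D * \<sigma> \<theta>0 + of_nat M" if "\<sigma> \<in> ?E" for \<sigma>
    using emb[OF that] by (simp add: \<theta>_def field_embedding_simps field_embeddingD)
  have "integral_frame ?E \<theta> n"
  proof
    show "?E = real_embeddings" "finite ?E" "n = card ?E" "n > 0" by (simp_all add: fin n0 n_def[symmetric])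
    show "\<theta> \<in> ring_of_integers"
    proof -
      have "of_nat D * \<theta>0 \<in> ring_of_integers" using int by (simp add: ring_of_integers_def)
      then show ?thesis unfolding \<theta>_def by (rule ring_of_integers_closed(1)) (rule ring_of_integers_closed(5))
    qed
    show "\<sigma> \<theta> > 0" if "\<sigma> \<in> ?E" for \<sigma>
    proof -
      have "\<bar>\<sigma> (of_nat D * \<theta>0)\<bar> \<le> (\<Sum>\<sigma>\<in>?E. \<bar>\<sigma> (of_nat D * \<theta>0)\<bar>)"
        using fin that by (intro member_le_sum[of \<sigma> ?E "\<lambda>\<sigma>. \<bar>\<sigma> (of_nat D * \<theta>0)\<bar>"]) auto
      moreover have "\<sigma> (of_nat D * \<theta>0) = of_nat D * \<sigma> \<theta>0"
        using emb[OF that] by (simp add: field_embedding_simps field_embeddingD)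
      ultimately show ?thesis using M unfolding \<sigma>\<theta>[OF that] by linarith
    qed
    show "inj_on (\<lambda>\<sigma>. \<sigma> \<theta>) ?E"
      using inj D(1) by (auto simp: inj_on_def \<sigma>\<theta>)
    show "\<exists>N::int. (\<Prod>\<sigma>\<in>?E. \<sigma> x) = of_int N \<and> \<bar>N\<bar> \<ge> 1" if "x \<in> ring_of_integers" "x \<noteq> 0" for x
      by (rule abs_norm_ge_1[OF nf tr that]) blast
    show "\<exists>c. y = (\<Sum>j<n. of_rat (c j) * \<theta> ^ j)" for y
    proof -
      obtain c where c: "y = (\<Sum>j<n. of_rat (c j) * \<theta>0 ^ j)" using basis by blast
      define p :: "rat poly" where "p = (\<Sum>j<n. monom (c j) j)"
      \<comment> \<open>\<open>l\<close> inverts \<theta> = D \<theta>0 + M. Substituting a linear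
        polynomial keeps degrees below n, so the powers of \<theta> span as well.\<close>
      define l :: "rat poly" where "l = [:- (of_nat M / of_nat D), 1 / of_nat D:]"
      have dp: "degree p \<le> n - 1" by (rule degree_le) (auto simp: p_def coeff_sum)
      have l\<theta>: "ratp l \<theta> = \<theta>0"
        using D(1) by (simp add: l_def ratp_pCons \<theta>_def of_rat_divide of_rat_minus field_simps)
      have "ratp p \<theta>0 = (\<Sum>j\<le>n - 1. of_rat (coeff p j) * \<theta>0 ^ j)"
        unfolding ratp_altdef by (rule sum.mono_neutral_left) (use dp in \<open>auto simp: coeff_eq_0\<close>)
      also have "\<dots> = (\<Sum>j<n. of_rat (coeff p j) * \<theta>0 ^ j)" using n0 by (intro sum.cong) auto
      also have "\<dots> = y" unfolding c by (intro sum.cong refl) (simp add: p_def coeff_sum)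
      finally have "ratp p \<theta>0 = y" .
      then have y: "y = ratp (pcompose p l) \<theta>" by (simp add: ratp_pcompose l\<theta>)
      have "degree (pcompose p l) \<le> n - 1" using dp D(1) by (simp add: degree_pcompose l_def)
      then have "ratp (pcompose p l) \<theta> = (\<Sum>j\<le>n - 1. of_rat (coeff (pcompose p l) j) * \<theta> ^ j)"
        unfolding ratp_altdef by (intro sum.mono_neutral_left) (auto simp: coeff_eq_0)
      also have "\<dots> = (\<Sum>j<n. of_rat (coeff (pcompose p l) j) * \<theta> ^ j)" using n0 by (intro sum.cong) auto
      finally show ?thesis unfolding y by (rule exI[of _ "coeff (pcompose p l)"])
    qed
  qed
  then show ?thesis unfolding n_def by blast
qed

subsection \<open>Universal forms\<close>

lemma represents_iff_diag_rep: "represents m as \<alpha> \<longleftrightarrow> diag_rep m ring_of_integers as \<alpha>"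
proof -
  have "diagonal_form m as xs = dot as (map (\<lambda>x. x ^ m) xs)" if "length xs = length as" for xs
    unfolding diagonal_form_def using that
    by (induction xs as rule: list_induct2) (simp_all add: sum.lessThan_Suc_shift del: sum.lessThan_Suc)
  then show ?thesis unfolding represents_def diag_rep_def by auto
qed

lemma diag_rep_scale:
  fixes \<tau> :: "'k::field_char_0"
  assumes "diag_rep m (UNIV :: nat set) as N"
  shows "diag_rep m ring_of_integers (map (\<lambda>a. of_nat a * \<tau>) as) (of_nat N * \<tau>)"
proof -
  obtain xs where xs: "length xs = length as" "N = dot as (map (\<lambda>x. x ^ m) xs)"
    using assms unfolding diag_rep_def by blast
  have "dot (map (\<lambda>a. of_nat a * \<tau>) as) (map (\<lambda>x. x ^ m) (map of_nat xs)) = of_nat (dot as (map (\<lambda>x. x ^ m) xs)) * \<tau>"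
    using xs(1) by (induction xs as rule: list_induct2) (simp_all add: algebra_simps)
  moreover have "set (map of_nat xs) \<subseteq> (ring_of_integers :: 'k set)"
    using ring_of_integers_closed(5)[of "int _"] by auto
  ultimately show ?thesis unfolding diag_rep_def using xs by (intro exI[of _ "map of_nat xs"]) auto
qed

lemma diag_rep_concat_member:
  assumes "m > 0" "0 \<in> S" "i \<in> set L" "diag_rep m S (f i) x"
  shows "diag_rep m S (concat (map f L)) x"
  using assms(3)
proof (induction L)
  case (Cons a L)
  show ?case
  proof (cases "i = a")
    case True
    then show ?thesis using diag_rep_append[OF assms(4) diag_rep_0[OF assms(1,2)]] by simp
  next
    case False
    then have "diag_rep m S (concat (map f L)) x" using Cons by simp
    from diag_rep_append[OF diag_rep_0[OF assms(1,2)] this] show ?thesis by simp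
  qed
qed simp

lemma diag_rep_concat_sum:
  assumes "m > 0" "0 \<in> S" "\<And>i. i \<in> set L \<Longrightarrow> diag_rep m S (f i) (g i)"
  shows "diag_rep m S (concat (map f L)) (\<Sum>i\<leftarrow>L. g i)"
  using assms(3)
proof (induction L)
  case Nil
  then show ?case using diag_rep_0[OF assms(1,2), of "[]"] by simp
next
  case (Cons a L)
  then show ?case using diag_rep_append[of m S "f a" "g a" "concat (map f L)"] by simp
qed

lemma diag_rep_single: "x \<in> S \<Longrightarrow> diag_rep m S [a] (a * x ^ m)"
  unfolding diag_rep_def by (intro exI[of _ "[x]"]) simp

text \<open>Every integer \<open>N \<ge> 2\<close> is \<open>2 a + 3 b\<close>, so multiples of \<open>\<tau>\<close> need only the decomposable coefficients \<open>2 \<tau>\<close>, \<open>3 \<tau>\<close>.\<close>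

definition multiples_form :: "nat list \<Rightarrow> 'k::field_char_0 \<Rightarrow> 'k list" where
  "multiples_form ws \<tau> = map (\<lambda>a. of_nat a * (of_nat 2 * \<tau>)) ws @ map (\<lambda>a. of_nat a * (of_nat 3 * \<tau>)) ws"

lemma multiples_form_rep:
  assumes "\<And>N. diag_rep m UNIV ws N" "N \<ge> 2"
  shows "diag_rep m ring_of_integers (multiples_form ws \<tau>) (of_nat N * \<tau>)"
proof -
  obtain a b where ab: "N = a * 2 + b * 3"
  proof (cases "even N")
    case True
    then show ?thesis using that[of "N div 2" 0] by simp
  next
    case False
    then have "N \<ge> 3" using assms(2) by (cases "N = 2") auto
    moreover have "even (N - 3)" using False by simp
    ultimately show ?thesis using that[of "(N - 3) div 2" 1] by simp
  qed
  have "diag_rep m ring_of_integers (multiples_form ws \<tau>) (of_nat a * (of_nat 2 * \<tau>) + of_nat b * (of_nat 3 * \<tau>))"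
    unfolding multiples_form_def by (intro diag_rep_append diag_rep_scale assms(1))
  then show ?thesis by (simp add: ab algebra_simps)
qed

section \<open>Decomposable coefficients and values of definite forms\<close>

context integral_frame
begin

lemma positive_integers_closed:
  fixes x y u :: 'k
  shows "x \<in> positive_integers \<Longrightarrow> y \<in> positive_integers \<Longrightarrow> x + y \<in> positive_integers"
    and "x \<in> positive_integers \<Longrightarrow> N > 0 \<Longrightarrow> of_nat N * x \<in> positive_integers"
    and "even m \<Longrightarrow> x \<in> positive_integers \<Longrightarrow> u \<in> ring_of_integers \<Longrightarrow> u \<noteq> 0 \<Longrightarrow> x * u ^ m \<in> positive_integers"
    and "x \<in> positive_integers \<Longrightarrow> x \<noteq> 0"
proof -
  show "x \<in> positive_integers \<Longrightarrow> y \<in> positive_integers \<Longrightarrow> x + y \<in> positive_integers"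
    by (simp add: positive_integers_def totally_positive_iff ring_of_integers_closed emb_simps add_pos_pos)
  show "x \<in> positive_integers \<Longrightarrow> N > 0 \<Longrightarrow> of_nat N * x \<in> positive_integers"
    using ring_of_integers_closed(5)[of "int N", where 'k = 'k]
    by (simp add: positive_integers_def totally_positive_iff ring_of_integers_closed emb_simps)
  show "x * u ^ m \<in> positive_integers" if "even m" "x \<in> positive_integers" "u \<in> ring_of_integers" "u \<noteq> 0"
  proof -
    have "\<sigma> (x * u ^ m) > 0" if \<sigma>: "\<sigma> \<in> E" for \<sigma>
    proof -
      have "\<sigma> u \<noteq> 0" using \<open>u \<noteq> 0\<close> \<sigma> by (simp add: emb_simps)
      then have "\<sigma> u ^ m > 0" using \<open>even m\<close> by (simp add: zero_less_power_eq)
      moreover have "\<sigma> x > 0" using \<open>x \<in> positive_integers\<close> \<sigma> by (simp add: positive_integers_def totally_positive_iff)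
      ultimately show ?thesis using \<sigma> by (simp add: emb_simps)
    qed
    then show ?thesis using that by (simp add: positive_integers_def totally_positive_iff ring_of_integers_closed)
  qed
  show "x \<in> positive_integers \<Longrightarrow> x \<noteq> 0"
    using E_nonempty by (auto simp: positive_integers_def totally_positive_iff emb_simps)
qed

lemma power_theta_positive: "\<theta> ^ j \<in> positive_integers"
  using \<theta>_int \<theta>_pos by (simp add: positive_integers_def totally_positive_iff ring_of_integers_closed emb_simps)

lemma multiples_form_decomposable:
  assumes "\<And>a. a \<in> set ws \<Longrightarrow> a > 0" "\<tau> \<in> positive_integers" "x \<in> set (multiples_form ws \<tau>)"
  shows "x \<in> decomposables"
proof -
  obtain a where a: "a \<in> set ws" "x = of_nat a * (of_nat 2 * \<tau>) \<or> x = of_nat a * (of_nat 3 * \<tau>)"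
    using assms(3) by (auto simp: multiples_form_def)
  then have "x = of_nat a * \<tau> + of_nat a * \<tau> \<or> x = of_nat a * \<tau> + of_nat (2 * a) * \<tau>"
    by (auto simp: algebra_simps)
  moreover have "of_nat a * \<tau> \<in> positive_integers" "of_nat (2 * a) * \<tau> \<in> positive_integers"
    using assms(1)[OF a(1)] by (intro positive_integers_closed assms(2); simp)+
  ultimately show ?thesis unfolding decomposables_def by blast
qed

lemma decomposables_positive: "x \<in> decomposables \<Longrightarrow> x \<in> positive_integers"
  unfolding decomposables_def using positive_integers_closed(1) by blast

lemma decomposables_mult:
  assumes "even m" "x \<in> decomposables" "u \<in> ring_of_integers" "u \<noteq> 0"
  shows "x * u ^ m \<in> decomposables"
proof -
  obtain y z where "x = y + z" "y \<in> positive_integers" "z \<in> positive_integers"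
    using assms(2) by (auto simp: decomposables_def)
  then have "x * u ^ m = y * u ^ m + z * u ^ m" "y * u ^ m \<in> positive_integers" "z * u ^ m \<in> positive_integers"
    using assms by (auto simp: distrib_right intro: positive_integers_closed)
  then show ?thesis unfolding decomposables_def by blast
qed

lemma indecomposable_iff: "indecomposable x \<longleftrightarrow> x \<in> positive_integers \<and> x \<notin> decomposables"
  by (auto simp: indecomposable_def decomposables_def)

lemma indecomposable_dot:
  fixes as xs :: "'k list"
  assumes "even m" "m > 0" "length as = length xs" "set as \<subseteq> positive_integers" "set xs \<subseteq> ring_of_integers"
    "indecomposable (dot as (map (\<lambda>x. x ^ m) xs))"
  shows "\<exists>a\<in>set as. \<exists>x\<in>set xs. dot as (map (\<lambda>x. x ^ m) xs) = a * x ^ m"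
proof -
  have trm: "a * x ^ m = 0 \<or> a * x ^ m \<in> positive_integers" if "a \<in> positive_integers" "x \<in> ring_of_integers" for a x :: 'k
    using positive_integers_closed(3)[OF assms(1) that] assms(2) by (cases "x = 0") auto
  \<comment> \<open>The tails of the sum are zero or totally positive as well, so in an
    indecomposable value either the first term or the tail vanishes.\<close>
  have dot: "dot as (map (\<lambda>x. x ^ m) xs) = 0 \<or> dot as (map (\<lambda>x. x ^ m) xs) \<in> positive_integers"
    if "length as = length xs" "set as \<subseteq> positive_integers" "set xs \<subseteq> ring_of_integers" for as xs :: "'k list"
    using that
  proof (induction as xs rule: list_induct2)
    case (Cons a as x xs)
    then have "a * x ^ m = 0 \<or> a * x ^ m \<in> positive_integers" by (intro trm) auto
    moreover have "dot as (map (\<lambda>x. x ^ m) xs) = 0 \<or> dot as (map (\<lambda>x. x ^ m) xs) \<in> positive_integers"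
      using Cons by simp
    moreover have "s + d = 0 \<or> s + d \<in> positive_integers"
      if "s = 0 \<or> s \<in> positive_integers" "d = 0 \<or> d \<in> positive_integers" for s d :: 'k
      using that positive_integers_closed(1)[of s d] by auto
    ultimately show ?case unfolding list.map dot.simps by blast
  qed simp
  show ?thesis using assms(3-6)
  proof (induction as xs rule: list_induct2)
    case Nil
    then show ?case using positive_integers_closed(4)[of 0] by (simp add: indecomposable_def)
  next
    case (Cons a as x xs)
    let ?d = "dot as (map (\<lambda>x. x ^ m) xs)"
    have d: "?d = 0 \<or> ?d \<in> positive_integers" using Cons by (intro dot) auto
    have t: "a * x ^ m = 0 \<or> a * x ^ m \<in> positive_integers" using Cons by (intro trm) auto
    have "a * x ^ m = 0 \<or> ?d = 0"
      using d t Cons.prems(3) unfolding indecomposable_def by auto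
    then show ?case
    proof
      assume "?d = 0"
      then show ?thesis by simp
    next
      assume z: "a * x ^ m = 0"
      have "indecomposable ?d" using Cons.prems(3) by (simp only: list.map dot.simps z add_0_left)
      then obtain b y where b: "b \<in> set as" "y \<in> set xs" "?d = b * y ^ m" using Cons.IH Cons.prems by auto
      then have "dot (a # as) (map (\<lambda>x. x ^ m) (x # xs)) = b * y ^ m" by (simp only: list.map dot.simps z add_0_left)
      then have "\<exists>y\<in>set (x # xs). dot (a # as) (map (\<lambda>x. x ^ m) (x # xs)) = b * y ^ m"
        by (rule bexI) (use b(2) in simp)
      then show ?thesis by (rule bexI) (use b(1) in simp)
    qed
  qed
qed

lemma equiv_unit_power_rel: "equiv positive_integers (unit_power_rel m :: ('k \<times> 'k) set)"
proof (rule equivI)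
  have one: "(1::'k) \<in> integer_units" using ring_of_integers_closed(5)[of 1, where 'k = 'k] by (auto simp: integer_units_def)
  show "unit_power_rel m \<subseteq> positive_integers \<times> (positive_integers :: 'k set)" by (auto simp: unit_power_rel_def)
  show "refl_on positive_integers (unit_power_rel m :: ('k \<times> 'k) set)"
    using one by (auto simp: refl_on_def unit_power_rel_def intro!: bexI[of _ 1])
  show "sym (unit_power_rel m :: ('k \<times> 'k) set)"
  proof (rule symI)
    fix x y :: 'k assume "(x, y) \<in> unit_power_rel m"
    then obtain u where u: "x \<in> positive_integers" "y \<in> positive_integers" "u \<in> integer_units" "y = x * u ^ m"
      by (auto simp: unit_power_rel_def)
    obtain v where v: "v \<in> integer_units" "u * v = 1" by (rule units_closed[OF u(3)]) (rule that)
    have "y * v ^ m = x * (u * v) ^ m" by (simp add: u(4) power_mult_distrib)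
    then have "x = y * v ^ m" using v(2) by simp
    then show "(y, x) \<in> unit_power_rel m" using u v by (auto simp: unit_power_rel_def)
  qed
  show "trans (unit_power_rel m :: ('k \<times> 'k) set)"
  proof (rule transI)
    fix x y z :: 'k assume "(x, y) \<in> unit_power_rel m" "(y, z) \<in> unit_power_rel m"
    then obtain u w where uw: "x \<in> positive_integers" "z \<in> positive_integers" "u \<in> integer_units" "y = x * u ^ m"
      "w \<in> integer_units" "z = y * w ^ m"
      by (auto simp: unit_power_rel_def)
    obtain u' where u': "u' \<in> ring_of_integers" "u * u' = 1" using uw(3) by (auto simp: integer_units_def)
    obtain w' where w': "w' \<in> ring_of_integers" "w * w' = 1" using uw(5) by (auto simp: integer_units_def)
    have "u * w * (u' * w') = (u * u') * (w * w')" by (simp add: mult_ac)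
    then have "u * w * (u' * w') = 1" using u'(2) w'(2) by simp
    then have "u * w \<in> integer_units"
      using uw(3,5) u'(1) w'(1) unfolding integer_units_def by (auto intro: ring_of_integers_closed intro!: bexI[of _ "u' * w'"])
    moreover have "z = x * (u * w) ^ m" by (simp add: uw(4,6) power_mult_distrib mult.assoc)
    ultimately show "(x, z) \<in> unit_power_rel m" using uw(1,2) by (auto simp: unit_power_rel_def)
  qed
qed

end

theorem theorem9p8:
  fixes m :: nat
  assumes "number_field TYPE('k::field_char_0)"
    and "totally_real TYPE('k)"
    and "m \<ge> 2"
    and "even m"
  shows "{unit_power_rel m `` {\<alpha>} | \<alpha>::'k. indecomposable \<alpha> \<and> powerfree m \<alpha>}
           \<subseteq> critical_classes m"
proof -
  obtain \<theta> :: 'k where "integral_frame real_embeddings \<theta> (card (real_embeddings :: ('k \<Rightarrow> real) set))"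
    using integral_frame_exists[OF assms(1,2)] by blast
  then interpret integral_frame "real_embeddings :: ('k \<Rightarrow> real) set" \<theta> "card (real_embeddings :: ('k \<Rightarrow> real) set)" .
  let ?n = "card (real_embeddings :: ('k \<Rightarrow> real) set)"
  let ?O = "ring_of_integers :: 'k set"
  have m0: "m > 0" using assms(3) by simp
  have zero: "0 \<in> ?O" using ring_of_integers_closed(5)[of 0] by simp
  obtain k where mk: "m = 2 * k" using assms(4) by blast
  have "k \<ge> 1" using m0 mk by simp
  obtain ws :: "nat list" where ws: "\<And>a. a \<in> set ws \<Longrightarrow> a > 0" and waring': "\<And>N. diag_rep (2 * k) UNIV ws N"
    by (rule waring_even[OF \<open>k \<ge> 1\<close>]) (rule that)
  note waring = waring'[folded mk]
  have "\<exists>c C. c > 0 \<and> (\<forall>\<beta>\<in>positive_integers. \<exists>u\<in>integer_units. \<exists>R>0. \<forall>\<sigma>\<in>real_embeddings.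
      c * R \<le> \<sigma> (\<beta> * u ^ m) \<and> \<sigma> ((\<beta>::'k) * u ^ m) \<le> C * R)"
    by (rule balanced_representative[OF m0 assms(4)]) blast
  then obtain c C :: real where c: "c > 0"
    and balanced: "\<forall>\<beta>\<in>positive_integers. \<exists>u\<in>integer_units. \<exists>R>0. \<forall>\<sigma>\<in>real_embeddings.
      c * R \<le> \<sigma> (\<beta> * u ^ m) \<and> \<sigma> ((\<beta>::'k) * u ^ m) \<le> C * R" by (elim exE conjE)
  define F where "F = bounded_positive (8 * C * W / c)"
  define P where "P = bounded_positive (3 * W) \<inter> decomposables"
  have "finite F" "finite P" by (simp_all add: F_def P_def finite_bounded_positive)
  obtain LF where LF: "set LF = F" using finite_list[OF \<open>finite F\<close>] by blast
  obtain LP where LP: "set LP = P" using finite_list[OF \<open>finite P\<close>] by blast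
  have FO: "x \<in> positive_integers" if "x \<in> F" for x using that by (simp add: F_def bounded_positive_def)
  show ?thesis
  proof
    fix Cl :: "'k set" assume "Cl \<in> {unit_power_rel m `` {\<alpha>} | \<alpha>::'k. indecomposable \<alpha> \<and> powerfree m \<alpha>}"
    then obtain \<alpha> :: 'k where Cl: "Cl = unit_power_rel m `` {\<alpha>}" and ind: "indecomposable \<alpha>" and pf: "powerfree m \<alpha>" by blast
    have \<alpha>: "\<alpha> \<in> positive_integers" "\<alpha> \<notin> decomposables" using ind by (simp_all add: indecomposable_iff)
    \<comment> \<open>\<open>A1\<close> has a block for each \<tau> in \<open>F\<close>, of which a
      given element uses one, while the blocks of \<open>A2\<close> are used together.
      \<open>LP\<close> and \<open>A4\<close> list the possible \<rho> and the exceptional small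
      elements, each represented by itself. Only \<open>A4\<close> can contain indecomposables, and
      the class of \<alpha> is removed from it.\<close>
    define A1 where "A1 = concat (map (multiples_form ws) LF)"
    define A2 where "A2 = concat (map (\<lambda>j. multiples_form ws (\<theta> ^ j)) [0..<?n])"
    define A4 where "A4 = filter (\<lambda>x. (\<alpha>, x) \<notin> unit_power_rel m) LF"
    define as where "as = A1 @ A2 @ LP @ A4"
    have dec: "x \<in> decomposables \<or> x \<in> F \<and> (\<alpha>, x) \<notin> unit_power_rel m" if "x \<in> set as" for x
    proof -
      have "x \<in> set A1 \<or> x \<in> set A2 \<or> x \<in> P \<or> x \<in> set A4" using that LP by (auto simp: as_def)
      then show ?thesis
      proof (elim disjE)
        assume "x \<in> set A1"
        then obtain \<tau> where "\<tau> \<in> F" "x \<in> set (multiples_form ws \<tau>)" using LF by (auto simp: A1_def)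
        then show ?thesis using multiples_form_decomposable[OF ws FO] by blast
      next
        assume "x \<in> set A2"
        then obtain j where "x \<in> set (multiples_form ws (\<theta> ^ j))" by (auto simp: A2_def)
        then show ?thesis using multiples_form_decomposable[OF ws power_theta_positive] by blast
      qed (use LF in \<open>auto simp: P_def A4_def\<close>)
    qed
    have asP: "set as \<subseteq> positive_integers" using dec FO decomposables_positive by blast
    have nonrep: "\<not> represents_class m as Cl"
    proof
      assume "represents_class m as Cl"
      then obtain \<alpha>' where \<alpha>': "(\<alpha>, \<alpha>') \<in> unit_power_rel m" "represents m as \<alpha>'"
        by (auto simp: represents_class_def Cl)
      then obtain u where u: "u \<in> integer_units" "\<alpha>' = \<alpha> * u ^ m" "\<alpha>' \<in> positive_integers" by (auto simp: unit_power_rel_def)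
      obtain v where v: "v \<in> integer_units" "u * v = 1" "v \<noteq> 0" by (rule units_closed[OF u(1)]) (rule that)
      have vO: "v \<in> ?O" using v(1) by (simp add: integer_units_def)
      have "\<alpha>' * v ^ m = \<alpha> * (u * v) ^ m" by (simp add: u(2) power_mult_distrib)
      then have \<alpha>v: "\<alpha> = \<alpha>' * v ^ m" using v(2) by simp
      have "\<alpha>' \<notin> decomposables" using decomposables_mult[OF assms(4) _ vO v(3), of \<alpha>'] \<alpha>(2) \<alpha>v by auto
      then have ind': "indecomposable \<alpha>'" using u(3) by (simp add: indecomposable_iff)
      obtain xs where xs: "length xs = length as" "set xs \<subseteq> ?O" "\<alpha>' = dot as (map (\<lambda>x. x ^ m) xs)"
        using \<alpha>'(2) unfolding represents_iff_diag_rep diag_rep_def by blast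
      obtain a x where ax: "a \<in> set as" "x \<in> set xs" "\<alpha>' = a * x ^ m"
        using indecomposable_dot[OF assms(4) m0 xs(1)[symmetric] asP xs(2)] ind' unfolding xs(3)[symmetric] by blast
      have xO: "x \<in> ?O" using xs(2) ax(2) by blast
      have "\<alpha>' \<noteq> 0" using u(3) by (rule positive_integers_closed(4))
      then have "x \<noteq> 0" using ax(3) m0 by auto
      \<comment> \<open>A decomposable a would make \<alpha>' = a x^m decomposable; so
        \<open>dec\<close> leaves only coefficients outside the class of \<alpha>.\<close>
      then have "a \<notin> decomposables" using decomposables_mult[OF assms(4) _ xO, of a] \<open>\<alpha>' \<notin> decomposables\<close> ax(3) by auto
      then have a: "(\<alpha>, a) \<notin> unit_power_rel m" using dec[OF ax(1)] by blast
      have \<alpha>eq: "\<alpha> = (x * v) ^ m * a" unfolding \<alpha>v ax(3) by (simp add: power_mult_distrib mult_ac)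
      have aP: "a \<in> positive_integers" using ax(1) asP by blast
      \<comment> \<open>Powerfreeness enters here: it makes x v a unit, which puts a into the class
        of \<alpha>, a contradiction.\<close>
      have "integer_dvd ((x * v) ^ m) \<alpha>"
        unfolding integer_dvd_def using \<alpha>eq aP by (intro bexI[of _ a]) (auto simp: positive_integers_def)
      then have "x * v \<in> integer_units" using pf ring_of_integers_closed(2)[OF xO vO] by (simp add: powerfree_def)
      then obtain w where w: "w \<in> integer_units" "x * v * w = 1" by (rule units_closed) (rule that)
      have "\<alpha> * w ^ m = a * (x * v * w) ^ m" unfolding \<alpha>eq by (simp add: power_mult_distrib mult_ac)
      then have "a = \<alpha> * w ^ m" using w(2) by simp
      then have "(\<alpha>, a) \<in> unit_power_rel m" using \<alpha>(1) aP w(1) by (auto simp: unit_power_rel_def)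
      then show False using a by simp
    qed
    have rep: "represents_class m as D" if D: "D \<in> positive_classes m - {Cl}" for D
    proof -
      obtain \<beta> where \<beta>: "\<beta> \<in> positive_integers" "D = unit_power_rel m `` {\<beta>}"
        using D by (auto simp: positive_classes_def quotient_def)
      \<comment> \<open>It is enough to represent one element of the class, and a balanced one is
        chosen.\<close>
      obtain u R where u: "u \<in> integer_units" and R: "R > 0"
        and bal: "\<forall>\<sigma>\<in>real_embeddings. c * R \<le> \<sigma> (\<beta> * u ^ m) \<and> \<sigma> (\<beta> * u ^ m) \<le> C * R"
        using bspec[OF balanced \<beta>(1)] by blast
      define \<beta>' where "\<beta>' = \<beta> * u ^ m"
      have "u \<noteq> 0" by (rule units_closed[OF u])
      then have \<beta>'P: "\<beta>' \<in> positive_integers"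
        unfolding \<beta>'_def using u \<beta>(1) assms(4) by (intro positive_integers_closed(3)) (auto simp: integer_units_def)
      have rel: "(\<beta>, \<beta>') \<in> unit_power_rel m" using \<beta>(1) \<beta>'P u by (auto simp: unit_power_rel_def \<beta>'_def)
      have "diag_rep m ?O as \<beta>'"
        using balanced_decomposition[OF c R \<beta>'P bal[folded \<beta>'_def]]
      proof
        assume "\<beta>' \<in> bounded_positive (8 * C * W / c)"
        then have \<beta>'F: "\<beta>' \<in> F" by (simp add: F_def)
        have "(\<alpha>, \<beta>') \<notin> unit_power_rel m"
        proof
          assume "(\<alpha>, \<beta>') \<in> unit_power_rel m"
          then have "unit_power_rel m `` {\<alpha>} = unit_power_rel m `` {\<beta>'}" by (rule equiv_class_eq[OF equiv_unit_power_rel])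
          moreover have "unit_power_rel m `` {\<beta>} = unit_power_rel m `` {\<beta>'}" by (rule equiv_class_eq[OF equiv_unit_power_rel rel])
          ultimately show False using D \<beta>(2) Cl by simp
        qed
        then have "\<beta>' \<in> set A4" using \<beta>'F LF by (simp add: A4_def)
        moreover have "diag_rep m ?O [\<beta>'] (\<beta>' * 1 ^ m)"
          by (rule diag_rep_single) (use ring_of_integers_closed(5)[of 1] in simp)
        ultimately have "diag_rep m ?O (concat (map (\<lambda>x. [x]) A4)) \<beta>'"
          using diag_rep_concat_member[OF m0 zero, of \<beta>' A4 "\<lambda>x. [x]" \<beta>'] by simp
        then have "diag_rep m ?O A4 \<beta>'" by simp
        then have "diag_rep m ?O as (0 + (0 + (0 + \<beta>')))"
          unfolding as_def by (intro diag_rep_append diag_rep_0 m0 zero)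
        then show ?thesis by simp
      next
        assume "\<exists>N \<tau> k \<rho>. N \<ge> 2 \<and> \<tau> \<in> bounded_positive (8 * C * W / c) \<and> (\<forall>j<?n. k j \<ge> 2) \<and>
          \<rho> \<in> bounded_positive (3 * W) \<inter> decomposables \<and> \<beta>' = of_nat N * \<tau> + (\<Sum>j<?n. of_nat (k j) * \<theta> ^ j) + \<rho>"
        then obtain N \<tau> k \<rho> where N: "N \<ge> 2" and \<tau>: "\<tau> \<in> F" and k: "\<forall>j<?n. k j \<ge> 2" and \<rho>: "\<rho> \<in> P"
          and eq: "\<beta>' = of_nat N * \<tau> + (\<Sum>j<?n. of_nat (k j) * \<theta> ^ j) + \<rho>"
          unfolding F_def[symmetric] P_def[symmetric] by (elim exE conjE)
        have 1: "diag_rep m ?O A1 (of_nat N * \<tau>)"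
          unfolding A1_def by (rule diag_rep_concat_member[OF m0 zero, of \<tau>]) (use \<tau> LF multiples_form_rep[OF waring N] in auto)
        have "diag_rep m ?O A2 (\<Sum>j\<leftarrow>[0..<?n]. of_nat (k j) * \<theta> ^ j)"
          unfolding A2_def by (rule diag_rep_concat_sum[OF m0 zero]) (use multiples_form_rep[OF waring] k in auto)
        then have 2: "diag_rep m ?O A2 (\<Sum>j<?n. of_nat (k j) * \<theta> ^ j)"
          by (simp add: interv_sum_list_conv_sum_set_nat lessThan_atLeast0)
        have "diag_rep m ?O [\<rho>] (\<rho> * 1 ^ m)"
          by (rule diag_rep_single) (use ring_of_integers_closed(5)[of 1] in simp)
        then have "diag_rep m ?O (concat (map (\<lambda>x. [x]) LP)) \<rho>"
          using diag_rep_concat_member[OF m0 zero, of \<rho> LP "\<lambda>x. [x]" \<rho>] \<rho> LP by simp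
        then have 3: "diag_rep m ?O LP \<rho>" by simp
        have "diag_rep m ?O as (of_nat N * \<tau> + ((\<Sum>j<?n. of_nat (k j) * \<theta> ^ j) + (\<rho> + 0)))"
          unfolding as_def by (intro diag_rep_append diag_rep_0 m0 zero 1 2 3)
        then show ?thesis unfolding eq by (simp add: add.assoc)
      qed
      then show ?thesis unfolding represents_class_def represents_iff_diag_rep using rel \<beta>(2) by blast
    qed
    have "Cl \<in> positive_classes m" unfolding positive_classes_def Cl by (rule quotientI) (rule \<alpha>(1))
    then show "Cl \<in> critical_classes m"
      unfolding critical_classes_def totally_positive_definite_def using asP nonrep rep by blast
  qed
qed

end
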